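(* Let $d$ be a sufficiently large positive integer, let $\alpha\in(0,1)$ satisfy $\alpha \gg d^{-\mathrm{polylog}(d)}$, let $\rho>0$ satisfy $\rho^2 \asymp \alpha^2\,\mathrm{polylog}(d/\alpha)$ and $\rho\le \rho_0$ for a sufficiently small absolute constant $\rho_0>0$, let $s\asymp \alpha$ (with a suitable absolute constant), let $\sigma=\sqrt{1-\rho^2}$, and let $E=\mathrm{DG}(0,\sigma,0,s)$. Consider the testing problem $\mathrm{Test}(d,\rho,E)$. Then: (1) $\mathbb P_{Z\sim E}(Z=0)\ge \alpha$; (2) any SQ algorithm that solves $\mathrm{Test}(d,\rho,E)$ with success probability at least $2/3$ either uses $q\gtrsim q_0:=d^{\log^2(d/\alpha)}$ queries, or uses at least one query to $\mathrm{VSTAT}(m)$ with $m\gtrsim \frac{\sqrt d}{\alpha^2\,\mathrm{polylog}(d,1/\alpha)}$.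
   Context: Notation: $a\lesssim b$ / $a\gtrsim b$ means $a\le Cb$ / $a\ge Cb$ for an absolute constant $C>0$, $a\asymp b$ means both; $\mathrm{polylog}$ denotes an unspecified polylogarithmic factor. Discrete Gaussian: for $\mu\in\mathbb R$, $\sigma>0$, $\theta\in\mathbb R$, $s>0$, $\mathrm{DG}(\mu,\sigma,\theta,s)$ is the probability distribution supported on $\theta+s\mathbb Z$ that assigns to each point $\theta+si$ ($i\in\mathbb Z$) probability proportional to $\phi_{\mu,\sigma}(\theta+si)$, where $\phi_{\mu,\sigma}$ is the density of $\mathcal N(\mu,\sigma^2)$. For a univariate distribution $E$, $R^*_{\rho,E}$ denotes the law of $G+z$ with $G\sim\mathcal N(0,\rho^2)$ and $z\sim E$ independent. Testing problem $\mathrm{Test}(d,\rho,E)$: a hidden bit $\Gamma\sim\mathrm{Ber}(1/2)$ and a hidden uniformly random unit vector $v\in S^{d-1}$ are drawn independently. If $\Gamma=0$ ("null"), the unknown distribution of $(x,y)\in\mathbb R^d\times\mathbb R$ is $P$: $x\sim\mathcal N(0,I_d)$ and $y\sim R^*_{\rho,E}$ independently. If $\Gamma=1$ ("alternate"), it is $Q_v$: $x\sim\mathcal N(0,I_d)$, $y=\rho v^\top x+z$ with $z\sim E$ independent of $x$. The algorithm must output a guess $\widehat\Gamma$ of $\Gamma$. VSTAT oracle: for a distribution $D$ and $m\in\mathbb N$, a $\mathrm{VSTAT}(m)$ oracle, given a query $f:\mathbb R^d\times\mathbb R\to[0,1]$, returns any value $u$ with $|u-\mathbb E_D[f]|\le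 \max\{1/m,\sqrt{\mathbb E_D[f](1-\mathbb E_D[f])/m}\}$. An SQ algorithm accesses the unknown distribution only through (possibly adaptive and randomized) queries to such oracles; it solves the problem with success probability $p$ if for every valid oracle answering its queries, $\mathbb P(\widehat\Gamma=\Gamma)\ge p$. *)

theory Defs
  imports "HOL-Probability.Probability"
begin

section \<open>Distributions\<close>

text \<open>The dimension \<open>d\<close> is quantified inside the theorem, so a vector of \<open>\<real>\<^sup>d\<close> is a function in
  \<open>PiE {..<d} (\<lambda>_. UNIV)\<close>, and a data point is a pair \<open>(x, y)\<close> of such a vector and a real.\<close>

type_synonym point = "(nat \<Rightarrow> real) \<times> real"

abbreviation vec_space :: "nat \<Rightarrow> (nat \<Rightarrow> real) measure" where
  "vec_space d \<equiv> PiM {..<d} (\<lambda>_. borel)"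

abbreviation point_space :: "nat \<Rightarrow> point measure" where
  "point_space d \<equiv> vec_space d \<Otimes>\<^sub>M borel"

definition gaussian :: "real \<Rightarrow> real \<Rightarrow> real measure" where
  "gaussian \<mu> \<sigma> = density lborel (\<lambda>x. ennreal (normal_density \<mu> \<sigma> x))"

definition gaussian_vec :: "nat \<Rightarrow> (nat \<Rightarrow> real) measure" where
  "gaussian_vec d = PiM {..<d} (\<lambda>_. gaussian 0 1)"

definition dot :: "nat \<Rightarrow> (nat \<Rightarrow> real) \<Rightarrow> (nat \<Rightarrow> real) \<Rightarrow> real" where
  "dot d v x = (\<Sum>i<d. v i * x i)"

definition unit_sphere :: "nat \<Rightarrow> (nat \<Rightarrow> real) set" where
  "unit_sphere d = {v \<in> PiE {..<d} (\<lambda>_. UNIV). sqrt (dot d v v) = 1}"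

text \<open>The uniform distribution on the sphere is the law of \<open>g / \<parallel>g\<parallel>\<close> for a standard Gaussian
  vector \<open>g\<close>; the value at the null event \<open>g = 0\<close> is irrelevant.\<close>

definition uniform_sphere :: "nat \<Rightarrow> (nat \<Rightarrow> real) measure" where
  "uniform_sphere d =
     distr (gaussian_vec d) (vec_space d) (\<lambda>g. \<lambda>i\<in>{..<d}. g i / sqrt (dot d g g))"

definition discrete_gaussian :: "real \<Rightarrow> real \<Rightarrow> real \<Rightarrow> real \<Rightarrow> real measure" where
  "discrete_gaussian \<mu> \<sigma> \<theta> s =
     distr
       (density (count_space (UNIV :: int set))
         (\<lambda>i. ennreal (normal_density \<mu> \<sigma> (\<theta> + s * of_int i) /
                        (\<Sum>\<^sub>\<infinity>j::int. normal_density \<mu> \<sigma> (\<theta> + s * of_int j)))))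
       borel (\<lambda>i. \<theta> + s * of_int i)"

section \<open>The testing problem\<close>

definition response_law :: "real \<Rightarrow> real measure \<Rightarrow> real measure" where
  "response_law \<rho> E = convolution (gaussian 0 \<rho>) E"

definition null_dist :: "nat \<Rightarrow> real \<Rightarrow> real measure \<Rightarrow> point measure" where
  "null_dist d \<rho> E = gaussian_vec d \<Otimes>\<^sub>M response_law \<rho> E"

definition alt_dist :: "nat \<Rightarrow> real \<Rightarrow> real measure \<Rightarrow> (nat \<Rightarrow> real) \<Rightarrow> point measure" where
  "alt_dist d \<rho> E v =
     distr (gaussian_vec d \<Otimes>\<^sub>M E) (point_space d) (\<lambda>(x, z). (x, \<rho> * dot d v x + z))"

definition test_dist ::
  "nat \<Rightarrow> real \<Rightarrow> real measure \<Rightarrow> bool \<Rightarrow> (nat \<Rightarrow> real) \<Rightarrow> point measure" where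
  "test_dist d \<rho> E \<Gamma> v = (if \<Gamma> then alt_dist d \<rho> E v else null_dist d \<rho> E)"

definition test_dists :: "nat \<Rightarrow> real \<Rightarrow> real measure \<Rightarrow> point measure set" where
  "test_dists d \<rho> E = {test_dist d \<rho> E \<Gamma> v | \<Gamma> v. v \<in> unit_sphere d}"

section \<open>Statistical query algorithms\<close>

text \<open>A query \<open>(f, m)\<close> asks for the mean of \<open>f\<close> with the accuracy of \<open>VSTAT(m)\<close>.  The case \<open>m = 0\<close> is excluded,
  because \<open>1 / 0 = 0\<close> would make the answers exact.\<close>

type_synonym query = "(point \<Rightarrow> real) \<times> nat"

definition valid_query :: "nat \<Rightarrow> query \<Rightarrow> bool" where
  "valid_query d = (\<lambda>(f, m). f \<in> borel_measurable (point_space d) \<and>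
     (\<forall>z \<in> space (point_space d). f z \<in> {0..1}) \<and> 1 \<le> m)"

definition vstat_answer :: "point measure \<Rightarrow> query \<Rightarrow> real \<Rightarrow> bool" where
  "vstat_answer D = (\<lambda>(f, m) u. let p = integral\<^sup>L D f in
     \<bar>u - p\<bar> \<le> max (1 / real m) (sqrt (p * (1 - p) / real m)))"

text \<open>Oracles are stateful: their answers may depend on the unknown distribution and on the entire transcript
  of the interaction so far.\<close>

type_synonym transcript = "(query \<times> real) list"

type_synonym vstat_oracle = "point measure \<Rightarrow> transcript \<Rightarrow> query \<Rightarrow> real"

definition valid_oracle :: "nat \<Rightarrow> point measure set \<Rightarrow> vstat_oracle \<Rightarrow> bool" where
  "valid_oracle d \<D> orc \<longleftrightarrow>
     (\<forall>D\<in>\<D>. \<forall>\<tau> q. valid_query d q \<longrightarrow> vstat_answer D q (orc D \<tau> q))"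

datatype action = Query query | Guess bool

primrec query_fun :: "action \<Rightarrow> point \<Rightarrow> real" where
  "query_fun (Query q) = fst q"
| "query_fun (Guess b) = (\<lambda>_. 0)"

primrec query_acc :: "action \<Rightarrow> nat" where
  "query_acc (Query q) = snd q"
| "query_acc (Guess b) = 0"

primrec verdict :: "action \<Rightarrow> bool option" where
  "verdict (Query q) = None"
| "verdict (Guess b) = Some b"

text \<open>A strategy maps the answers received so far to the next action.  A randomized algorithm draws
  a seed from \<open>M\<close> at the start and then follows the strategy selected by the seed.  The seed type is
  fixed to \<open>real\<close>, with an arbitrary probability measure, so that the constants of the theorem cannot
  depend on it; every standard Borel space of seeds embeds into it.\<close>

type_synonym strategy = "real list \<Rightarrow> action"

definition sq_algorithm :: "nat \<Rightarrow> real measure \<Rightarrow> (real \<Rightarrow> strategy) \<Rightarrow> bool" where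
  "sq_algorithm d M A \<longleftrightarrow> prob_space M \<and>
     (\<forall>\<omega>\<in>space M. \<forall>us q. A \<omega> us = Query q \<longrightarrow> valid_query d q) \<and>
     (\<forall>n. let N = M \<Otimes>\<^sub>M vec_space n; B = (\<lambda>(\<omega>, u). A \<omega> (map u [0..<n])) in
        (\<lambda>w. verdict (B w)) \<in> N \<rightarrow>\<^sub>M count_space UNIV \<and>
        (\<lambda>w. query_acc (B w)) \<in> N \<rightarrow>\<^sub>M count_space UNIV \<and>
        (\<lambda>(w, z). query_fun (B w) z) \<in> borel_measurable (N \<Otimes>\<^sub>M point_space d))"

primrec run :: "strategy \<Rightarrow> (transcript \<Rightarrow> query \<Rightarrow> real) \<Rightarrow> nat \<Rightarrow> transcript" where
  "run S r 0 = []"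
| "run S r (Suc n) = (let \<tau> = run S r n in
     case S (map snd \<tau>) of Query q \<Rightarrow> \<tau> @ [(q, r \<tau> q)] | Guess b \<Rightarrow> \<tau>)"

definition outputs :: "strategy \<Rightarrow> (transcript \<Rightarrow> query \<Rightarrow> real) \<Rightarrow> bool \<Rightarrow> bool" where
  "outputs S r b \<longleftrightarrow> (\<exists>n. S (map snd (run S r n)) = Guess b)"

definition test_space :: "nat \<Rightarrow> real measure \<Rightarrow> (bool \<times> (nat \<Rightarrow> real) \<times> real) measure" where
  "test_space d M = measure_pmf (bernoulli_pmf (1/2)) \<Otimes>\<^sub>M (uniform_sphere d \<Otimes>\<^sub>M M)"

definition success_event ::
  "nat \<Rightarrow> real \<Rightarrow> real measure \<Rightarrow> real measure \<Rightarrow> (real \<Rightarrow> strategy) \<Rightarrow> vstat_oracle \<Rightarrow>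
     (bool \<times> (nat \<Rightarrow> real) \<times> real) set" where
  "success_event d \<rho> E M A orc =
     {(\<Gamma>, v, \<omega>) \<in> space (test_space d M). outputs (A \<omega>) (orc (test_dist d \<rho> E \<Gamma> v)) \<Gamma>}"

text \<open>For oracles that depend non-measurably on the distribution or the transcript, the success event
  need not have a probability, so only oracles with a measurable success event are considered.\<close>

definition solves_test ::
  "nat \<Rightarrow> real \<Rightarrow> real measure \<Rightarrow> real measure \<Rightarrow> (real \<Rightarrow> strategy) \<Rightarrow> real \<Rightarrow> bool" where
  "solves_test d \<rho> E M A p \<longleftrightarrow>
     (\<forall>orc. valid_oracle d (test_dists d \<rho> E) orc \<and>
            success_event d \<rho> E M A orc \<in> sets (test_space d M) \<longrightarrow>
        p \<le> measure (test_space d M) (success_event d \<rho> E M A orc))"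

definition possible_runs ::
  "nat \<Rightarrow> real \<Rightarrow> real measure \<Rightarrow> real measure \<Rightarrow> (real \<Rightarrow> strategy) \<Rightarrow> transcript set" where
  "possible_runs d \<rho> E M A =
     {run (A \<omega>) (orc D) n | \<omega> orc D n.
        \<omega> \<in> space M \<and> D \<in> test_dists d \<rho> E \<and> valid_oracle d (test_dists d \<rho> E) orc}"

end

theory Submission
  imports Defs
begin

text \<open>An adversarial oracle answers every query as under the null hypothesis whenever the tolerance permits, so the
  algorithm must find a query \<open>f\<close> whose mean under \<open>Q\<^sub>v\<close> differs from its null mean by more than the tolerance.  Let
  \<open>V\<close> be the set of directions for which a fixed \<open>f\<close> does so.  By Cauchy-Schwarz the average gap over \<open>V\<close> is controlled by
  the average over \<open>v, u \<in> V\<close> of the pairwise correlation of \<open>Q\<^sub>v\<close> and \<open>Q\<^sub>u\<close> relative to the null distribution.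

  If \<open>E\<close> were the Gaussian \<open>N(0, 1 - \<rho>\<^sup>2)\<close>, this correlation would be \<open>1 / (1 - \<rho>\<^sup>2 t)\<close> with \<open>t = v \<bullet> u\<close>.  The lattice
  changes it only by ratios of theta functions, which differ from 1 by \<open>exp (- c \<rho>\<^sup>2 / s\<^sup>2)\<close> as long as \<open>t\<close> is bounded away
  from 1, and \<open>\<rho>\<^sup>2 / s\<^sup>2\<close> is polylogarithmic.  Near \<open>\<bar>t\<bar> = 1\<close> the correlation is at most a multiple of \<open>1 / (1 - \<bar>t\<bar>)\<close>, which
  is integrable against the law of \<open>t\<close>.  Since \<open>\<bar>t\<bar>\<close> exceeds \<open>polylog / sqrt d\<close> with superpolynomially small probability, \<open>V\<close>
  has measure below \<open>1 / q\<^sub>0\<close> unless the accuracy \<open>m\<close> exceeds \<open>sqrt d / (\<alpha>\<^sup>2 polylog)\<close>.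

  For fixed \<open>v\<close>, \<open>Q\<^sub>v\<close> is singular with respect to the null distribution.  The densities therefore come from an
  interpolation that replaces a fraction of the signal \<open>v \<bullet> x\<close> by fresh noise, and a limit argument for the mixture over
  \<open>V\<close> removes the noise.\<close>

section \<open>Periodised Gaussian densities\<close>

text \<open>Every quantity is compared on the scale \<open>L = ln (d / \<alpha>)\<close>. The
  threshold separating near from far pairs is \<open>\<tau> = L\<^sup>2 / sqrt d\<close>: pairs with
  \<open>\<bar>t\<bar> > \<tau>\<close> then have probability of order
  \<open>exp (- L ^ 4 / 8)\<close>, and even after half of the exponent is spent on the singularity
  at \<open>\<bar>t\<bar> = 1\<close> this beats \<open>q\<^sub>0 \<le> exp (L ^ 3)\<close>. For
  near pairs the correlation exceeds 1 by at most a multiple of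
  \<open>\<rho>\<^sup>2 * \<tau>\<close>, provided the lattice error is smaller than that. Since
  \<open>\<rho>\<^sup>2 * \<tau>\<close> is at least of order
  \<open>(\<alpha> / d)\<^sup>2 = exp (- 2 * L)\<close> and the lattice error is
  \<open>exp (- b * L ^ k)\<close> for some \<open>b > 0\<close>, a power \<open>k \<ge> 2\<close>
  is enough. Cauchy-Schwarz then bounds the squared average gap of a query with null mean
  \<open>p\<close> by a multiple of \<open>p * (1 - p) * \<rho>\<^sup>2 * \<tau>\<close>, to be
  compared with the squared tolerance \<open>p * (1 - p) / m\<close>. A query is therefore
  informative only if \<open>m\<close> is at least of order
  \<open>1 / (\<rho>\<^sup>2 * \<tau>)\<close>, that is,
  \<open>sqrt d / (\<alpha>\<^sup>2 * L ^ (k + 2))\<close>.\<close>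

lemma nn_integral_unit_intervals:
  fixes g :: "real \<Rightarrow> ennreal"
  assumes [measurable]: "g \<in> borel_measurable borel"
  shows "(\<integral>\<^sup>+x. g x \<partial>lborel) =
    (\<integral>\<^sup>+i. (\<integral>\<^sup>+x\<in>{real_of_int i..<real_of_int i + 1}. g x \<partial>lborel) \<partial>count_space UNIV)"
proof -
  have ind: "indicator {real_of_int i..<real_of_int i + 1} x = (indicator {\<lfloor>x\<rfloor>} i :: ennreal)" for i x
    by (auto simp: indicator_def floor_eq_iff intro: floor_unique[symmetric])
  have 1: "(\<integral>\<^sup>+i. indicator {real_of_int i..<real_of_int i + 1} x \<partial>count_space UNIV) = (1::ennreal)" for x
    unfolding ind by simp
  have "(\<integral>\<^sup>+x. g x \<partial>lborel) =
      (\<integral>\<^sup>+x. \<integral>\<^sup>+i. g x * indicator {real_of_int i..<real_of_int i + 1} x \<partial>count_space UNIV \<partial>lborel)"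
    by (simp add: nn_integral_cmult 1)
  also have "\<dots> = (\<integral>\<^sup>+i. (\<integral>\<^sup>+x\<in>{real_of_int i..<real_of_int i + 1}. g x \<partial>lborel) \<partial>count_space UNIV)"
    by (rule nn_integral_count_space_nn_integral) auto
  finally show ?thesis .
qed

lemma nn_integral_periodize:
  fixes g :: "real \<Rightarrow> ennreal"
  assumes [measurable]: "g \<in> borel_measurable borel"
  shows "(\<integral>\<^sup>+x. g x \<partial>lborel) =
    (\<integral>\<^sup>+x\<in>{0..<1}. (\<integral>\<^sup>+i. g (x + real_of_int i) \<partial>count_space UNIV) \<partial>lborel)"
proof -
  have "(\<integral>\<^sup>+x. g x \<partial>lborel) =
      (\<integral>\<^sup>+i. (\<integral>\<^sup>+x. g (x + real_of_int i) * indicator {0..<1} x \<partial>lborel) \<partial>count_space UNIV)"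
    unfolding nn_integral_unit_intervals[OF assms]
  proof (rule nn_integral_cong)
    fix i :: int
    have "(\<integral>\<^sup>+x\<in>{real_of_int i..<real_of_int i + 1}. g x \<partial>lborel) =
      (\<integral>\<^sup>+x. g (real_of_int i + x) * indicator {real_of_int i..<real_of_int i + 1} (real_of_int i + x) \<partial>lborel)"
      by (subst nn_integral_real_affine[where c=1 and t="real_of_int i"]) auto
    also have "\<dots> = (\<integral>\<^sup>+x. g (x + real_of_int i) * indicator {0..<1} x \<partial>lborel)"
      by (intro nn_integral_cong) (auto simp: indicator_def add.commute)
    finally show "(\<integral>\<^sup>+x\<in>{real_of_int i..<real_of_int i + 1}. g x \<partial>lborel) =
      (\<integral>\<^sup>+x. g (x + real_of_int i) * indicator {0..<1} x \<partial>lborel)" .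
  qed
  also have "\<dots> = (\<integral>\<^sup>+x. \<integral>\<^sup>+i. g (x + real_of_int i) * indicator {0..<1} x \<partial>count_space UNIV \<partial>lborel)"
    by (rule nn_integral_count_space_nn_integral[symmetric]) auto
  also have "\<dots> = (\<integral>\<^sup>+x\<in>{0..<1}. (\<integral>\<^sup>+i. g (x + real_of_int i) \<partial>count_space UNIV) \<partial>lborel)"
    by (simp add: nn_integral_multc)
  finally show ?thesis .
qed

lemma nn_integral_normal_density [simp]:
  "0 < \<sigma> \<Longrightarrow> (\<integral>\<^sup>+x. ennreal (normal_density \<mu> \<sigma> x) \<partial>lborel) = 1"
  by (subst nn_integral_eq_integral) auto

lemma nn_integral_lborel_shift:
  fixes f :: "real \<Rightarrow> ennreal"
  assumes [measurable]: "f \<in> borel_measurable borel"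
  shows "(\<integral>\<^sup>+x. f (t + x) \<partial>lborel) = (\<integral>\<^sup>+x. f x \<partial>lborel)"
  using nn_integral_real_affine[OF assms, of 1 t] by simp

lemma nn_integral_lborel_reflect:
  fixes f :: "real \<Rightarrow> ennreal"
  assumes [measurable]: "f \<in> borel_measurable borel"
  shows "(\<integral>\<^sup>+x. f (t - x) \<partial>lborel) = (\<integral>\<^sup>+x. f x \<partial>lborel)"
  using nn_integral_real_affine[OF assms, of "-1" t] by simp

lemma measurable_nn_integral_count_space_int:
  fixes f :: "int \<Rightarrow> 'a \<Rightarrow> ennreal"
  assumes "\<And>i. f i \<in> borel_measurable M"
  shows "(\<lambda>x. \<integral>\<^sup>+i. f i x \<partial>count_space UNIV) \<in> borel_measurable M"
proof -
  interpret sigma_finite_measure "count_space (UNIV :: int set)"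
    by (rule sigma_finite_measure_count_space)
  have "(\<lambda>(i, x). f i x) \<in> borel_measurable (count_space UNIV \<Otimes>\<^sub>M M)"
    using assms by (intro measurable_pair_measure_countable1) auto
  from measurable_pair_swap[OF this] show ?thesis
    by (intro borel_measurable_nn_integral) (simp add: case_prod_beta')
qed

text \<open>The Gaussian density of variance \<open>V\<close> wrapped onto the circle of length 1,
  in other words the heat kernel of the circle. The parameter is the variance, so that convolution
  adds parameters; values in \<open>ennreal\<close> make summability a non-issue.\<close>

definition theta :: "real \<Rightarrow> real \<Rightarrow> ennreal" where
  "theta V x = (\<integral>\<^sup>+i. ennreal (normal_density 0 (sqrt V) (x + real_of_int i)) \<partial>count_space UNIV)"

lemma measurable_theta [measurable]: "theta V \<in> borel_measurable borel"
  unfolding theta_def by (intro measurable_nn_integral_count_space_int) measurable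

lemma theta_periodic: "theta V (x + real_of_int j) = theta V x"
  unfolding theta_def
  using nn_integral_bij_count_space[of "\<lambda>i. i + j" UNIV UNIV
      "\<lambda>i. ennreal (normal_density 0 (sqrt V) (x + real_of_int i))"]
  by (simp add: bij_betwI[where g="\<lambda>i. i - j"] add.commute add.left_commute)

lemma nn_integral_theta:
  assumes "0 < V"
  shows "(\<integral>\<^sup>+x\<in>{0..<1}. theta V x \<partial>lborel) = 1"
  using nn_integral_periodize[of "\<lambda>x. ennreal (normal_density 0 (sqrt V) x)"] assms
  by (simp add: theta_def)

lemma nn_integral_theta_reflect:
  assumes "0 < V"
  shows "(\<integral>\<^sup>+y\<in>{0..<1}. theta V (x - y) \<partial>lborel) = 1"
proof -
  have "theta V (x - y) = (\<integral>\<^sup>+i. ennreal (normal_density 0 (sqrt V) (x - (y + real_of_int i))) \<partial>count_space UNIV)" for y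
    unfolding theta_def
    using nn_integral_bij_count_space[of "\<lambda>i::int. - i" UNIV UNIV
      "\<lambda>i. ennreal (normal_density 0 (sqrt V) (x - y + real_of_int i))"]
    by (simp add: bij_uminus algebra_simps)
  then have "(\<integral>\<^sup>+y\<in>{0..<1}. theta V (x - y) \<partial>lborel) = (\<integral>\<^sup>+y. ennreal (normal_density 0 (sqrt V) (x - y)) \<partial>lborel)"
    by (subst nn_integral_periodize) auto
  also have "\<dots> = 1"
    using assms nn_integral_lborel_reflect[of "\<lambda>y. ennreal (normal_density 0 (sqrt V) y)" x] by simp
  finally show ?thesis .
qed

text \<open>Wrapping onto the circle commutes with convolution: the convolution variable is folded
  into one period, and \<open>theta V\<close> does not notice because it is periodic.\<close>

lemma theta_add:
  assumes "0 < V" "0 < W"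
  shows "theta (V + W) x = (\<integral>\<^sup>+y\<in>{0..<1}. theta V (x - y) * theta W y \<partial>lborel)"
proof -
  have conv: "ennreal (normal_density 0 (sqrt (V + W)) z) =
      (\<integral>\<^sup>+y. ennreal (normal_density 0 (sqrt V) (z - y)) * ennreal (normal_density 0 (sqrt W) y) \<partial>lborel)" for z
    using fun_cong[OF conv_normal_density_zero_mean[of "sqrt V" "sqrt W"], of z] assms
    by (simp add: ennreal_mult')
  have "theta (V + W) x = (\<integral>\<^sup>+i. \<integral>\<^sup>+y. ennreal (normal_density 0 (sqrt V) (x + real_of_int i - y)) *
      ennreal (normal_density 0 (sqrt W) y) \<partial>lborel \<partial>count_space UNIV)"
    unfolding theta_def conv ..
  also have "\<dots> = (\<integral>\<^sup>+y. \<integral>\<^sup>+i. ennreal (normal_density 0 (sqrt V) (x + real_of_int i - y)) *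
      ennreal (normal_density 0 (sqrt W) y) \<partial>count_space UNIV \<partial>lborel)"
    by (rule nn_integral_count_space_nn_integral[symmetric]) auto
  also have "\<dots> = (\<integral>\<^sup>+y. theta V (x - y) * ennreal (normal_density 0 (sqrt W) y) \<partial>lborel)"
    by (subst nn_integral_multc) (auto simp: theta_def algebra_simps)
  also have "\<dots> = (\<integral>\<^sup>+y\<in>{0..<1}. (\<integral>\<^sup>+i. theta V (x - (y + real_of_int i)) *
      ennreal (normal_density 0 (sqrt W) (y + real_of_int i)) \<partial>count_space UNIV) \<partial>lborel)"
    by (subst nn_integral_periodize) auto
  also have "\<dots> = (\<integral>\<^sup>+y\<in>{0..<1}. theta V (x - y) * theta W y \<partial>lborel)"
  proof -
    have "theta V (x - (y + real_of_int i)) = theta V (x - y)" for y i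
      using theta_periodic[of V "x - y" "-i"] by (simp add: algebra_simps)
    then show ?thesis by (simp add: nn_integral_cmult theta_def)
  qed
  finally show ?thesis .
qed

text \<open>The sum over the lattice differs from the integral by at most the total variation of the density.\<close>

lemma theta_crude:
  assumes V: "0 < V"
  shows "theta V x \<le> 1 + ennreal (1 / sqrt V)" "1 \<le> theta V x + ennreal (1 / sqrt V)"
proof -
  define \<sigma> where "\<sigma> = sqrt V"
  have \<sigma>: "0 < \<sigma>" using V by (simp add: \<sigma>_def)
  define \<phi> where "\<phi> t = normal_density 0 \<sigma> (x + t)" for t
  define \<psi> where "\<psi> t = - (x + t) / \<sigma>\<^sup>2 * \<phi> t" for t
  have [measurable]: "\<phi> \<in> borel_measurable borel" "\<psi> \<in> borel_measurable borel"
    unfolding \<phi>_def \<psi>_def by measurable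
  have \<phi>0: "0 \<le> \<phi> t" for t by (simp add: \<phi>_def)
  define K where "K = 1 / sqrt (2 * pi * \<sigma>\<^sup>2)"
  have \<phi>_eq: "\<phi> = (\<lambda>t. K * exp (- (x + t)\<^sup>2 / (2 * \<sigma>\<^sup>2)))"
    by (simp add: fun_eq_iff \<phi>_def normal_density_def K_def)
  have der: "(\<phi> has_real_derivative \<psi> t) (at t)" for t
    unfolding \<psi>_def \<phi>_eq using \<sigma>
    by (auto intro!: derivative_eq_intros simp: field_simps power2_eq_square)
  have cont: "isCont \<psi> t" for t
    unfolding \<phi>_def \<psi>_def normal_density_def using \<sigma> by (intro continuous_intros) auto
  \<comment> \<open>The total variation of a bell curve is twice its peak, here
    \<open>sqrt (2 / pi) / \<sigma>\<close>. It is computed as the first absolute moment divided by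
    \<open>\<sigma>\<^sup>2\<close>.\<close>
  have D: "(\<integral>\<^sup>+t. ennreal \<bar>\<psi> t\<bar> \<partial>lborel) \<le> ennreal (1 / \<sigma>)"
  proof -
    have "(\<integral>\<^sup>+t. ennreal \<bar>\<psi> t\<bar> \<partial>lborel) = (\<integral>\<^sup>+t. ennreal (1/\<sigma>\<^sup>2) * ennreal (normal_density 0 \<sigma> (x + t) * \<bar>x + t\<bar>) \<partial>lborel)"
      using \<sigma> by (intro nn_integral_cong, subst ennreal_mult[symmetric])
        (auto simp: \<psi>_def \<phi>_def abs_mult)
    also have "\<dots> = ennreal (1/\<sigma>\<^sup>2) * (\<integral>\<^sup>+t. ennreal (normal_density 0 \<sigma> (x + t) * \<bar>x + t\<bar>) \<partial>lborel)"
      by (subst nn_integral_cmult) auto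
    also have "(\<integral>\<^sup>+t. ennreal (normal_density 0 \<sigma> (x + t) * \<bar>x + t\<bar>) \<partial>lborel) = (\<integral>\<^sup>+t. ennreal (normal_density 0 \<sigma> t * \<bar>t\<bar>) \<partial>lborel)"
      using nn_integral_lborel_shift[of "\<lambda>t. ennreal (normal_density 0 \<sigma> t * \<bar>t\<bar>)" x] by simp
    also have "\<dots> = ennreal (\<sigma> * sqrt (2 / pi))"
    proof (subst nn_integral_eq_integral)
      show "integrable lborel (\<lambda>t. normal_density 0 \<sigma> t * \<bar>t\<bar>)"
        using integrable_normal_moment_abs[OF \<sigma>, of 0 1] by simp
      show "ennreal (\<integral>t. normal_density 0 \<sigma> t * \<bar>t\<bar> \<partial>lborel) = ennreal (\<sigma> * sqrt (2 / pi))"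
        using integral_normal_moment_abs_odd[OF \<sigma>, of 0 0] by simp
    qed auto
    also have "ennreal (1/\<sigma>\<^sup>2) * ennreal (\<sigma> * sqrt (2 / pi)) = ennreal (sqrt (2/pi) / \<sigma>)"
      using \<sigma> by (subst ennreal_mult[symmetric]) (auto simp: power2_eq_square)
    also have "\<dots> \<le> ennreal (1 / \<sigma>)"
    proof -
      have "sqrt (2/pi) \<le> 1" using pi_gt3 by simp
      then show ?thesis using \<sigma> by (intro ennreal_leI divide_right_mono) auto
    qed
    finally show ?thesis .
  qed
  let ?I = "\<lambda>j::int. {real_of_int j..<real_of_int j + 1}"
  have diff: "ennreal \<bar>\<phi> t - \<phi> (real_of_int j)\<bar> \<le> (\<integral>\<^sup>+s\<in>?I j. ennreal \<bar>\<psi> s\<bar> \<partial>lborel)" if "t \<in> ?I j" for t j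
  proof -
    have "(\<integral>s. \<psi> s * indicator {real_of_int j..t} s \<partial>lborel) = \<phi> t - \<phi> (real_of_int j)"
      using that der cont by (intro integral_FTC_Icc_real) auto
    then have "ennreal \<bar>\<phi> t - \<phi> (real_of_int j)\<bar> = ennreal (norm (\<integral>s. \<psi> s * indicator {real_of_int j..t} s \<partial>lborel))"
      by simp
    also have "\<dots> \<le> (\<integral>\<^sup>+s. ennreal (norm (\<psi> s * indicator {real_of_int j..t} s)) \<partial>lborel)"
    proof (rule integral_norm_bound_ennreal)
      have "set_integrable lborel {real_of_int j..t} \<psi>"
        using cont by (intro borel_integrable_atLeastAtMost') (auto intro!: continuous_at_imp_continuous_on)
      then show "integrable lborel (\<lambda>s. \<psi> s * indicator {real_of_int j..t} s)"
        by (simp add: set_integrable_def mult.commute)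
    qed
    also have "\<dots> \<le> (\<integral>\<^sup>+s\<in>?I j. ennreal \<bar>\<psi> s\<bar> \<partial>lborel)"
      using that by (intro nn_integral_mono) (auto simp: indicator_def)
    finally show ?thesis .
  qed
  let ?D = "\<lambda>j. \<integral>\<^sup>+s\<in>?I j. ennreal \<bar>\<psi> s\<bar> \<partial>lborel"
  have one: "(\<integral>\<^sup>+t\<in>?I j. c \<partial>lborel) = c" for j and c :: ennreal
    by (simp add: nn_integral_cmult_indicator)
  have up: "ennreal (\<phi> (real_of_int j)) \<le> (\<integral>\<^sup>+t\<in>?I j. ennreal (\<phi> t) \<partial>lborel) + ?D j" for j
  proof -
    have "ennreal (\<phi> (real_of_int j)) = (\<integral>\<^sup>+t\<in>?I j. ennreal (\<phi> (real_of_int j)) \<partial>lborel)"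
      by (simp add: one)
    also have "\<dots> \<le> (\<integral>\<^sup>+t. ennreal (\<phi> t) * indicator (?I j) t + ?D j * indicator (?I j) t \<partial>lborel)"
    proof (intro nn_integral_mono)
      fix t
      have "ennreal (\<phi> (real_of_int j)) \<le> ennreal (\<phi> t) + ?D j" if "t \<in> ?I j"
      proof -
        have "ennreal (\<phi> (real_of_int j)) \<le> ennreal (\<phi> t) + ennreal \<bar>\<phi> t - \<phi> (real_of_int j)\<bar>"
          using \<phi>0 by (subst ennreal_plus[symmetric]) (auto intro!: ennreal_leI simp del: ennreal_plus)
        also have "\<dots> \<le> ennreal (\<phi> t) + ?D j" by (intro add_left_mono diff that)
        finally show ?thesis .
      qed
      then show "ennreal (\<phi> (real_of_int j)) * indicator (?I j) t \<le> ennreal (\<phi> t) * indicator (?I j) t + ?D j * indicator (?I j) t"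
        by (auto simp: indicator_def)
    qed
    also have "\<dots> = (\<integral>\<^sup>+t\<in>?I j. ennreal (\<phi> t) \<partial>lborel) + ?D j"
      by (subst nn_integral_add) (auto simp: one)
    finally show ?thesis .
  qed
  have low: "(\<integral>\<^sup>+t\<in>?I j. ennreal (\<phi> t) \<partial>lborel) \<le> ennreal (\<phi> (real_of_int j)) + ?D j" for j
  proof -
    have "(\<integral>\<^sup>+t\<in>?I j. ennreal (\<phi> t) \<partial>lborel) \<le> (\<integral>\<^sup>+t\<in>?I j. (ennreal (\<phi> (real_of_int j)) + ?D j) \<partial>lborel)"
    proof (intro nn_integral_mono)
      fix t
      have "ennreal (\<phi> t) \<le> ennreal (\<phi> (real_of_int j)) + ?D j" if "t \<in> ?I j"
      proof -
        have "ennreal (\<phi> t) \<le> ennreal (\<phi> (real_of_int j)) + ennreal \<bar>\<phi> t - \<phi> (real_of_int j)\<bar>"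
          using \<phi>0 by (subst ennreal_plus[symmetric]) (auto intro!: ennreal_leI simp del: ennreal_plus)
        also have "\<dots> \<le> ennreal (\<phi> (real_of_int j)) + ?D j" by (intro add_left_mono diff that)
        finally show ?thesis .
      qed
      then show "ennreal (\<phi> t) * indicator (?I j) t \<le> (ennreal (\<phi> (real_of_int j)) + ?D j) * indicator (?I j) t"
        by (auto simp: indicator_def)
    qed
    also have "\<dots> = ennreal (\<phi> (real_of_int j)) + ?D j" by (rule one)
    finally show ?thesis .
  qed
  have th: "theta V x = (\<integral>\<^sup>+j. ennreal (\<phi> (real_of_int j)) \<partial>count_space UNIV)"
    by (simp add: theta_def \<phi>_def \<sigma>_def)
  have tot: "(\<integral>\<^sup>+j. (\<integral>\<^sup>+t\<in>?I j. ennreal (\<phi> t) \<partial>lborel) \<partial>count_space UNIV) = 1"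
    using nn_integral_unit_intervals[of "\<lambda>t. ennreal (\<phi> t)"] \<sigma>
      nn_integral_lborel_shift[of "\<lambda>t. ennreal (normal_density 0 \<sigma> t)" x]
    by (simp add: \<phi>_def)
  have totD: "(\<integral>\<^sup>+j. ?D j \<partial>count_space UNIV) \<le> ennreal (1 / sqrt V)"
    using nn_integral_unit_intervals[of "\<lambda>t. ennreal \<bar>\<psi> t\<bar>"] D by (simp add: \<sigma>_def)
  have "theta V x \<le> (\<integral>\<^sup>+j. (\<integral>\<^sup>+t\<in>?I j. ennreal (\<phi> t) \<partial>lborel) + ?D j \<partial>count_space UNIV)"
    unfolding th by (intro nn_integral_mono up)
  also have "\<dots> \<le> 1 + ennreal (1 / sqrt V)"
    using totD by (subst nn_integral_add) (auto simp: tot intro: add_left_mono)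
  finally show "theta V x \<le> 1 + ennreal (1 / sqrt V)" .
  have "1 \<le> (\<integral>\<^sup>+j. ennreal (\<phi> (real_of_int j)) + ?D j \<partial>count_space UNIV)"
    unfolding tot[symmetric] by (intro nn_integral_mono low)
  also have "\<dots> \<le> theta V x + ennreal (1 / sqrt V)"
    using totD by (subst nn_integral_add) (auto simp: th intro: add_left_mono)
  finally show "1 \<le> theta V x + ennreal (1 / sqrt V)" .
qed

text \<open>Doeblin contraction: since \<open>theta W \<ge> 1/2\<close> and both functions have mean 1 on a period,
  \<open>theta (V + W) x - 1 = \<integral> (theta V (x - y) - 1) (theta W y - 1/2) dy\<close>, and the second factor has integral
  \<open>1/2\<close>.  Iterating gives exponential closeness to 1 without Poisson summation.\<close>

lemma theta_contract:
  assumes VW: "0 < V" "0 < W" and B: "0 \<le> B"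
    and W: "\<And>x. ennreal (1/2) \<le> theta W x"
    and up: "\<And>x. theta V x \<le> 1 + ennreal B" and low: "\<And>x. 1 \<le> theta V x + ennreal B"
  shows "theta (V + W) x \<le> 1 + ennreal (B / 2)" "1 \<le> theta (V + W) x + ennreal (B / 2)"
proof -
  define k where "k y = theta W y - ennreal (1/2)" for y
  have [measurable]: "k \<in> borel_measurable borel" unfolding k_def by measurable
  have k: "theta W y = ennreal (1/2) + k y" for y
    unfolding k_def using W[of y] by (simp add: add_diff_inverse_ennreal)
  let ?J = "{0..<1::real}"
  have half: "ennreal (1/2) + ennreal (1/2) = 1"
    by (subst ennreal_plus[symmetric]) auto
  have "1 = (\<integral>\<^sup>+y\<in>?J. (ennreal (1/2) + k y) \<partial>lborel)"
    using nn_integral_theta[OF VW(2)] by (simp add: k)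
  also have "\<dots> = ennreal (1/2) + (\<integral>\<^sup>+y\<in>?J. k y \<partial>lborel)"
    by (simp add: distrib_right nn_integral_add nn_integral_cmult_indicator)
  finally have ik: "(\<integral>\<^sup>+y\<in>?J. k y \<partial>lborel) = ennreal (1/2)"
    unfolding half[symmetric] by (simp only: ennreal_add_left_cancel) simp
  have eq: "theta (V + W) x = ennreal (1/2) + (\<integral>\<^sup>+y\<in>?J. theta V (x - y) * k y \<partial>lborel)"
  proof -
    have "theta (V + W) x = (\<integral>\<^sup>+y. ennreal (1/2) * (theta V (x - y) * indicator ?J y) + theta V (x - y) * k y * indicator ?J y \<partial>lborel)"
      unfolding theta_add[OF VW] k by (intro nn_integral_cong) (simp add: algebra_simps)
    also have "\<dots> = ennreal (1/2) * (\<integral>\<^sup>+y\<in>?J. theta V (x - y) \<partial>lborel) + (\<integral>\<^sup>+y\<in>?J. theta V (x - y) * k y \<partial>lborel)"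
      by (subst nn_integral_add) (auto simp: nn_integral_cmult)
    finally show ?thesis by (simp add: nn_integral_theta_reflect VW)
  qed
  have B2: "ennreal B * ennreal (1/2) = ennreal (B / 2)"
    using B by (subst ennreal_mult[symmetric]) auto
  have "(\<integral>\<^sup>+y\<in>?J. theta V (x - y) * k y \<partial>lborel) \<le> (\<integral>\<^sup>+y. (1 + ennreal B) * (k y * indicator ?J y) \<partial>lborel)"
    by (intro nn_integral_mono) (auto simp: indicator_def intro!: mult_right_mono up)
  also have "\<dots> = ennreal (1/2) + ennreal (B / 2)"
    by (subst nn_integral_cmult) (auto simp only: ik distrib_right B2 mult_1, measurable)
  finally have "theta (V + W) x \<le> ennreal (1/2) + (ennreal (1/2) + ennreal (B / 2))"
    unfolding eq by (rule add_left_mono)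
  then show "theta (V + W) x \<le> 1 + ennreal (B / 2)"
    by (simp only: add.assoc[symmetric] half)
  have "ennreal (1/2) \<le> (\<integral>\<^sup>+y. theta V (x - y) * k y * indicator ?J y + ennreal B * (k y * indicator ?J y) \<partial>lborel)"
    unfolding ik[symmetric]
  proof (intro nn_integral_mono)
    fix y
    show "k y * indicator ?J y \<le> theta V (x - y) * k y * indicator ?J y + ennreal B * (k y * indicator ?J y)"
      using mult_right_mono[OF low[of "x - y"], of "k y * indicator ?J y"]
      by (simp add: distrib_right mult.assoc)
  qed
  also have "\<dots> = (\<integral>\<^sup>+y\<in>?J. theta V (x - y) * k y \<partial>lborel) + ennreal (B / 2)"
    by (subst nn_integral_add, measurable) (subst nn_integral_cmult, measurable, simp only: ik B2)
  finally have "ennreal (1/2) + ennreal (1/2) \<le> ennreal (1/2) + ((\<integral>\<^sup>+y\<in>?J. theta V (x - y) * k y \<partial>lborel) + ennreal (B / 2))"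
    by (rule add_left_mono)
  then show "1 \<le> theta (V + W) x + ennreal (B / 2)"
    unfolding half eq by (simp add: add.assoc)
qed

text \<open>Variance 4 is where the crude deviation \<open>1 / sqrt V\<close> equals 1/2, so
  \<open>theta 4\<close> satisfies the minorisation and each further 4 units of variance halve the
  error. Lower bounds are written as \<open>1 \<le> theta V x + B\<close> because subtraction in
  \<open>ennreal\<close> truncates.\<close>

lemma theta_iterate:
  assumes V: "0 < V"
  shows "(\<forall>x. theta (V + 4 * real n) x \<le> 1 + ennreal (1 / sqrt V / 2 ^ n)) \<and>
    (\<forall>x. 1 \<le> theta (V + 4 * real n) x + ennreal (1 / sqrt V / 2 ^ n))"
proof (induction n)
  case 0
  then show ?case using theta_crude[OF V] by simp
next
  case (Suc n)
  have 4: "ennreal (1/2) \<le> theta 4 x" for x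
  proof -
    have "ennreal (1/2) + ennreal (1/2) \<le> theta 4 x + ennreal (1/2)"
      using theta_crude(2)[of 4 x] by (subst ennreal_plus[symmetric]) auto
    then show ?thesis by (simp add: add.commute ennreal_add_left_cancel_le)
  qed
  have e: "V + 4 * real (Suc n) = (V + 4 * real n) + 4" by simp
  have "1 / sqrt V / 2 ^ Suc n = 1 / sqrt V / 2 ^ n / 2" by simp
  then show ?case
    unfolding e using theta_contract[of "V + 4 * real n" 4 "1 / sqrt V / 2 ^ n"] 4 Suc V
    by (simp add: mult_ac)
qed

text \<open>As many steps of variance 4 are taken as leave at least variance 1, where the crude
  deviation is at most 1. The resulting rate \<open>ln 2 / 4\<close> is rounded down to 1/8, and the
  factor 4 pays for the incomplete last step.\<close>

lemma theta_bounds: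
  assumes "1 \<le> X"
  shows "theta X x \<le> 1 + ennreal (4 * exp (- X / 8))" "1 \<le> theta X x + ennreal (4 * exp (- X / 8))"
proof -
  define n where "n = nat \<lfloor>(X - 1) / 4\<rfloor>"
  define V where "V = X - 4 * real n"
  have n: "real n \<le> (X - 1) / 4" "(X - 1) / 4 < real n + 1"
    using assms of_int_floor_le[of "(X - 1) / 4"] unfolding n_def by (simp_all add: of_nat_nat)
  have V: "1 \<le> V" and X: "X = V + 4 * real n" using n by (auto simp: V_def)
  have "1 / sqrt V / 2 ^ n \<le> 1 / 2 ^ n"
    using V by (simp add: divide_simps)
  also have "1 / 2 ^ n = exp (- ln 2 * real n)"
    using powr_realpow[of 2 n] by (simp add: powr_def exp_minus field_simps)
  also have "\<dots> \<le> exp (ln 4 - X / 8)"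
  proof -
    have l: "1/2 \<le> ln (2::real)" using ln_le_minus_one[of "1/2"] by (simp add: ln_div)
    have "ln (4::real) = 2 * ln 2" using ln_realpow[of 2 2] by simp
    moreover have "ln 2 * (X / 4 - 5 / 4) \<le> ln 2 * real n" using n l by (intro mult_left_mono) auto
    moreover have "(1/2) * (X / 4) \<le> ln 2 * (X / 4)" using l assms by (intro mult_right_mono) auto
    ultimately show ?thesis using l by (auto simp: algebra_simps)
  qed
  also have "\<dots> = 4 * exp (- X / 8)" by (simp only: diff_conv_add_uminus exp_add) simp
  finally have *: "ennreal (1 / sqrt V / 2 ^ n) \<le> ennreal (4 * exp (- X / 8))" by (rule ennreal_leI)
  have **: "theta X x \<le> 1 + ennreal (1 / sqrt V / 2 ^ n)" "1 \<le> theta X x + ennreal (1 / sqrt V / 2 ^ n)"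
    using theta_iterate[of V n] V X by auto
  show "theta X x \<le> 1 + ennreal (4 * exp (- X / 8))"
    by (rule order_trans[OF **(1) add_left_mono[OF *]])
  show "1 \<le> theta X x + ennreal (4 * exp (- X / 8))"
    by (rule order_trans[OF **(2) add_left_mono[OF *]])
qed

section \<open>Discrete Gaussians\<close>

lemma normal_density_scale:
  assumes "0 < s" "0 < \<sigma>"
  shows "normal_density 0 \<sigma> (s * x) = normal_density 0 (\<sigma> / s) x / s"
  using assms by (simp add: normal_density_def power_divide real_sqrt_mult real_sqrt_divide power_mult_distrib field_simps)

lemma nn_integral_lattice_normal:
  assumes "0 < s" "0 < \<sigma>"
  shows "(\<integral>\<^sup>+i. ennreal (normal_density 0 \<sigma> (x + s * real_of_int i)) \<partial>count_space UNIV) =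
    ennreal (1 / s) * theta (\<sigma>\<^sup>2 / s\<^sup>2) (x / s)"
proof -
  have "ennreal (normal_density 0 \<sigma> (x + s * real_of_int i)) =
      ennreal (1 / s) * ennreal (normal_density 0 (sqrt (\<sigma>\<^sup>2 / s\<^sup>2)) (x / s + real_of_int i))" for i
    using assms normal_density_scale[OF assms, of "x / s + real_of_int i"]
    by (subst ennreal_mult[symmetric]) (auto simp: real_sqrt_divide distrib_left)
  then show ?thesis by (simp add: theta_def nn_integral_cmult)
qed

lemma theta_finite: "0 < V \<Longrightarrow> theta V x < \<top>"
  using theta_crude(1)[of V x] by (rule le_less_trans) auto

lemma theta_zero_pos:
  assumes "0 < V"
  shows "0 < theta V 0"
proof -
  have "ennreal (normal_density 0 (sqrt V) 0) =
      (\<integral>\<^sup>+i. ennreal (normal_density 0 (sqrt V) 0) * indicator {0::int} i \<partial>count_space UNIV)"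
    by (simp add: nn_integral_cmult)
  also have "\<dots> \<le> theta V 0"
    unfolding theta_def by (intro nn_integral_mono) (auto simp: indicator_def)
  finally show ?thesis
    using normal_density_pos[of "sqrt V" 0 0] assms by (auto intro: less_le_trans[rotated])
qed

text \<open>An \<open>infsum\<close> over a non-summable family is 0 by default, so the finiteness
  of \<open>theta\<close> has to be used before the sum can be identified.\<close>

lemma discrete_gaussian_normalizer:
  assumes "0 < s" "0 < \<sigma>"
  shows "ennreal (\<Sum>\<^sub>\<infinity>j::int. normal_density 0 \<sigma> (s * real_of_int j)) = ennreal (1 / s) * theta (\<sigma>\<^sup>2 / s\<^sup>2) 0"
proof -
  let ?f = "\<lambda>j::int. normal_density 0 \<sigma> (s * real_of_int j)"
  have eq: "(\<integral>\<^sup>+j. ennreal (?f j) \<partial>count_space UNIV) = ennreal (1 / s) * theta (\<sigma>\<^sup>2 / s\<^sup>2) 0"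
    using nn_integral_lattice_normal[OF assms, of 0] by simp
  also have "\<dots> < \<top>" using assms theta_finite[of "\<sigma>\<^sup>2 / s\<^sup>2" 0] by (auto simp: ennreal_mult_less_top)
  finally have int: "integrable (count_space UNIV) ?f"
    by (intro integrableI_nonneg) auto
  then have "(\<Sum>\<^sub>\<infinity>j::int. ?f j) = (\<integral>j. ?f j \<partial>count_space UNIV)"
    using infsetsum_infsum[of ?f UNIV] by (simp add: infsetsum_def abs_summable_on_def)
  then have "ennreal (\<Sum>\<^sub>\<infinity>j::int. ?f j) = (\<integral>\<^sup>+j. ennreal (?f j) \<partial>count_space UNIV)"
    using int by (simp add: nn_integral_eq_integral)
  then show ?thesis by (simp add: eq)
qed

lemma discrete_gaussian_normalizer_pos:
  assumes "0 < s" "0 < \<sigma>"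
  shows "0 < (\<Sum>\<^sub>\<infinity>j::int. normal_density 0 \<sigma> (s * real_of_int j))"
proof -
  have "0 < ennreal (1 / s) * theta (\<sigma>\<^sup>2 / s\<^sup>2) 0"
    using assms theta_zero_pos[of "\<sigma>\<^sup>2 / s\<^sup>2"] by (simp add: ennreal_zero_less_mult_iff)
  then show ?thesis
    unfolding discrete_gaussian_normalizer[OF assms, symmetric] by simp
qed

lemma sets_discrete_gaussian [measurable_cong, simp]: "sets (discrete_gaussian \<mu> \<sigma> \<theta> s) = sets borel"
  and space_discrete_gaussian [simp]: "space (discrete_gaussian \<mu> \<sigma> \<theta> s) = UNIV"
  by (simp_all add: discrete_gaussian_def)

lemma nn_integral_discrete_gaussian:
  assumes "0 < s" "0 < \<sigma>" and [measurable]: "g \<in> borel_measurable borel"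
  shows "(\<integral>\<^sup>+z. g z \<partial>discrete_gaussian 0 \<sigma> 0 s) =
    (\<integral>\<^sup>+i. ennreal (normal_density 0 \<sigma> (s * real_of_int i)) * g (s * real_of_int i) \<partial>count_space UNIV)
      / (ennreal (1 / s) * theta (\<sigma>\<^sup>2 / s\<^sup>2) 0)"
proof -
  define Z where "Z = (\<Sum>\<^sub>\<infinity>j::int. normal_density 0 \<sigma> (s * real_of_int j))"
  have Z: "0 < Z" unfolding Z_def by (rule discrete_gaussian_normalizer_pos[OF assms(1,2)])
  have "(\<integral>\<^sup>+z. g z \<partial>discrete_gaussian 0 \<sigma> 0 s) =
    (\<integral>\<^sup>+i. ennreal (normal_density 0 \<sigma> (s * real_of_int i) / Z) * g (s * real_of_int i) \<partial>count_space UNIV)"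
    unfolding discrete_gaussian_def
    by (simp add: nn_integral_distr nn_integral_density Z_def)
  also have "\<dots> = (\<integral>\<^sup>+i. ennreal (normal_density 0 \<sigma> (s * real_of_int i)) * g (s * real_of_int i) / ennreal Z \<partial>count_space UNIV)"
    using Z by (intro nn_integral_cong) (simp add: divide_ennreal[symmetric] ennreal_times_divide mult.commute)
  also have "\<dots> = (\<integral>\<^sup>+i. ennreal (normal_density 0 \<sigma> (s * real_of_int i)) * g (s * real_of_int i) \<partial>count_space UNIV) / ennreal Z"
    by (rule nn_integral_divide) simp
  finally show ?thesis unfolding Z_def discrete_gaussian_normalizer[OF assms(1,2)] .
qed

lemma prob_space_discrete_gaussian:
  assumes "0 < s" "0 < \<sigma>"
  shows "prob_space (discrete_gaussian 0 \<sigma> 0 s)"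
proof
  have p: "0 < ennreal (1 / s) * theta (\<sigma>\<^sup>2 / s\<^sup>2) 0" "ennreal (1 / s) * theta (\<sigma>\<^sup>2 / s\<^sup>2) 0 < \<top>"
    using assms theta_zero_pos[of "\<sigma>\<^sup>2 / s\<^sup>2"] theta_finite[of "\<sigma>\<^sup>2 / s\<^sup>2" 0]
    by (auto simp: ennreal_zero_less_mult_iff ennreal_mult_less_top)
  have "emeasure (discrete_gaussian 0 \<sigma> 0 s) (space (discrete_gaussian 0 \<sigma> 0 s)) = (\<integral>\<^sup>+z. 1 \<partial>discrete_gaussian 0 \<sigma> 0 s)"
    by simp
  also have "\<dots> = (ennreal (1 / s) * theta (\<sigma>\<^sup>2 / s\<^sup>2) 0) / (ennreal (1 / s) * theta (\<sigma>\<^sup>2 / s\<^sup>2) 0)"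
    using nn_integral_lattice_normal[OF assms, of 0] by (subst nn_integral_discrete_gaussian[OF assms]) auto
  also have "\<dots> = 1" using p by (intro ennreal_divide_self) auto
  finally show "emeasure (discrete_gaussian 0 \<sigma> 0 s) (space (discrete_gaussian 0 \<sigma> 0 s)) = 1" .
qed

text \<open>Bayes' rule for Gaussians: prior times likelihood equals marginal times posterior, with
  posterior mean \<open>\<sigma>\<^sup>2 * x / (\<sigma>\<^sup>2 + \<tau>\<^sup>2)\<close> and
  variance \<open>\<sigma>\<^sup>2 * \<tau>\<^sup>2 / (\<sigma>\<^sup>2 +
  \<tau>\<^sup>2)\<close>.\<close>

lemma normal_density_product:
  assumes "0 < \<sigma>" "0 < \<tau>"
  shows "normal_density 0 \<sigma> a * normal_density 0 \<tau> (x - a) =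
    normal_density 0 (sqrt (\<sigma>\<^sup>2 + \<tau>\<^sup>2)) x * normal_density 0 (sqrt (\<sigma>\<^sup>2 * \<tau>\<^sup>2 / (\<sigma>\<^sup>2 + \<tau>\<^sup>2))) (a - \<sigma>\<^sup>2 * x / (\<sigma>\<^sup>2 + \<tau>\<^sup>2))"
proof -
  define S T where "S = \<sigma>\<^sup>2" and "T = \<tau>\<^sup>2"
  have ST: "0 < S" "0 < T" using assms by (auto simp: S_def T_def)
  have 1: "sqrt (2 * pi * S) * sqrt (2 * pi * T) = sqrt (2 * pi * (S + T)) * sqrt (2 * pi * (S * T / (S + T)))"
    using ST by (simp add: real_sqrt_mult[symmetric])
  have 2: "- a\<^sup>2 / (2 * S) + - (x - a)\<^sup>2 / (2 * T) =
      - x\<^sup>2 / (2 * (S + T)) + - (a - S * x / (S + T))\<^sup>2 / (2 * (S * T / (S + T)))"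
  proof -
    have n: "S + T \<noteq> 0" using ST by simp
    define y where "y = x / (S + T)"
    have x: "x = y * (S + T)" using n by (simp add: y_def)
    have y2: "S * x / (S + T) = S * y" by (simp add: y_def)
    show ?thesis unfolding y2 unfolding x using ST n
      by (simp add: divide_simps) (simp add: power2_eq_square algebra_simps)
  qed
  have "normal_density 0 \<sigma> a * normal_density 0 \<tau> (x - a) =
     1 / (sqrt (2 * pi * S) * sqrt (2 * pi * T)) * exp (- a\<^sup>2 / (2 * S) + - (x - a)\<^sup>2 / (2 * T))"
    unfolding exp_add by (simp add: normal_density_def S_def T_def)
  also have "\<dots> = normal_density 0 (sqrt (S + T)) x * normal_density 0 (sqrt (S * T / (S + T))) (a - S * x / (S + T))"
    unfolding 1 2 exp_add using ST by (simp add: normal_density_def)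
  finally show ?thesis by (simp add: S_def T_def)
qed

text \<open>The marginal factor does not depend on the lattice point and comes out of the sum; the
  posterior summed over the lattice is a theta function. The lattice is thus visible only through a
  quotient of two theta values, each close to 1 when its variance is large in lattice units.\<close>

lemma discrete_gaussian_smooth:
  assumes "0 < s" "0 < \<sigma>" "0 < \<tau>"
  shows "(\<integral>\<^sup>+z. ennreal (normal_density 0 \<tau> (x - z)) \<partial>discrete_gaussian 0 \<sigma> 0 s) =
    ennreal (normal_density 0 (sqrt (\<sigma>\<^sup>2 + \<tau>\<^sup>2)) x) *
    theta (\<sigma>\<^sup>2 * \<tau>\<^sup>2 / (\<sigma>\<^sup>2 + \<tau>\<^sup>2) / s\<^sup>2) (- (\<sigma>\<^sup>2 * x / (\<sigma>\<^sup>2 + \<tau>\<^sup>2)) / s) / theta (\<sigma>\<^sup>2 / s\<^sup>2) 0"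
proof -
  let ?V = "\<sigma>\<^sup>2 * \<tau>\<^sup>2 / (\<sigma>\<^sup>2 + \<tau>\<^sup>2)" and ?m = "\<sigma>\<^sup>2 * x / (\<sigma>\<^sup>2 + \<tau>\<^sup>2)"
  have V: "0 < ?V" using assms by (simp add: add_pos_pos)
  have "(\<integral>\<^sup>+i. ennreal (normal_density 0 \<sigma> (s * real_of_int i)) * ennreal (normal_density 0 \<tau> (x - s * real_of_int i)) \<partial>count_space UNIV)
     = (\<integral>\<^sup>+i. ennreal (normal_density 0 (sqrt (\<sigma>\<^sup>2 + \<tau>\<^sup>2)) x) * ennreal (normal_density 0 (sqrt ?V) (- ?m + s * real_of_int i)) \<partial>count_space UNIV)"
    using assms by (intro nn_integral_cong) (simp add: ennreal_mult[symmetric] normal_density_product)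
  also have "\<dots> = ennreal (normal_density 0 (sqrt (\<sigma>\<^sup>2 + \<tau>\<^sup>2)) x) * (ennreal (1 / s) * theta ((sqrt ?V)\<^sup>2 / s\<^sup>2) (- ?m / s))"
    using V assms(1) by (subst nn_integral_cmult, simp, subst nn_integral_lattice_normal) simp_all
  also have "(sqrt ?V)\<^sup>2 = ?V" using V by simp
  also have "ennreal (normal_density 0 (sqrt (\<sigma>\<^sup>2 + \<tau>\<^sup>2)) x) * (ennreal (1 / s) * theta (?V / s\<^sup>2) (- ?m / s)) =
      ennreal (1 / s) * (ennreal (normal_density 0 (sqrt (\<sigma>\<^sup>2 + \<tau>\<^sup>2)) x) * theta (?V / s\<^sup>2) (- ?m / s))"
    by (simp add: mult_ac)
  finally have *: "(\<integral>\<^sup>+z. ennreal (normal_density 0 \<tau> (x - z)) \<partial>discrete_gaussian 0 \<sigma> 0 s) =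
      ennreal (1 / s) * (ennreal (normal_density 0 (sqrt (\<sigma>\<^sup>2 + \<tau>\<^sup>2)) x) * theta (?V / s\<^sup>2) (- ?m / s))
        / (ennreal (1 / s) * theta (\<sigma>\<^sup>2 / s\<^sup>2) 0)"
    using assms by (subst nn_integral_discrete_gaussian) auto
  have c: "c * a / (c * b) = a / b" if "c \<noteq> 0" "c \<noteq> \<top>" for a b c :: ennreal
    using that by (simp add: mult.commute[of c] divide_mult_eq)
  show ?thesis unfolding * using assms by (subst c) (auto simp: ennreal_zero_less_mult_iff)
qed

text \<open>The atom has mass \<open>s * normal_density 0 \<sigma> 0\<close> divided by a theta
  value that is at most \<open>1 + s / \<sigma>\<close>. As the peak is at least
  \<open>1 / (3 * \<sigma>)\<close>, the mass is at least \<open>s / (3 * (\<sigma> + s))\<close>,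
  and a spacing of 10 times \<alpha> leaves room.\<close>

lemma discrete_gaussian_atom:
  assumes \<sigma>: "0 < \<sigma>" "\<sigma> \<le> 1" and \<alpha>: "0 < \<alpha>" "\<alpha> \<le> 1 / 10" and s: "10 * \<alpha> \<le> s"
  shows "\<alpha> \<le> measure (discrete_gaussian 0 \<sigma> 0 s) {0}"
proof -
  have s0: "0 < s" using \<alpha> s by linarith
  interpret prob_space "discrete_gaussian 0 \<sigma> 0 s" by (rule prob_space_discrete_gaussian[OF s0 \<sigma>(1)])
  define t where "t = theta (\<sigma>\<^sup>2 / s\<^sup>2) 0"
  have t: "t \<le> ennreal (1 + s / \<sigma>)" "0 < t"
    using theta_crude(1)[of "\<sigma>\<^sup>2 / s\<^sup>2" 0] theta_zero_pos[of "\<sigma>\<^sup>2 / s\<^sup>2"] s0 \<sigma>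
    by (auto simp: t_def real_sqrt_divide)
  have "emeasure (discrete_gaussian 0 \<sigma> 0 s) {0} = (\<integral>\<^sup>+z. indicator {0} z \<partial>discrete_gaussian 0 \<sigma> 0 s)"
    by simp
  also have "\<dots> = (\<integral>\<^sup>+i. ennreal (normal_density 0 \<sigma> (s * real_of_int i)) * indicator {0} (s * real_of_int i) \<partial>count_space UNIV)
      / (ennreal (1 / s) * t)"
    using s0 \<sigma> by (subst nn_integral_discrete_gaussian) (auto simp: t_def)
  also have "(\<integral>\<^sup>+i. ennreal (normal_density 0 \<sigma> (s * real_of_int i)) * indicator {0} (s * real_of_int i) \<partial>count_space UNIV)
     = (\<integral>\<^sup>+i. ennreal (normal_density 0 \<sigma> 0) * indicator {0::int} i \<partial>count_space UNIV)"
    using s0 by (intro nn_integral_cong) (auto simp: indicator_def)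
  also have "\<dots> = ennreal (normal_density 0 \<sigma> 0)" by (simp add: nn_integral_cmult)
  finally have e: "emeasure (discrete_gaussian 0 \<sigma> 0 s) {0} = ennreal (normal_density 0 \<sigma> 0) / (ennreal (1 / s) * t)" .
  have "ennreal \<alpha> \<le> ennreal (normal_density 0 \<sigma> 0 / (1 / s * (1 + s / \<sigma>)))"
  proof (rule ennreal_leI)
    have "sqrt (2 * pi * \<sigma>\<^sup>2) \<le> 3 * \<sigma>"
      using pi_less_4 \<sigma> by (intro real_le_lsqrt) (auto simp: power_mult_distrib)
    then have n: "1 / (3 * \<sigma>) \<le> normal_density 0 \<sigma> 0"
      using \<sigma> by (simp add: normal_density_def frac_le)
    have "\<alpha> * (1 + s) \<le> s / 3"
    proof -
      have "\<alpha> * s \<le> 1 / 10 * s" using \<alpha> s0 by (intro mult_right_mono) auto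
      then show ?thesis using s s0 unfolding distrib_left by linarith
    qed
    have "\<alpha> \<le> 1 / (3 * \<sigma>) / (1 / s * (1 + s / \<sigma>))"
    proof -
      have "\<alpha> * (\<sigma> + s) \<le> \<alpha> * (1 + s)" using \<sigma> \<alpha> by (intro mult_left_mono) auto
      also have "\<dots> \<le> s / 3" by fact
      finally have "\<alpha> * (\<sigma> + s) \<le> s / 3" .
      then show ?thesis using s0 \<sigma> by (simp add: field_simps)
    qed
    also have "\<dots> \<le> normal_density 0 \<sigma> 0 / (1 / s * (1 + s / \<sigma>))"
      using n s0 \<sigma> by (intro divide_right_mono) auto
    finally show "\<alpha> \<le> normal_density 0 \<sigma> 0 / (1 / s * (1 + s / \<sigma>))" .
  qed
  also have "\<dots> \<le> emeasure (discrete_gaussian 0 \<sigma> 0 s) {0}"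
  proof -
    obtain t' where t': "t = ennreal t'" "0 < t'" "t' \<le> 1 + s / \<sigma>"
    proof (cases t)
      case (real r)
      moreover have "0 \<le> 1 + s / \<sigma>" using s0 \<sigma> by simp
      ultimately have "r \<le> 1 + s / \<sigma>" "0 < r" using t by (simp_all only: ennreal_le_iff ennreal_less_zero_iff)
      then show ?thesis using real that by auto
    next
      case top
      then show ?thesis using t(1) by (simp add: top_unique)
    qed
    have "emeasure (discrete_gaussian 0 \<sigma> 0 s) {0} = ennreal (normal_density 0 \<sigma> 0 / (1 / s * t'))"
      unfolding e t'(1) using s0 t'(2)
      by (subst ennreal_mult[symmetric], simp, simp, subst divide_ennreal) auto
    moreover have "normal_density 0 \<sigma> 0 / (1 / s * (1 + s / \<sigma>)) \<le> normal_density 0 \<sigma> 0 / (1 / s * t')"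
      using s0 t'(2,3) by (intro divide_left_mono mult_left_mono mult_pos_pos) auto
    ultimately show ?thesis by (simp add: ennreal_leI)
  qed
  finally show ?thesis by (simp add: emeasure_eq_measure)
qed

section \<open>Gaussian vectors\<close>

text \<open>The centred bivariate normal density with covariance matrix \<open>((p, w), (w, q))\<close>.\<close>

definition normal_density2 :: "real \<Rightarrow> real \<Rightarrow> real \<Rightarrow> real \<Rightarrow> real \<Rightarrow> real" where
  "normal_density2 p q w a b =
     1 / (2 * pi * sqrt (p * q - w\<^sup>2)) * exp (- (q * a\<^sup>2 - 2 * w * a * b + p * b\<^sup>2) / (2 * (p * q - w\<^sup>2)))"

lemma measurable_normal_density2 [measurable]:
  assumes [measurable]: "f \<in> borel_measurable M" "g \<in> borel_measurable M"
  shows "(\<lambda>x. normal_density2 p q w (f x) (g x)) \<in> borel_measurable M"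
  unfolding normal_density2_def by measurable

lemma normal_density2_nonneg:
  "0 < p * q - w\<^sup>2 \<Longrightarrow> 0 \<le> normal_density2 p q w a b"
  by (simp add: normal_density2_def)

lemma pos_def2:
  fixes p q w :: real
  assumes "0 < p" "0 < p * q - w\<^sup>2"
  shows "0 \<le> q * \<alpha>\<^sup>2 - 2 * w * \<alpha> * \<beta> + p * \<beta>\<^sup>2"
proof -
  have "p * (q * \<alpha>\<^sup>2 - 2 * w * \<alpha> * \<beta> + p * \<beta>\<^sup>2) = (p * q - w\<^sup>2) * \<alpha>\<^sup>2 + (p * \<beta> - w * \<alpha>)\<^sup>2"
    by (simp add: power2_eq_square algebra_simps)
  also have "\<dots> \<ge> 0" using assms by simp
  finally show ?thesis using assms by (simp add: zero_le_mult_iff)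
qed

text \<open>Adding a common standard normal \<open>x\<close> with loadings \<open>\<alpha>\<close>
  and \<open>\<beta>\<close> to a Gaussian pair adds a rank-one matrix to its covariance. The proof
  completes the square in \<open>x\<close>.\<close>

lemma normal_density2_rank_one:
  assumes p: "0 < p" and D: "0 < p * q - w\<^sup>2"
  shows "(\<integral>\<^sup>+x. ennreal (std_normal_density x) * ennreal (normal_density2 p q w (a - \<alpha> * x) (b - \<beta> * x)) \<partial>lborel)
    = ennreal (normal_density2 (p + \<alpha>\<^sup>2) (q + \<beta>\<^sup>2) (w + \<alpha> * \<beta>) a b)"
    and "0 < (p + \<alpha>\<^sup>2) * (q + \<beta>\<^sup>2) - (w + \<alpha> * \<beta>)\<^sup>2"
proof -
  define D where "D = p * q - w\<^sup>2"
  define Q where "Q = q * \<alpha>\<^sup>2 - 2 * w * \<alpha> * \<beta> + p * \<beta>\<^sup>2"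
  define B where "B = q * a * \<alpha> - w * (a * \<beta> + b * \<alpha>) + p * b * \<beta>"
  define C where "C = q * a\<^sup>2 - 2 * w * a * b + p * b\<^sup>2"
  have D0: "0 < D" using D by (simp add: D_def)
  have Q0: "0 \<le> Q" unfolding Q_def by (rule pos_def2[OF p D])
  have DQ: "0 < D + Q" using D0 Q0 by simp
  \<comment> \<open>Matrix determinant lemma for the rank-one update.\<close>
  have D': "(p + \<alpha>\<^sup>2) * (q + \<beta>\<^sup>2) - (w + \<alpha> * \<beta>)\<^sup>2 = D + Q"
    by (simp add: D_def Q_def power2_eq_square algebra_simps)
  show "0 < (p + \<alpha>\<^sup>2) * (q + \<beta>\<^sup>2) - (w + \<alpha> * \<beta>)\<^sup>2" unfolding D' by (rule DQ)
  \<comment> \<open>A Lagrange-type identity. It turns what remains after completing the square into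
    the quadratic form of the enlarged covariance.\<close>
  have lag: "C * Q - B\<^sup>2 = D * (\<beta> * a - \<alpha> * b)\<^sup>2"
    by (simp add: C_def Q_def B_def D_def power2_eq_square algebra_simps)
  have C': "(q + \<beta>\<^sup>2) * a\<^sup>2 - 2 * (w + \<alpha> * \<beta>) * a * b + (p + \<alpha>\<^sup>2) * b\<^sup>2 = C + (\<beta> * a - \<alpha> * b)\<^sup>2"
    by (simp add: C_def power2_eq_square algebra_simps)
  have Cx: "q * (a - \<alpha> * x)\<^sup>2 - 2 * w * (a - \<alpha> * x) * (b - \<beta> * x) + p * (b - \<beta> * x)\<^sup>2 = C - 2 * B * x + Q * x\<^sup>2" for x
    by (simp add: C_def B_def Q_def power2_eq_square algebra_simps)
  \<comment> \<open>\<open>v\<close> and the \<open>m\<close> below are the variance and mean of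
    \<open>x\<close> conditional on the pair \<open>(a, b)\<close>.\<close>
  define v where "v = D / (D + Q)"
  have v: "0 < v" using D0 DQ by (simp add: v_def)
  define m where "m = B / (D + Q)"
  have ex: "- x\<^sup>2 / 2 + - (C - 2 * B * x + Q * x\<^sup>2) / (2 * D) =
      - (C + (\<beta> * a - \<alpha> * b)\<^sup>2) / (2 * (D + Q)) + - (x - m)\<^sup>2 / (2 * v)" for x
  proof -
    define e where "e = (\<beta> * a - \<alpha> * b)\<^sup>2"
    define E where "E = D + Q"
    have E: "0 < E" "Q = E - D" using DQ by (auto simp: E_def)
    have B2: "B * B = C * Q - D * e" using lag by (simp add: e_def power2_eq_square algebra_simps)
    have l: "- x\<^sup>2 / 2 + - (C - 2 * B * x + Q * x\<^sup>2) / (2 * D) = - (x\<^sup>2 * E + C - 2 * B * x) / (2 * D)"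
      using D0 by (simp add: E(2) field_simps)
    have r: "- (C + e) / (2 * E) + - (x - m)\<^sup>2 / (2 * v) = - ((C + e) * D + (x * E - B)\<^sup>2) / (2 * D * E)"
    proof -
      have "(x - m)\<^sup>2 / (2 * v) = (x * E - B)\<^sup>2 / (2 * D * E)"
        unfolding m_def v_def E_def[symmetric] using D0 E(1) by (simp add: field_simps power2_eq_square)
      moreover have "(C + e) / (2 * E) = (C + e) * D / (2 * D * E)" using D0 by simp
      ultimately show ?thesis by (simp add: add_divide_distrib diff_divide_distrib)
    qed
    have "(x\<^sup>2 * E + C - 2 * B * x) * E = (C + e) * D + (x * E - B)\<^sup>2"
      using B2 by (simp add: E(2) power2_eq_square algebra_simps)
    moreover have "- (x\<^sup>2 * E + C - 2 * B * x) / (2 * D) = - ((x\<^sup>2 * E + C - 2 * B * x) * E) / (2 * D * E)"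
    proof -
      have "y / (2 * D) = (y * E) / (2 * D * E)" for y using E(1) by simp
      from this[of "- (x\<^sup>2 * E + C - 2 * B * x)"] show ?thesis by (simp only: mult_minus_left)
    qed
    ultimately show ?thesis unfolding e_def[symmetric] E_def[symmetric] l r by simp
  qed
  have sq: "sqrt (2 * pi) * (2 * pi * sqrt D) = 2 * pi * sqrt (D + Q) * sqrt (2 * pi * v)"
  proof -
    have "sqrt (2 * pi * v) * sqrt (D + Q) = sqrt (2 * pi) * sqrt D"
      using DQ by (simp add: v_def real_sqrt_mult[symmetric] del: real_sqrt_mult)
    then show ?thesis by (simp only: mult_ac)
  qed
  have "std_normal_density x * normal_density2 p q w (a - \<alpha> * x) (b - \<beta> * x) =
      normal_density2 (p + \<alpha>\<^sup>2) (q + \<beta>\<^sup>2) (w + \<alpha> * \<beta>) a b * normal_density m (sqrt v) x" for x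
  proof -
    have "std_normal_density x * normal_density2 p q w (a - \<alpha> * x) (b - \<beta> * x) =
       1 / (sqrt (2 * pi) * (2 * pi * sqrt D)) * exp (- x\<^sup>2 / 2 + - (C - 2 * B * x + Q * x\<^sup>2) / (2 * D))"
    proof -
      have "1 / y * e * (1 / z * f) = 1 / (y * z) * (e * f)" for y z e f :: real by simp
      then show ?thesis
        unfolding exp_add std_normal_density_def normal_density2_def Cx D_def[symmetric] .
    qed
    also have "\<dots> = normal_density2 (p + \<alpha>\<^sup>2) (q + \<beta>\<^sup>2) (w + \<alpha> * \<beta>) a b * normal_density m (sqrt v) x"
    proof -
      have "1 / (y * z) * (e * f) = 1 / y * e * (1 / z * f)" for y z e f :: real by simp
      moreover have "(sqrt v)\<^sup>2 = v" using v by simp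
      ultimately show ?thesis
        unfolding sq ex exp_add normal_density2_def normal_density_def D' C' by presburger
    qed
    finally show ?thesis .
  qed
  moreover have "0 \<le> normal_density2 (p + \<alpha>\<^sup>2) (q + \<beta>\<^sup>2) (w + \<alpha> * \<beta>) a b"
    by (rule normal_density2_nonneg) (simp add: D' DQ)
  ultimately have "(\<integral>\<^sup>+x. ennreal (std_normal_density x) * ennreal (normal_density2 p q w (a - \<alpha> * x) (b - \<beta> * x)) \<partial>lborel) =
      (\<integral>\<^sup>+x. ennreal (normal_density2 (p + \<alpha>\<^sup>2) (q + \<beta>\<^sup>2) (w + \<alpha> * \<beta>) a b) * ennreal (normal_density m (sqrt v) x) \<partial>lborel)"
    using D by (intro nn_integral_cong) (simp add: ennreal_mult[symmetric] normal_density2_nonneg)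
  also have "\<dots> = ennreal (normal_density2 (p + \<alpha>\<^sup>2) (q + \<beta>\<^sup>2) (w + \<alpha> * \<beta>) a b)"
    using v by (simp add: nn_integral_cmult nn_integral_eq_integral)
  finally show "(\<integral>\<^sup>+x. ennreal (std_normal_density x) * ennreal (normal_density2 p q w (a - \<alpha> * x) (b - \<beta> * x)) \<partial>lborel)
    = ennreal (normal_density2 (p + \<alpha>\<^sup>2) (q + \<beta>\<^sup>2) (w + \<alpha> * \<beta>) a b)" .
qed

lemma normal_density2_indep:
  assumes "0 < \<tau>"
  shows "normal_density2 (\<tau>\<^sup>2) (\<tau>\<^sup>2) 0 a b = normal_density 0 \<tau> a * normal_density 0 \<tau> b"
proof -
  define T where "T = \<tau>\<^sup>2"
  have T: "0 < T" using assms by (simp add: T_def)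
  have 1: "sqrt (T * T - 0\<^sup>2) = T" using T by simp
  have 2: "- (T * a\<^sup>2 - 2 * 0 * a * b + T * b\<^sup>2) / (2 * (T * T - 0\<^sup>2)) = - (a - 0)\<^sup>2 / (2 * T) + - (b - 0)\<^sup>2 / (2 * T)"
    using T by (simp add: field_simps)
  have 3: "sqrt (2 * pi * T) * sqrt (2 * pi * T) = 2 * pi * T" using T by simp
  have split: "1 / W * (e * f) = 1 / y * e * (1 / z * f)" if "y * z = W" for y z e f W :: real
    unfolding that[symmetric] by simp
  show ?thesis
    unfolding normal_density2_def normal_density_def T_def[symmetric] 1 2 exp_add by (rule split[OF 3])
qed

section \<open>Standard Gaussian vectors and inner products\<close>

lemma sets_gaussian [measurable_cong, simp]: "sets (gaussian \<mu> \<sigma>) = sets borel"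
  and space_gaussian [simp]: "space (gaussian \<mu> \<sigma>) = UNIV"
  by (simp_all add: gaussian_def)

lemma prob_space_gaussian: "0 < \<sigma> \<Longrightarrow> prob_space (gaussian \<mu> \<sigma>)"
  unfolding gaussian_def by (rule prob_space_normal_density)

lemma nn_integral_gaussian:
  "f \<in> borel_measurable borel \<Longrightarrow> (\<integral>\<^sup>+x. f x \<partial>gaussian \<mu> \<sigma>) = (\<integral>\<^sup>+x. ennreal (normal_density \<mu> \<sigma> x) * f x \<partial>lborel)"
  unfolding gaussian_def by (subst nn_integral_density) auto

lemma sets_gaussian_vec [measurable_cong, simp]: "sets (gaussian_vec d) = sets (vec_space d)"
  and space_gaussian_vec: "space (gaussian_vec d) = space (vec_space d)"
  unfolding gaussian_vec_def by (auto intro!: sets_PiM_cong simp: space_PiM)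

lemma prob_space_gaussian_vec: "prob_space (gaussian_vec d)"
  unfolding gaussian_vec_def by (intro prob_space_PiM prob_space_gaussian) simp

lemma measurable_vec_component:
  "f \<in> measurable M (vec_space d) \<Longrightarrow> i < d \<Longrightarrow> (\<lambda>x. f x i) \<in> borel_measurable M"
  by (rule measurable_compose[OF _ measurable_component_singleton]) auto

lemma measurable_dot [measurable]:
  assumes "f \<in> measurable M (vec_space d)" "g \<in> measurable M (vec_space d)"
  shows "(\<lambda>x. dot d (f x) (g x)) \<in> borel_measurable M"
  unfolding dot_def
  by (intro borel_measurable_sum borel_measurable_times measurable_vec_component[OF assms(1)]
      measurable_vec_component[OF assms(2)]) auto

lemma measurable_dot_const [measurable]:
  assumes "g \<in> measurable M (vec_space d)"
  shows "(\<lambda>x. dot d v (g x)) \<in> borel_measurable M"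
  unfolding dot_def
  by (intro borel_measurable_sum borel_measurable_times measurable_vec_component[OF assms]
      borel_measurable_const) auto

lemma dot_Suc_upd [simp]: "dot (Suc d) v (x(d := y)) = dot d v x + v d * y"
  unfolding dot_def by simp

lemma dot_Suc: "dot (Suc d) v x = dot d v x + v d * x d"
  unfolding dot_def by simp

lemma dot_upd_ge [simp]: "dot d (x(d := y)) u = dot d x u"
  unfolding dot_def by simp

lemma dot_scale_left: "dot d (\<lambda>i. c * v i) x = c * dot d v x"
  by (simp add: dot_def sum_distrib_left mult.assoc)

lemma dot_scale_both: "dot d (\<lambda>i. c * v i) (\<lambda>i. c * u i) = c\<^sup>2 * dot d v u"
  by (simp add: dot_def sum_distrib_left power2_eq_square mult_ac)

lemma nn_integral_gaussian_vec_Suc: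
  assumes "f \<in> borel_measurable (vec_space (Suc d))"
  shows "(\<integral>\<^sup>+x. f x \<partial>gaussian_vec (Suc d)) = (\<integral>\<^sup>+x. \<integral>\<^sup>+y. f (x(d := y)) \<partial>gaussian 0 1 \<partial>gaussian_vec d)"
proof -
  interpret product_sigma_finite "\<lambda>_::nat. gaussian 0 1"
    by (simp add: product_sigma_finite_def prob_space_gaussian prob_space_imp_sigma_finite)
  have ins: "{..<Suc d} = insert d {..<d}" by auto
  have "f \<in> borel_measurable (gaussian_vec (Suc d))"
    using assms by simp
  then show ?thesis unfolding gaussian_vec_def ins by (subst product_nn_integral_insert) auto
qed

text \<open>Every coordinate of \<open>x\<close> contributes the rank-one term with loadings
  \<open>v i\<close> and \<open>u i\<close>, so only the Gram matrix of \<open>v\<close> and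
  \<open>u\<close> enters. The starting covariance is left general because it changes along the
  induction.\<close>

lemma gaussian_vec_normal_density2:
  assumes "0 < p" "0 < p * q - w\<^sup>2"
  shows "(\<integral>\<^sup>+x. ennreal (normal_density2 p q w (a - dot d v x) (b - dot d u x)) \<partial>gaussian_vec d) =
    ennreal (normal_density2 (p + dot d v v) (q + dot d u u) (w + dot d v u) a b)"
  using assms
proof (induction d arbitrary: p q w)
  case 0
  interpret prob_space "gaussian_vec 0" by (rule prob_space_gaussian_vec)
  show ?case by (simp add: dot_def emeasure_space_1)
next
  case (Suc d)
  have "(\<integral>\<^sup>+x. ennreal (normal_density2 p q w (a - dot (Suc d) v x) (b - dot (Suc d) u x)) \<partial>gaussian_vec (Suc d)) =
    (\<integral>\<^sup>+x. \<integral>\<^sup>+y. ennreal (std_normal_density y) *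
        ennreal (normal_density2 p q w ((a - dot d v x) - v d * y) ((b - dot d u x) - u d * y)) \<partial>lborel \<partial>gaussian_vec d)"
    by (subst nn_integral_gaussian_vec_Suc) (auto simp: nn_integral_gaussian algebra_simps)
  also have "\<dots> = (\<integral>\<^sup>+x. ennreal (normal_density2 (p + (v d)\<^sup>2) (q + (u d)\<^sup>2) (w + v d * u d) (a - dot d v x) (b - dot d u x)) \<partial>gaussian_vec d)"
    by (simp add: normal_density2_rank_one(1)[OF Suc.prems])
  also have "\<dots> = ennreal (normal_density2 (p + (v d)\<^sup>2 + dot d v v) (q + (u d)\<^sup>2 + dot d u u) (w + v d * u d + dot d v u) a b)"
    using Suc.prems normal_density2_rank_one(2)[OF Suc.prems, of "v d" "u d"]
    by (intro Suc.IH) (auto simp: add_pos_nonneg)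
  finally show ?case by (simp add: dot_Suc power2_eq_square algebra_simps)
qed

section \<open>Exponential moments of linear and quadratic forms\<close>

lemma gaussian_exp_quadratic:
  assumes "-1/2 < \<mu>"
  shows "(\<integral>\<^sup>+x. ennreal (exp (h * x - \<mu> * x\<^sup>2)) \<partial>gaussian 0 1) =
    ennreal (exp (h\<^sup>2 / (2 * (1 + 2 * \<mu>))) / sqrt (1 + 2 * \<mu>))"
proof -
  define c where "c = 1 + 2 * \<mu>"
  have c: "0 < c" and \<mu>: "\<mu> = (c - 1) / 2" using assms by (auto simp: c_def)
  have "std_normal_density x * exp (h * x - \<mu> * x\<^sup>2) = exp (h\<^sup>2 / (2 * c)) / sqrt c * normal_density (h / c) (1 / sqrt c) x" for x
  proof -
    have "- x\<^sup>2 / 2 + (h * x - \<mu> * x\<^sup>2) = h\<^sup>2 / (2 * c) + - (x - h / c)\<^sup>2 / (2 * (1 / sqrt c)\<^sup>2)"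
    proof -
      have "(x - h / c)\<^sup>2 / (2 * (1 / sqrt c)\<^sup>2) = (x - h / c)\<^sup>2 * c / 2"
        using c by (simp add: power_divide)
      moreover have "(x - h / c)\<^sup>2 * c = x\<^sup>2 * c - 2 * x * h + h\<^sup>2 / c"
        using c by (simp add: power2_eq_square field_simps)
      ultimately show ?thesis using c by (simp add: \<mu> field_simps)
    qed
    then show ?thesis using c
      by (simp add: std_normal_density_def normal_density_def exp_add[symmetric] power_divide real_sqrt_divide)
  qed
  then have "(\<integral>\<^sup>+x. ennreal (exp (h * x - \<mu> * x\<^sup>2)) \<partial>gaussian 0 1) =
      (\<integral>\<^sup>+x. ennreal (exp (h\<^sup>2 / (2 * c)) / sqrt c) * ennreal (normal_density (h / c) (1 / sqrt c) x) \<partial>lborel)"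
    using c by (subst nn_integral_gaussian) (auto intro!: nn_integral_cong simp: ennreal_mult[symmetric])
  also have "\<dots> = ennreal (exp (h\<^sup>2 / (2 * c)) / sqrt c)"
    using c by (simp add: nn_integral_cmult nn_integral_eq_integral)
  finally show ?thesis by (simp add: c_def)
qed

lemma gaussian_vec_exp_linear:
  assumes "0 \<le> \<mu>"
  shows "(\<integral>\<^sup>+x. ennreal (exp (h * dot d v x - \<mu> * dot d x x)) \<partial>gaussian_vec d) =
    ennreal (exp (h\<^sup>2 * dot d v v / (2 * (1 + 2 * \<mu>))) / sqrt (1 + 2 * \<mu>) ^ d)"
proof (induction d)
  case 0
  interpret prob_space "gaussian_vec 0" by (rule prob_space_gaussian_vec)
  show ?case by (simp add: dot_def emeasure_space_1)
next
  case (Suc d)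
  let ?c = "ennreal (exp ((h * v d)\<^sup>2 / (2 * (1 + 2 * \<mu>))) / sqrt (1 + 2 * \<mu>))"
  have "(\<integral>\<^sup>+x. ennreal (exp (h * dot (Suc d) v x - \<mu> * dot (Suc d) x x)) \<partial>gaussian_vec (Suc d)) =
    (\<integral>\<^sup>+x. \<integral>\<^sup>+y. ennreal (exp (h * dot d v x - \<mu> * dot d x x)) * ennreal (exp ((h * v d) * y - \<mu> * y\<^sup>2)) \<partial>gaussian 0 1 \<partial>gaussian_vec d)"
    by (subst nn_integral_gaussian_vec_Suc)
      (auto intro!: nn_integral_cong simp: ennreal_mult[symmetric] exp_add[symmetric] power2_eq_square algebra_simps)
  also have "\<dots> = (\<integral>\<^sup>+x. ennreal (exp (h * dot d v x - \<mu> * dot d x x)) * ?c \<partial>gaussian_vec d)"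
    using assms by (intro nn_integral_cong) (simp add: nn_integral_cmult gaussian_exp_quadratic)
  also have "\<dots> = ennreal (exp (h\<^sup>2 * dot d v v / (2 * (1 + 2 * \<mu>))) / sqrt (1 + 2 * \<mu>) ^ d) * ?c"
    by (simp add: nn_integral_multc Suc)
  also have "\<dots> = ennreal (exp (h\<^sup>2 * dot (Suc d) v v / (2 * (1 + 2 * \<mu>))) / sqrt (1 + 2 * \<mu>) ^ Suc d)"
    using assms by (subst ennreal_mult[symmetric])
      (auto simp: dot_Suc exp_add[symmetric] add_divide_distrib power2_eq_square algebra_simps)
  finally show ?case .
qed

text \<open>The square in the exponent is linearised by \<open>exp (l t\<^sup>2) = \<integral> exp (sqrt (2 l) t h) d\<gamma>(h)\<close>, after which the
  coordinates separate.\<close>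

lemma gaussian_vec_exp_quadratic:
  assumes v: "dot d v v = 1" and \<mu>: "0 \<le> \<mu>" and l: "0 \<le> l" "2 * l < 1 + 2 * \<mu>"
  shows "(\<integral>\<^sup>+x. ennreal (exp (l * (dot d v x)\<^sup>2 - \<mu> * dot d x x)) \<partial>gaussian_vec d) =
    ennreal (1 / (sqrt (1 + 2 * \<mu>) ^ d * sqrt (1 - 2 * l / (1 + 2 * \<mu>))))"
proof -
  interpret pair_sigma_finite "gaussian 0 1" "gaussian_vec d"
    by (intro pair_sigma_finite.intro prob_space_imp_sigma_finite prob_space_gaussian prob_space_gaussian_vec) simp
  have lin: "ennreal (exp (l * t\<^sup>2)) = (\<integral>\<^sup>+h. ennreal (exp (sqrt (2 * l) * t * h - 0 * h\<^sup>2)) \<partial>gaussian 0 1)" for t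
    using l by (subst gaussian_exp_quadratic) (auto simp: power_mult_distrib)
  have "(\<integral>\<^sup>+x. ennreal (exp (l * (dot d v x)\<^sup>2 - \<mu> * dot d x x)) \<partial>gaussian_vec d) =
    (\<integral>\<^sup>+x. ennreal (exp (- \<mu> * dot d x x)) * ennreal (exp (l * (dot d v x)\<^sup>2)) \<partial>gaussian_vec d)"
    by (intro nn_integral_cong) (simp add: ennreal_mult[symmetric] exp_add[symmetric])
  also have "\<dots> = (\<integral>\<^sup>+x. \<integral>\<^sup>+h. ennreal (exp ((sqrt (2 * l) * h) * dot d v x - \<mu> * dot d x x)) \<partial>gaussian 0 1 \<partial>gaussian_vec d)"
    unfolding lin
    by (subst nn_integral_cmult[symmetric])
      (auto intro!: nn_integral_cong simp: ennreal_mult[symmetric] exp_add[symmetric] mult_ac)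
  also have "\<dots> = (\<integral>\<^sup>+h. \<integral>\<^sup>+x. ennreal (exp ((sqrt (2 * l) * h) * dot d v x - \<mu> * dot d x x)) \<partial>gaussian_vec d \<partial>gaussian 0 1)"
    by (rule Fubini') measurable
  also have "\<dots> = (\<integral>\<^sup>+h. ennreal (1 / sqrt (1 + 2 * \<mu>) ^ d) * ennreal (exp (0 * h - (- l / (1 + 2 * \<mu>)) * h\<^sup>2)) \<partial>gaussian 0 1)"
  proof -
    have "2 * l * h\<^sup>2 / (2 * (1 + 2 * \<mu>)) = - (- l / (1 + 2 * \<mu>)) * h\<^sup>2" for h :: real
      using \<mu> by (simp add: field_simps)
    then show ?thesis
      using \<mu> l by (simp add: gaussian_vec_exp_linear[OF \<mu>] v ennreal_mult[symmetric] power_mult_distrib)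
  qed
  also have "\<dots> = ennreal (1 / sqrt (1 + 2 * \<mu>) ^ d) * ennreal (1 / sqrt (1 + 2 * (- l / (1 + 2 * \<mu>))))"
    using \<mu> l by (subst nn_integral_cmult, simp, subst gaussian_exp_quadratic) (auto simp: field_simps)
  also have "\<dots> = ennreal (1 / (sqrt (1 + 2 * \<mu>) ^ d * sqrt (1 - 2 * l / (1 + 2 * \<mu>))))"
    using \<mu> l by (subst ennreal_mult[symmetric]) auto
  finally show ?thesis .
qed

section \<open>Pairwise correlations\<close>

text \<open>The density of \<open>z + g\<close> for \<open>z\<close> drawn from \<open>E\<close> and
  an independent centred Gaussian \<open>g\<close> of standard deviation
  \<open>\<tau>\<close>.\<close>

definition smooth :: "real measure \<Rightarrow> real \<Rightarrow> real \<Rightarrow> ennreal" where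
  "smooth E \<tau> x = (\<integral>\<^sup>+z. ennreal (normal_density 0 \<tau> (x - z)) \<partial>E)"

lemma ennreal_divide_mono:
  assumes "A \<le> ennreal a" "ennreal b \<le> B" "0 \<le> a" "0 < b"
  shows "A / B \<le> ennreal (a / b)"
proof (cases B)
  case (real B')
  then have b: "b \<le> B'" using assms by simp
  have "A / B \<le> ennreal a / B" by (rule divide_right_mono_ennreal[OF assms(1)])
  also have "\<dots> = ennreal (a / B')" using real b assms by (simp add: divide_ennreal)
  also have "\<dots> \<le> ennreal (a / b)" using b assms by (intro ennreal_leI divide_left_mono mult_pos_pos) auto
  finally show ?thesis .
qed simp

text \<open>On the diagonal the quotient is again Gaussian in \<open>y\<close>, with variance
  \<open>(1 + \<kappa>) / (1 - \<kappa>)\<close> and mass \<open>1 / (1 - \<kappa>)\<close>. With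
  \<open>\<kappa> = \<rho>\<^sup>2 * t\<close> this mass is the correlation of the purely Gaussian
  model.\<close>

lemma nn_integral_normal_density2_diagonal:
  assumes "\<bar>\<kappa>\<bar> < 1"
  shows "(\<integral>\<^sup>+y. ennreal (normal_density2 1 1 \<kappa> y y / std_normal_density y) \<partial>lborel) = ennreal (1 / (1 - \<kappa>))"
proof -
  have k: "0 < 1 + \<kappa>" "0 < 1 - \<kappa>" using assms by auto
  have f: "1 - \<kappa>\<^sup>2 = (1 + \<kappa>) * (1 - \<kappa>)" by (simp add: power2_eq_square algebra_simps)
  define v where "v = (1 + \<kappa>) / (1 - \<kappa>)"
  have v: "0 < v" using k by (simp add: v_def)
  have "normal_density2 1 1 \<kappa> y y / std_normal_density y = 1 / (1 - \<kappa>) * normal_density 0 (sqrt v) y" for y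
  proof -
    have e1: "- (1 * y\<^sup>2 - 2 * \<kappa> * y * y + 1 * y\<^sup>2) / (2 * (1 * 1 - \<kappa>\<^sup>2)) = - y\<^sup>2 / (1 + \<kappa>)"
    proof -
      have "1 * y\<^sup>2 - 2 * \<kappa> * y * y + 1 * y\<^sup>2 = 2 * y\<^sup>2 * (1 - \<kappa>)" by (simp add: power2_eq_square algebra_simps)
      then show ?thesis using k by (simp add: f)
    qed
    have e2: "- y\<^sup>2 / (1 + \<kappa>) - (- y\<^sup>2 / 2) = - (y - 0)\<^sup>2 / (2 * v)"
      using k by (simp add: v_def field_simps)
    have sq: "sqrt (2 * pi) / (2 * pi * sqrt (1 * 1 - \<kappa>\<^sup>2)) = 1 / (1 - \<kappa>) * (1 / sqrt (2 * pi * v))"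
    proof -
      have q1: "sqrt (2 * pi * v) = sqrt (2 * pi) * sqrt v" by (simp add: real_sqrt_mult)
      have q2: "sqrt (1 * 1 - \<kappa>\<^sup>2) = (1 - \<kappa>) * sqrt v"
      proof -
        have "(1 - \<kappa>)\<^sup>2 * v = 1 * 1 - \<kappa>\<^sup>2"
          unfolding mult_1 f using k by (simp add: v_def power2_eq_square)
        from this[symmetric] show ?thesis using k by (simp add: real_sqrt_mult)
      qed
      have q3: "sqrt (2 * pi) / (2 * pi * W) = 1 / (sqrt (2 * pi) * W)" for W
      proof -
        have "A / (A * A * W) = 1 / (A * W)" for A :: real by (cases "A = 0") auto
        moreover have "sqrt (2 * pi) * sqrt (2 * pi) = 2 * pi" by simp
        ultimately show ?thesis by metis
      qed
      show ?thesis unfolding q3 q2 q1 by simp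
    qed
    have "normal_density2 1 1 \<kappa> y y / std_normal_density y =
        sqrt (2 * pi) / (2 * pi * sqrt (1 * 1 - \<kappa>\<^sup>2)) * exp (- y\<^sup>2 / (1 + \<kappa>) - (- y\<^sup>2 / 2))"
      unfolding normal_density2_def std_normal_density_def e1 exp_diff by simp
    then show ?thesis unfolding sq e2 normal_density_def using v by simp
  qed
  then have "(\<integral>\<^sup>+y. ennreal (normal_density2 1 1 \<kappa> y y / std_normal_density y) \<partial>lborel) =
      (\<integral>\<^sup>+y. ennreal (1 / (1 - \<kappa>)) * ennreal (normal_density 0 (sqrt v) y) \<partial>lborel)"
    using k by (intro nn_integral_cong) (simp add: ennreal_mult'[symmetric])
  also have "\<dots> = ennreal (1 / (1 - \<kappa>))"
    using v by (subst nn_integral_cmult) (auto simp: nn_integral_eq_integral)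
  finally show ?thesis .
qed

section \<open>The regression model with lattice noise: smoothed densities and correlations\<close>

locale lattice_noise =
  fixes \<rho> s :: real
  assumes rho: "0 < \<rho>" "\<rho> < 1" and s: "0 < s"
begin

definition sd :: real where "sd = sqrt (1 - \<rho>\<^sup>2)"
definition E :: "real measure" where "E = discrete_gaussian 0 sd 0 s"

lemma rho2: "0 < \<rho>\<^sup>2" "\<rho>\<^sup>2 < 1"
  using rho by (auto simp: power_less_one_iff)

lemma sd: "0 < sd" "sd\<^sup>2 = 1 - \<rho>\<^sup>2"
  using rho2 by (auto simp: sd_def)

lemma sets_E [measurable_cong, simp]: "sets E = sets borel" and space_E [simp]: "space E = UNIV"
  by (simp_all add: E_def)

lemma prob_space_E: "prob_space E"
  unfolding E_def using s sd by (intro prob_space_discrete_gaussian)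

sublocale E: prob_space E by (rule prob_space_E)

lemma measurable_smooth [measurable]:
  assumes [measurable]: "f \<in> borel_measurable M"
  shows "(\<lambda>x. smooth E \<tau> (f x)) \<in> borel_measurable M"
  unfolding smooth_def by measurable

text \<open>This is \<open>s\<close> times the normalising sum of \<open>E\<close>. It tends to 1 as
  the lattice becomes finer.\<close>

definition normalizer :: real where "normalizer = enn2real (theta (sd\<^sup>2 / s\<^sup>2) 0)"

lemma normalizer: "theta (sd\<^sup>2 / s\<^sup>2) 0 = ennreal normalizer" "0 < normalizer"
proof -
  have "0 < sd\<^sup>2 / s\<^sup>2" by (intro divide_pos_pos zero_less_power sd(1) s)
  then have "theta (sd\<^sup>2 / s\<^sup>2) 0 < \<top>" "0 < theta (sd\<^sup>2 / s\<^sup>2) 0"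
    by (auto intro: theta_finite theta_zero_pos)
  then show "theta (sd\<^sup>2 / s\<^sup>2) 0 = ennreal normalizer" "0 < normalizer"
    by (auto simp: normalizer_def enn2real_positive_iff)
qed

lemma smooth_eq:
  assumes "0 < \<tau>"
  shows "smooth E \<tau> x = ennreal (normal_density 0 (sqrt (sd\<^sup>2 + \<tau>\<^sup>2)) x) *
    theta (sd\<^sup>2 * \<tau>\<^sup>2 / (sd\<^sup>2 + \<tau>\<^sup>2) / s\<^sup>2) (- (sd\<^sup>2 * x / (sd\<^sup>2 + \<tau>\<^sup>2)) / s) / ennreal normalizer"
  unfolding smooth_def E_def using discrete_gaussian_smooth[OF s sd(1) assms] normalizer by simp

lemma smooth_upper:
  assumes "0 < \<tau>" "0 \<le> \<delta>" "\<And>x. theta (sd\<^sup>2 * \<tau>\<^sup>2 / (sd\<^sup>2 + \<tau>\<^sup>2) / s\<^sup>2) x \<le> 1 + ennreal \<delta>"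
  shows "smooth E \<tau> x \<le> ennreal ((1 + \<delta>) / normalizer) * ennreal (normal_density 0 (sqrt (sd\<^sup>2 + \<tau>\<^sup>2)) x)"
proof -
  have "smooth E \<tau> x \<le> ennreal (normal_density 0 (sqrt (sd\<^sup>2 + \<tau>\<^sup>2)) x) * (1 + ennreal \<delta>) / ennreal normalizer"
    unfolding smooth_eq[OF assms(1)] by (intro divide_right_mono_ennreal mult_left_mono assms(3)) simp
  also have "1 + ennreal \<delta> = ennreal (1 + \<delta>)" using assms(2) by simp
  also have "ennreal (normal_density 0 (sqrt (sd\<^sup>2 + \<tau>\<^sup>2)) x) * ennreal (1 + \<delta>) / ennreal normalizer =
     ennreal ((1 + \<delta>) / normalizer) * ennreal (normal_density 0 (sqrt (sd\<^sup>2 + \<tau>\<^sup>2)) x)"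
    using assms(2) normalizer(2)
    by (simp add: ennreal_mult'[symmetric] divide_ennreal mult.commute del: ennreal_plus)
  finally show ?thesis .
qed

lemma smooth_lower:
  assumes "0 < \<tau>" "0 \<le> \<delta>" "\<delta> < 1" "\<And>x. 1 \<le> theta (sd\<^sup>2 * \<tau>\<^sup>2 / (sd\<^sup>2 + \<tau>\<^sup>2) / s\<^sup>2) x + ennreal \<delta>"
  shows "ennreal ((1 - \<delta>) / normalizer * normal_density 0 (sqrt (sd\<^sup>2 + \<tau>\<^sup>2)) x) \<le> smooth E \<tau> x"
proof -
  let ?t = "theta (sd\<^sup>2 * \<tau>\<^sup>2 / (sd\<^sup>2 + \<tau>\<^sup>2) / s\<^sup>2) (- (sd\<^sup>2 * x / (sd\<^sup>2 + \<tau>\<^sup>2)) / s)"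
  have "ennreal (1 - \<delta>) \<le> ?t"
  proof -
    have "ennreal (1 - \<delta>) + ennreal \<delta> \<le> ?t + ennreal \<delta>"
      using assms by (subst ennreal_plus[symmetric]) auto
    then show ?thesis by (simp add: add.commute ennreal_add_left_cancel_le)
  qed
  then have "ennreal (normal_density 0 (sqrt (sd\<^sup>2 + \<tau>\<^sup>2)) x) * ennreal (1 - \<delta>) / ennreal normalizer \<le> smooth E \<tau> x"
    unfolding smooth_eq[OF assms(1)] by (intro divide_right_mono_ennreal mult_left_mono) auto
  also have "ennreal (normal_density 0 (sqrt (sd\<^sup>2 + \<tau>\<^sup>2)) x) * ennreal (1 - \<delta>) / ennreal normalizer =
     ennreal ((1 - \<delta>) / normalizer * normal_density 0 (sqrt (sd\<^sup>2 + \<tau>\<^sup>2)) x)"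
    using assms normalizer(2) by (simp add: ennreal_mult'[symmetric] divide_ennreal mult.commute)
  finally show ?thesis .
qed

definition response_density :: "real \<Rightarrow> ennreal" where "response_density = smooth E \<rho>"

text \<open>The conditional density of \<open>y\<close> given \<open>x\<close> when the signal
  \<open>v \<bullet> x\<close> is damped by \<open>r\<close> and independent noise makes up for the
  lost variance. For a unit vector \<open>v\<close> the total Gaussian variance stays
  \<open>\<rho>\<^sup>2\<close>, so the marginal law of \<open>y\<close> is the same for every
  \<open>r\<close>.\<close>

definition alt_density :: "nat \<Rightarrow> real \<Rightarrow> (nat \<Rightarrow> real) \<Rightarrow> (nat \<Rightarrow> real) \<Rightarrow> real \<Rightarrow> ennreal" where
  "alt_density d r v x y = smooth E (\<rho> * sqrt (1 - r\<^sup>2)) (y - \<rho> * r * dot d v x)"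

lemma measurable_response_density [measurable]: "response_density \<in> borel_measurable borel"
  unfolding response_density_def by measurable

lemma measurable_alt_density [measurable]:
  assumes [measurable]: "f \<in> measurable M (vec_space d)" "g \<in> measurable M (vec_space d)" "h \<in> borel_measurable M"
  shows "(\<lambda>x. alt_density d r (f x) (g x) (h x)) \<in> borel_measurable M"
  unfolding alt_density_def by measurable

lemma measurable_alt_density_const [measurable]:
  assumes [measurable]: "g \<in> measurable M (vec_space d)" "h \<in> borel_measurable M"
  shows "(\<lambda>x. alt_density d r v (g x) (h x)) \<in> borel_measurable M"
  unfolding alt_density_def by measurable

lemma smooth_times_smooth:
  "smooth E \<tau> a * smooth E \<tau> b =
    (\<integral>\<^sup>+z. \<integral>\<^sup>+z'. ennreal (normal_density 0 \<tau> (a - z) * normal_density 0 \<tau> (b - z')) \<partial>E \<partial>E)"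
proof -
  have "smooth E \<tau> a * smooth E \<tau> b = (\<integral>\<^sup>+z. ennreal (normal_density 0 \<tau> (a - z)) * smooth E \<tau> b \<partial>E)"
    unfolding smooth_def[of E \<tau> a] by (subst nn_integral_multc) auto
  also have "\<dots> = (\<integral>\<^sup>+z. \<integral>\<^sup>+z'. ennreal (normal_density 0 \<tau> (a - z)) * ennreal (normal_density 0 \<tau> (b - z')) \<partial>E \<partial>E)"
    unfolding smooth_def by (subst nn_integral_cmult) auto
  finally show ?thesis by (simp add: ennreal_mult')
qed

lemma nn_integral_mixture2:
  assumes M: "sigma_finite_measure M"
    and [measurable]: "k \<in> borel_measurable M" "f \<in> borel_measurable M" "g \<in> borel_measurable M"
  shows "(\<integral>\<^sup>+x. k x * (smooth E \<tau> (f x) * smooth E \<tau> (g x)) \<partial>M) =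
    (\<integral>\<^sup>+z. \<integral>\<^sup>+z'. \<integral>\<^sup>+x. k x * ennreal (normal_density 0 \<tau> (f x - z) * normal_density 0 \<tau> (g x - z')) \<partial>M \<partial>E \<partial>E)"
proof -
  interpret M: sigma_finite_measure M by (rule M)
  interpret P: pair_sigma_finite E M by unfold_locales
  have "(\<integral>\<^sup>+x. k x * (smooth E \<tau> (f x) * smooth E \<tau> (g x)) \<partial>M) =
    (\<integral>\<^sup>+x. \<integral>\<^sup>+z. \<integral>\<^sup>+z'. k x * ennreal (normal_density 0 \<tau> (f x - z) * normal_density 0 \<tau> (g x - z')) \<partial>E \<partial>E \<partial>M)"
    unfolding smooth_times_smooth by (simp add: nn_integral_cmult)
  also have "\<dots> = (\<integral>\<^sup>+z. \<integral>\<^sup>+x. \<integral>\<^sup>+z'. k x * ennreal (normal_density 0 \<tau> (f x - z) * normal_density 0 \<tau> (g x - z')) \<partial>E \<partial>M \<partial>E)"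
    by (rule P.Fubini') measurable
  also have "\<dots> = (\<integral>\<^sup>+z. \<integral>\<^sup>+z'. \<integral>\<^sup>+x. k x * ennreal (normal_density 0 \<tau> (f x - z) * normal_density 0 \<tau> (g x - z')) \<partial>M \<partial>E \<partial>E)"
    by (intro nn_integral_cong P.Fubini') measurable
  finally show ?thesis .
qed

text \<open>Two Gaussians of variance \<open>\<rho>\<^sup>2\<close> and correlation \<open>c\<close> are conditionally independent given a common part of variance
  \<open>\<rho>\<^sup>2 \<bar>c\<bar>\<close>.  Given that part, the two lattice sums factor, and each one is a one-dimensional theta function.\<close>

lemma alt_density_correlation:
  assumes r: "0 \<le> r" "r < 1" and v: "dot d v v = 1" and u: "dot d u u = 1"
    and c: "c = r\<^sup>2 * dot d v u" "\<bar>c\<bar> < 1"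
    and \<tau>: "\<tau> = \<rho> * sqrt (1 - \<bar>c\<bar>)"
    and \<delta>: "0 \<le> \<delta>" "\<And>x. theta (sd\<^sup>2 * \<tau>\<^sup>2 / (sd\<^sup>2 + \<tau>\<^sup>2) / s\<^sup>2) x \<le> 1 + ennreal \<delta>"
  shows "(\<integral>\<^sup>+x. alt_density d r v x y * alt_density d r u x y \<partial>gaussian_vec d) \<le>
    ennreal (((1 + \<delta>) / normalizer)\<^sup>2 * normal_density2 1 1 (\<rho>\<^sup>2 * c) y y)"
proof -
  interpret gv: prob_space "gaussian_vec d" by (rule prob_space_gaussian_vec)
  define \<epsilon> where "\<epsilon> = \<rho> * sqrt (1 - r\<^sup>2)"
  have r2: "r\<^sup>2 < 1" using r by (simp add: power_less_one_iff)
  have \<epsilon>: "0 < \<epsilon>" "\<epsilon>\<^sup>2 = \<rho>\<^sup>2 * (1 - r\<^sup>2)" using rho r2 by (auto simp: \<epsilon>_def power_mult_distrib)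
  define \<beta> where "\<beta> = \<rho> * sqrt \<bar>c\<bar>"
  \<comment> \<open>A negative correlation is produced by letting the common part enter the second
    response with the opposite sign.\<close>
  define \<beta>' where "\<beta>' = (if 0 \<le> c then \<beta> else - \<beta>)"
  have \<beta>: "\<beta>\<^sup>2 = \<rho>\<^sup>2 * \<bar>c\<bar>" "\<beta>'\<^sup>2 = \<rho>\<^sup>2 * \<bar>c\<bar>" "\<beta> * \<beta>' = \<rho>\<^sup>2 * c"
  proof -
    define q where "q = sqrt \<bar>c\<bar>"
    have "\<beta> * \<beta>' = \<rho>\<^sup>2 * (q * q) * (if 0 \<le> c then 1 else - 1)"
      unfolding \<beta>'_def \<beta>_def q_def[symmetric] by (simp add: power2_eq_square)
    also have "\<dots> = \<rho>\<^sup>2 * (sqrt \<bar>c\<bar> * sqrt \<bar>c\<bar>) * (if 0 \<le> c then 1 else - 1)" by (simp only: q_def)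
    also have "sqrt \<bar>c\<bar> * sqrt \<bar>c\<bar> = \<bar>c\<bar>" by simp
    finally show "\<beta> * \<beta>' = \<rho>\<^sup>2 * c" by simp
  qed (auto simp: \<beta>_def \<beta>'_def power_mult_distrib)
  have \<tau>0: "0 < \<tau>" "\<tau>\<^sup>2 = \<rho>\<^sup>2 * (1 - \<bar>c\<bar>)" using rho c by (auto simp: \<tau> power_mult_distrib)
  have pd: "0 < \<tau>\<^sup>2" "0 < \<tau>\<^sup>2 * \<tau>\<^sup>2 - 0\<^sup>2" using \<tau>0(1) by auto
  \<comment> \<open>Only the covariance of the pair matters, so the \<open>d\<close>-dimensional
    average over \<open>x\<close> may be replaced by an average over the single common variable
    \<open>h\<close>, with independent residuals of variance \<open>\<tau>\<^sup>2\<close>.\<close>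
  have N2: "(\<integral>\<^sup>+x. 1 * ennreal (normal_density 0 \<epsilon> ((y - \<rho> * r * dot d v x) - z) * normal_density 0 \<epsilon> ((y - \<rho> * r * dot d u x) - z')) \<partial>gaussian_vec d)
     = (\<integral>\<^sup>+h. ennreal (std_normal_density h) * ennreal (normal_density 0 \<tau> ((y - \<beta> * h) - z) * normal_density 0 \<tau> ((y - \<beta>' * h) - z')) \<partial>lborel)" for z z'
  proof -
    have "(\<integral>\<^sup>+x. 1 * ennreal (normal_density 0 \<epsilon> ((y - \<rho> * r * dot d v x) - z) * normal_density 0 \<epsilon> ((y - \<rho> * r * dot d u x) - z')) \<partial>gaussian_vec d)
      = (\<integral>\<^sup>+x. ennreal (normal_density2 (\<epsilon>\<^sup>2) (\<epsilon>\<^sup>2) 0 ((y - z) - dot d (\<lambda>i. (\<rho> * r) * v i) x) ((y - z') - dot d (\<lambda>i. (\<rho> * r) * u i) x)) \<partial>gaussian_vec d)"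
      by (simp add: normal_density2_indep[OF \<epsilon>(1)] dot_scale_left algebra_simps)
    also have "\<dots> = ennreal (normal_density2 (\<epsilon>\<^sup>2 + (\<rho> * r)\<^sup>2) (\<epsilon>\<^sup>2 + (\<rho> * r)\<^sup>2) (0 + (\<rho> * r)\<^sup>2 * dot d v u) (y - z) (y - z'))"
      using \<epsilon>(1) by (subst gaussian_vec_normal_density2) (auto simp: dot_scale_both v u)
    also have "\<epsilon>\<^sup>2 + (\<rho> * r)\<^sup>2 = \<tau>\<^sup>2 + \<beta>\<^sup>2" by (simp add: \<epsilon>(2) \<tau>0(2) \<beta> power_mult_distrib algebra_simps)
    also have "0 + (\<rho> * r)\<^sup>2 * dot d v u = 0 + \<beta> * \<beta>'" by (simp add: \<beta> c power_mult_distrib)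
    also have "normal_density2 (\<tau>\<^sup>2 + \<beta>\<^sup>2) (\<tau>\<^sup>2 + \<beta>\<^sup>2) (0 + \<beta> * \<beta>') = normal_density2 (\<tau>\<^sup>2 + \<beta>\<^sup>2) (\<tau>\<^sup>2 + \<beta>'\<^sup>2) (0 + \<beta> * \<beta>')"
      by (simp add: \<beta>)
    also have "ennreal (normal_density2 (\<tau>\<^sup>2 + \<beta>\<^sup>2) (\<tau>\<^sup>2 + \<beta>'\<^sup>2) (0 + \<beta> * \<beta>') (y - z) (y - z')) =
      (\<integral>\<^sup>+h. ennreal (std_normal_density h) * ennreal (normal_density2 (\<tau>\<^sup>2) (\<tau>\<^sup>2) 0 ((y - z) - \<beta> * h) ((y - z') - \<beta>' * h)) \<partial>lborel)"
      by (rule normal_density2_rank_one(1)[OF pd, symmetric])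
    finally show ?thesis by (simp add: normal_density2_indep[OF \<tau>0(1)] algebra_simps)
  qed
  have "(\<integral>\<^sup>+x. alt_density d r v x y * alt_density d r u x y \<partial>gaussian_vec d) =
     (\<integral>\<^sup>+x. 1 * (smooth E \<epsilon> (y - \<rho> * r * dot d v x) * smooth E \<epsilon> (y - \<rho> * r * dot d u x)) \<partial>gaussian_vec d)"
    by (simp add: alt_density_def \<epsilon>_def)
  also have "\<dots> = (\<integral>\<^sup>+z. \<integral>\<^sup>+z'. \<integral>\<^sup>+h. ennreal (std_normal_density h) * ennreal (normal_density 0 \<tau> ((y - \<beta> * h) - z) * normal_density 0 \<tau> ((y - \<beta>' * h) - z')) \<partial>lborel \<partial>E \<partial>E)"
    by (subst nn_integral_mixture2) (auto simp: gv.sigma_finite_measure_axioms N2[unfolded mult_1])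
  also have "\<dots> = (\<integral>\<^sup>+h. ennreal (std_normal_density h) * (smooth E \<tau> (y - \<beta> * h) * smooth E \<tau> (y - \<beta>' * h)) \<partial>lborel)"
    by (subst nn_integral_mixture2) (auto simp: lborel.sigma_finite_measure_axioms)
  also have "\<dots> \<le> (\<integral>\<^sup>+h. ennreal (std_normal_density h) *
      ((ennreal ((1 + \<delta>) / normalizer) * ennreal (normal_density 0 (sqrt (sd\<^sup>2 + \<tau>\<^sup>2)) (y - \<beta> * h))) *
       (ennreal ((1 + \<delta>) / normalizer) * ennreal (normal_density 0 (sqrt (sd\<^sup>2 + \<tau>\<^sup>2)) (y - \<beta>' * h)))) \<partial>lborel)"
    by (intro nn_integral_mono mult_mono smooth_upper[OF \<tau>0(1) \<delta>]) auto
  also have "\<dots> = (\<integral>\<^sup>+h. ennreal (((1 + \<delta>) / normalizer)\<^sup>2) * (ennreal (std_normal_density h) *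
      ennreal (normal_density2 ((sqrt (sd\<^sup>2 + \<tau>\<^sup>2))\<^sup>2) ((sqrt (sd\<^sup>2 + \<tau>\<^sup>2))\<^sup>2) 0 (y - \<beta> * h) (y - \<beta>' * h))) \<partial>lborel)"
    using \<delta>(1) normalizer(2) \<tau>0(1) sd(1)
    by (intro nn_integral_cong, subst normal_density2_indep)
      (auto simp: ennreal_mult'[symmetric] power2_eq_square mult_ac add_pos_pos)
  also have "\<dots> = ennreal (((1 + \<delta>) / normalizer)\<^sup>2) * ennreal (normal_density2 ((sqrt (sd\<^sup>2 + \<tau>\<^sup>2))\<^sup>2 + \<beta>\<^sup>2) ((sqrt (sd\<^sup>2 + \<tau>\<^sup>2))\<^sup>2 + \<beta>'\<^sup>2) (0 + \<beta> * \<beta>') y y)"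
  proof -
    have "0 < (sqrt (sd\<^sup>2 + \<tau>\<^sup>2))\<^sup>2" using sd(1) \<tau>0(1) by (simp add: add_pos_pos)
    then have "0 < (sqrt (sd\<^sup>2 + \<tau>\<^sup>2))\<^sup>2" "0 < (sqrt (sd\<^sup>2 + \<tau>\<^sup>2))\<^sup>2 * (sqrt (sd\<^sup>2 + \<tau>\<^sup>2))\<^sup>2 - 0\<^sup>2" by simp_all
    from normal_density2_rank_one(1)[OF this] show ?thesis by (subst nn_integral_cmult) auto
  qed
  also have "(sqrt (sd\<^sup>2 + \<tau>\<^sup>2))\<^sup>2 + \<beta>\<^sup>2 = 1"
    using \<tau>0(1) sd(1) by (simp add: add_pos_pos less_imp_le) (simp add: sd(2) \<tau>0(2) \<beta> algebra_simps)
  also have "(sqrt (sd\<^sup>2 + \<tau>\<^sup>2))\<^sup>2 + \<beta>'\<^sup>2 = 1"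
    using \<tau>0(1) sd(1) by (simp add: add_pos_pos less_imp_le) (simp add: sd(2) \<tau>0(2) \<beta> algebra_simps)
  finally show ?thesis by (simp add: \<beta> ennreal_mult'[symmetric])
qed

text \<open>The inner product, in L2 of the null distribution, of the two likelihood ratios at
  interpolation level \<open>r\<close>.\<close>

definition correlation :: "nat \<Rightarrow> real \<Rightarrow> (nat \<Rightarrow> real) \<Rightarrow> (nat \<Rightarrow> real) \<Rightarrow> ennreal" where
  "correlation d r v u = (\<integral>\<^sup>+y. (\<integral>\<^sup>+x. alt_density d r v x y * alt_density d r u x y \<partial>gaussian_vec d) / response_density y \<partial>lborel)"

text \<open>The numerator carries \<open>normalizer\<close> to the power -2 and the lower bound for
  the null density carries it to the power -1. One power survives and is bounded through
  \<open>1 - \<epsilon> \<le> normalizer\<close>; what remains is the integral of the Gaussian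
  model.\<close>

lemma correlation_le:
  assumes r: "0 \<le> r" "r < 1" and v: "dot d v v = 1" and u: "dot d u u = 1"
    and c: "c = r\<^sup>2 * dot d v u" "\<bar>c\<bar> < 1"
    and \<tau>: "\<tau> = \<rho> * sqrt (1 - \<bar>c\<bar>)"
    and \<delta>: "0 \<le> \<delta>" "\<And>x. theta (sd\<^sup>2 * \<tau>\<^sup>2 / (sd\<^sup>2 + \<tau>\<^sup>2) / s\<^sup>2) x \<le> 1 + ennreal \<delta>"
    and \<epsilon>: "0 \<le> \<epsilon>" "\<epsilon> < 1" "\<And>x. 1 \<le> theta (sd\<^sup>2 * \<rho>\<^sup>2 / s\<^sup>2) x + ennreal \<epsilon>" "1 \<le> theta (sd\<^sup>2 / s\<^sup>2) 0 + ennreal \<epsilon>"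
  shows "correlation d r v u \<le> ennreal (((1 + \<delta>) / (1 - \<epsilon>))\<^sup>2 / (1 - \<rho>\<^sup>2 * c))"
proof -
  have n: "1 - \<epsilon> \<le> normalizer"
  proof -
    have "1 \<le> ennreal (normalizer + \<epsilon>)" using \<epsilon>(1,4) normalizer by simp
    then show ?thesis by (simp del: ennreal_plus)
  qed
  have k: "\<bar>\<rho>\<^sup>2 * c\<bar> < 1"
    using rho2 c(2) mult_strict_mono[of "\<rho>\<^sup>2" 1 "\<bar>c\<bar>" 1] by (simp add: abs_mult)
  have kk: "0 < 1 * 1 - (\<rho>\<^sup>2 * c)\<^sup>2" using k by (simp add: abs_square_less_1)
  have resp: "ennreal ((1 - \<epsilon>) / normalizer * std_normal_density y) \<le> response_density y" for y
    unfolding response_density_def using smooth_lower[OF rho(1) \<epsilon>(1,2), of y] \<epsilon>(3)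
    by (simp add: sd(2))
  have "correlation d r v u \<le> (\<integral>\<^sup>+y. ennreal (((1 + \<delta>) / (1 - \<epsilon>))\<^sup>2) * ennreal (normal_density2 1 1 (\<rho>\<^sup>2 * c) y y / std_normal_density y) \<partial>lborel)"
    unfolding correlation_def
  proof (intro nn_integral_mono)
    fix y :: real
    have sn: "0 < std_normal_density y" by (simp add: normal_density_pos)
    have "(\<integral>\<^sup>+x. alt_density d r v x y * alt_density d r u x y \<partial>gaussian_vec d) / response_density y
      \<le> ennreal ((((1 + \<delta>) / normalizer)\<^sup>2 * normal_density2 1 1 (\<rho>\<^sup>2 * c) y y) / ((1 - \<epsilon>) / normalizer * std_normal_density y))"
      using \<epsilon> normalizer(2) sn kk
      by (intro ennreal_divide_mono alt_density_correlation[OF r v u c \<tau> \<delta>] resp)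
        (auto intro!: mult_nonneg_nonneg mult_pos_pos divide_pos_pos normal_density2_nonneg)
    also have "\<dots> \<le> ennreal (((1 + \<delta>) / (1 - \<epsilon>))\<^sup>2 * (normal_density2 1 1 (\<rho>\<^sup>2 * c) y y / std_normal_density y))"
    proof (rule ennreal_leI)
      have "(((1 + \<delta>) / normalizer)\<^sup>2 * normal_density2 1 1 (\<rho>\<^sup>2 * c) y y) / ((1 - \<epsilon>) / normalizer * std_normal_density y) =
         (1 + \<delta>)\<^sup>2 / ((1 - \<epsilon>) * normalizer) * (normal_density2 1 1 (\<rho>\<^sup>2 * c) y y / std_normal_density y)"
        using normalizer(2) sn \<epsilon> by (simp add: power2_eq_square field_simps)
      also have "\<dots> \<le> (1 + \<delta>)\<^sup>2 / ((1 - \<epsilon>) * (1 - \<epsilon>)) * (normal_density2 1 1 (\<rho>\<^sup>2 * c) y y / std_normal_density y)"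
        using n \<epsilon> sn kk normalizer(2)
        by (intro mult_right_mono divide_left_mono mult_left_mono mult_pos_pos divide_nonneg_nonneg normal_density2_nonneg) auto
      finally show "(((1 + \<delta>) / normalizer)\<^sup>2 * normal_density2 1 1 (\<rho>\<^sup>2 * c) y y) / ((1 - \<epsilon>) / normalizer * std_normal_density y)
         \<le> ((1 + \<delta>) / (1 - \<epsilon>))\<^sup>2 * (normal_density2 1 1 (\<rho>\<^sup>2 * c) y y / std_normal_density y)"
        by (simp add: power_divide power2_eq_square)
    qed
    finally show "(\<integral>\<^sup>+x. alt_density d r v x y * alt_density d r u x y \<partial>gaussian_vec d) / response_density y \<le>
       ennreal (((1 + \<delta>) / (1 - \<epsilon>))\<^sup>2) * ennreal (normal_density2 1 1 (\<rho>\<^sup>2 * c) y y / std_normal_density y)"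
      by (subst ennreal_mult'[symmetric]) auto
  qed
  also have "\<dots> = ennreal (((1 + \<delta>) / (1 - \<epsilon>))\<^sup>2) * ennreal (1 / (1 - \<rho>\<^sup>2 * c))"
    by (subst nn_integral_cmult) (auto simp: nn_integral_normal_density2_diagonal[OF k])
  also have "\<dots> = ennreal (((1 + \<delta>) / (1 - \<epsilon>))\<^sup>2 / (1 - \<rho>\<^sup>2 * c))"
    by (simp add: ennreal_mult'[symmetric])
  finally show ?thesis .
qed

end

section \<open>The uniform distribution on the sphere\<close>

lemma sets_uniform_sphere [measurable_cong, simp]: "sets (uniform_sphere d) = sets (vec_space d)"
  and space_uniform_sphere: "space (uniform_sphere d) = space (vec_space d)"
  by (simp_all add: uniform_sphere_def)

lemma measurable_normalize [measurable]:
  "(\<lambda>g. \<lambda>i\<in>{..<d}. g i / sqrt (dot d g g)) \<in> measurable (vec_space d) (vec_space d)"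
proof (rule measurable_restrict)
  fix i assume "i \<in> {..<d}"
  then have [measurable]: "(\<lambda>g. g i) \<in> borel_measurable (vec_space d)"
    by (intro measurable_component_singleton)
  show "(\<lambda>g. g i / sqrt (dot d g g)) \<in> borel_measurable (vec_space d)"
    by measurable
qed

lemma prob_space_uniform_sphere: "prob_space (uniform_sphere d)"
  unfolding uniform_sphere_def
  by (rule prob_space.prob_space_distr[OF prob_space_gaussian_vec]) simp

lemma nn_integral_uniform_sphere:
  assumes [measurable]: "f \<in> borel_measurable (vec_space d)"
  shows "(\<integral>\<^sup>+v. f v \<partial>uniform_sphere d) = (\<integral>\<^sup>+g. f (\<lambda>i\<in>{..<d}. g i / sqrt (dot d g g)) \<partial>gaussian_vec d)"
  unfolding uniform_sphere_def by (subst nn_integral_distr) auto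

lemma dot_normalize: "dot d v (\<lambda>i\<in>{..<d}. g i / sqrt (dot d g g)) = dot d v g / sqrt (dot d g g)"
  unfolding dot_def by (simp add: sum_divide_distrib)

lemma dot_self_nonneg: "0 \<le> dot d v v"
  unfolding dot_def by (intro sum_nonneg) simp

lemma dot_Cauchy_Schwarz: "(dot d v u)\<^sup>2 \<le> dot d v v * dot d u u"
  using Cauchy_Schwarz_ineq_sum[of v u "{..<d}"] by (simp add: dot_def power2_eq_square)

lemma abs_dot_le_one: "dot d v v = 1 \<Longrightarrow> dot d u u = 1 \<Longrightarrow> \<bar>dot d v u\<bar> \<le> 1"
  using dot_Cauchy_Schwarz[of d v u] by (simp add: abs_square_le_1)

lemma AE_uniform_sphere_unit:
  assumes "0 < d"
  shows "AE v in uniform_sphere d. v \<in> unit_sphere d"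
proof -
  have eq: "{v \<in> space (vec_space d). v \<in> unit_sphere d} = {v \<in> space (vec_space d). sqrt (dot d v v) = 1}"
    by (auto simp: unit_sphere_def space_PiM)
  have ms: "{v \<in> space (vec_space d). v \<in> unit_sphere d} \<in> sets (vec_space d)"
    unfolding eq by measurable
  have "AE g in gaussian_vec d. g 0 \<noteq> 0"
  proof -
    have "AE y in gaussian 0 1. y \<noteq> 0"
      unfolding gaussian_def by (subst AE_density) (auto intro: AE_mp[OF AE_lborel_singleton[of 0]])
    moreover have "distr (gaussian_vec d) (gaussian 0 1) (\<lambda>g. g 0) = gaussian 0 1"
      unfolding gaussian_vec_def using assms
      by (intro distr_PiM_component prob_space_gaussian) auto
    ultimately have "AE y in distr (gaussian_vec d) (gaussian 0 1) (\<lambda>g. g 0). y \<noteq> 0" by (simp only:)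
    then show ?thesis
      using assms by (subst (asm) AE_distr_iff) auto
  qed
  then have "AE g in gaussian_vec d. (\<lambda>i\<in>{..<d}. g i / sqrt (dot d g g)) \<in> unit_sphere d"
  proof (rule AE_mp, intro AE_I2 impI)
    fix g :: "nat \<Rightarrow> real" assume g: "g 0 \<noteq> 0"
    let ?u = "\<lambda>i\<in>{..<d}. g i / sqrt (dot d g g)"
    have "0 < g 0 * g 0" using g not_real_square_gt_zero[of "g 0"] by blast
    also have "\<dots> \<le> dot d g g"
      unfolding dot_def using assms by (intro member_le_sum) auto
    finally have p: "0 < dot d g g" .
    have "dot d ?u ?u = (\<Sum>i<d. g i * g i) / dot d g g"
      using p unfolding sum_divide_distrib by (subst dot_def) (intro sum.cong, auto)
    then have "dot d ?u ?u = 1" using p by (simp add: dot_def)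
    then show "?u \<in> unit_sphere d" by (auto simp: unit_sphere_def)
  qed
  then show ?thesis
    unfolding uniform_sphere_def using ms by (subst AE_distr_iff) auto
qed

text \<open>A Gamma integral: the right-hand side is \<open>6 / N ^ 4\<close> for positive
  \<open>N\<close>, and both sides are infinite at 0. Writing an inverse power as a mixture of
  exponentials reduces inverse moments to the exponential moments of Gaussian vectors.\<close>

lemma inverse_power4_le:
  assumes "0 \<le> N"
  shows "inverse (ennreal N) ^ 4 \<le> (\<integral>\<^sup>+u\<in>{0..}. ennreal (u ^ 3 * exp (- (u * N))) \<partial>lborel)"
proof (cases "N = 0")
  case True
  have "(\<top>::ennreal) = (\<integral>\<^sup>+u. indicator {1::real..} u \<partial>lborel)"
  proof -
    have "ennreal r \<le> emeasure lborel {1::real..}" if "0 \<le> r" for r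
      using emeasure_mono[of "{1..1 + r}" "{1..}" lborel] that by auto
    then have "emeasure lborel {1::real..} = \<top>"
      by (metis ennreal_Ex_less_of_nat linorder_not_less of_nat_0_le_iff ennreal_of_nat_eq_real_of_nat infinity_ennreal_def not_le_imp_less top_greatest order.not_eq_order_implies_strict)
    then show ?thesis by simp
  qed
  also have "\<dots> \<le> (\<integral>\<^sup>+u\<in>{0..}. ennreal (u ^ 3 * exp (- (u * N))) \<partial>lborel)"
    by (intro nn_integral_mono) (auto simp: indicator_def True one_le_power)
  finally show ?thesis by (simp add: top_unique)
next
  case False
  with assms have N: "0 < N" by simp
  have "ennreal 6 = (\<integral>\<^sup>+x. ennreal (x ^ 3 * exp (- x)) * indicator {0..} x \<partial>lborel)"
    using nn_intergal_power_times_exp_Ici[of 3] by (simp add: fact_numeral)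
  also have "\<dots> = ennreal N * (\<integral>\<^sup>+u. ennreal ((N * u) ^ 3 * exp (- (N * u))) * indicator {0..} (N * u) \<partial>lborel)"
    using N by (subst nn_integral_real_affine[where c=N and t=0]) auto
  also have "(\<integral>\<^sup>+u. ennreal ((N * u) ^ 3 * exp (- (N * u))) * indicator {0..} (N * u) \<partial>lborel) =
      (\<integral>\<^sup>+u. ennreal (N ^ 3) * (ennreal (u ^ 3 * exp (- (u * N))) * indicator {0..} u) \<partial>lborel)"
    using N by (intro nn_integral_cong)
      (auto simp: indicator_def zero_le_mult_iff ennreal_mult[symmetric] power_mult_distrib mult_ac)
  also have "\<dots> = ennreal (N ^ 3) * (\<integral>\<^sup>+u\<in>{0..}. ennreal (u ^ 3 * exp (- (u * N))) \<partial>lborel)"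
    by (rule nn_integral_cmult) measurable
  finally have 6: "ennreal 6 = ennreal (N ^ 4) * (\<integral>\<^sup>+u\<in>{0..}. ennreal (u ^ 3 * exp (- (u * N))) \<partial>lborel)"
    using N by (simp add: mult.assoc[symmetric] ennreal_mult[symmetric] power_Suc[symmetric] del: power_Suc)
  have i: "inverse (ennreal N) ^ 4 = ennreal (1 / N ^ 4)"
    using N by (simp add: inverse_ennreal ennreal_power power_divide inverse_eq_divide)
  have "inverse (ennreal N) ^ 4 \<le> ennreal (1 / N ^ 4) * ennreal 6"
    unfolding i using N by (subst ennreal_mult[symmetric]) (auto intro!: ennreal_leI simp: divide_right_mono)
  also have "\<dots> = (\<integral>\<^sup>+u\<in>{0..}. ennreal (u ^ 3 * exp (- (u * N))) \<partial>lborel)"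
    unfolding 6 using N by (simp add: mult.assoc[symmetric] ennreal_mult[symmetric])
  finally show ?thesis .
qed

text \<open>The quantity inverted is the squared distance of \<open>g\<close> from the line spanned
  by \<open>v\<close>, a chi-square variable with \<open>d - 1\<close> degrees of freedom. For
  \<open>d \<ge> 11\<close> its Laplace transform is at most \<open>1 / (1 + u) ^ 5\<close>, and
  \<open>u ^ 3 / (1 + u) ^ 5 \<le> 1 / (1 + u)\<^sup>2\<close> has integral at most 1.\<close>

lemma gaussian_vec_inverse_dist:
  assumes v: "dot d v v = 1" and d: "11 \<le> d"
  shows "(\<integral>\<^sup>+g. inverse (ennreal (dot d g g - (dot d v g)\<^sup>2)) ^ 4 \<partial>gaussian_vec d) \<le> 1"
proof -
  interpret pair_sigma_finite lborel "gaussian_vec d"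
    by (simp add: pair_sigma_finite_def prob_space_imp_sigma_finite prob_space_gaussian_vec sigma_finite_lborel)
  have N: "0 \<le> dot d g g - (dot d v g)\<^sup>2" for g
    using dot_Cauchy_Schwarz[of d v g] v by simp
  have "(\<integral>\<^sup>+g. inverse (ennreal (dot d g g - (dot d v g)\<^sup>2)) ^ 4 \<partial>gaussian_vec d) \<le>
      (\<integral>\<^sup>+g. (\<integral>\<^sup>+u\<in>{0..}. ennreal (u ^ 3 * exp (- (u * (dot d g g - (dot d v g)\<^sup>2)))) \<partial>lborel) \<partial>gaussian_vec d)"
    by (intro nn_integral_mono inverse_power4_le N)
  also have "\<dots> = (\<integral>\<^sup>+u. \<integral>\<^sup>+g. ennreal (u ^ 3 * exp (- (u * (dot d g g - (dot d v g)\<^sup>2)))) * indicator {0..} u \<partial>gaussian_vec d \<partial>lborel)"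
    by (rule Fubini') measurable
  also have "\<dots> \<le> (\<integral>\<^sup>+u. ennreal (inverse ((1 + u) ^ 2)) * indicator {0..} u \<partial>lborel)"
  proof (intro nn_integral_mono)
    fix u :: real
    show "(\<integral>\<^sup>+g. ennreal (u ^ 3 * exp (- (u * (dot d g g - (dot d v g)\<^sup>2)))) * indicator {0..} u \<partial>gaussian_vec d)
        \<le> ennreal (inverse ((1 + u) ^ 2)) * indicator {0..} u"
    proof (cases "0 \<le> u")
      case True
      have "(\<integral>\<^sup>+g. ennreal (u ^ 3 * exp (- (u * (dot d g g - (dot d v g)\<^sup>2)))) * indicator {0..} u \<partial>gaussian_vec d) =
        (\<integral>\<^sup>+g. ennreal (u ^ 3) * ennreal (exp (u * (dot d v g)\<^sup>2 - u * dot d g g)) \<partial>gaussian_vec d)"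
        using True by (intro nn_integral_cong) (simp add: ennreal_mult[symmetric] algebra_simps)
      also have "\<dots> = ennreal (u ^ 3) * ennreal (1 / (sqrt (1 + 2 * u) ^ d * sqrt (1 - 2 * u / (1 + 2 * u))))"
        using True v by (subst nn_integral_cmult, measurable) (subst gaussian_vec_exp_quadratic, auto)
      also have "\<dots> \<le> ennreal (inverse ((1 + u) ^ 2))"
      proof -
        have s: "sqrt (1 - 2 * u / (1 + 2 * u)) = 1 / sqrt (1 + 2 * u)"
        proof -
          have "1 - 2 * u / (1 + 2 * u) = 1 / (1 + 2 * u)" using True by (simp add: field_simps)
          then show ?thesis by (simp add: real_sqrt_divide)
        qed
        obtain e where e: "d = e + 11" using d by (metis le_add_diff_inverse2)
        have "(1 + u) ^ 5 \<le> (1 + 2 * u) ^ 5" using True by (intro power_mono) auto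
        also have "\<dots> = sqrt (1 + 2 * u) ^ 10"
        proof -
          have "sqrt (1 + 2 * u) ^ 10 = (sqrt (1 + 2 * u) ^ 2) ^ 5" by (simp only: power_mult[symmetric]) simp
          then show ?thesis using True by simp
        qed
        also have "\<dots> \<le> sqrt (1 + 2 * u) ^ e * sqrt (1 + 2 * u) ^ 10"
          using True mult_right_mono[of 1 "sqrt (1 + 2 * u) ^ e" "sqrt (1 + 2 * u) ^ 10"] by (simp add: one_le_power)
        also have "\<dots> = sqrt (1 + 2 * u) ^ d * sqrt (1 - 2 * u / (1 + 2 * u))"
          using True unfolding s e by (simp add: power_add field_simps power_Suc[symmetric] del: power_Suc)
        finally have le: "(1 + u) ^ 5 \<le> sqrt (1 + 2 * u) ^ d * sqrt (1 - 2 * u / (1 + 2 * u))" .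
        have p: "0 < (1 + u) ^ 5" using True by simp
        have "u ^ 3 * (1 / (sqrt (1 + 2 * u) ^ d * sqrt (1 - 2 * u / (1 + 2 * u)))) \<le> (1 + u) ^ 3 * (1 / (1 + u) ^ 5)"
          using True le p by (intro mult_mono power_mono divide_left_mono mult_pos_pos) auto
        also have "\<dots> = inverse ((1 + u) ^ 2)"
          using True by (simp add: field_simps power_add[symmetric])
        finally show ?thesis
          using True by (subst ennreal_mult[symmetric]) (auto intro!: ennreal_leI)
      qed
      finally show ?thesis using True by simp
    qed (simp add: indicator_def)
  qed
  also have "\<dots> = ennreal (0 - - 1 / (1 + 0))"
  proof (rule nn_integral_FTC_atLeast)
    show "((\<lambda>u. - 1 / (1 + u)) has_real_derivative inverse ((1 + u)\<^sup>2)) (at u)" if "0 \<le> u" for u :: real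
      using that by (auto intro!: derivative_eq_intros simp: power2_eq_square field_simps)
    show "((\<lambda>u. - 1 / (1 + u)) \<longlongrightarrow> 0) (at_top :: real filter)"
      by real_asymp
  qed auto
  finally show ?thesis by simp
qed

text \<open>A crude bound suffices: \<open>x ^ 8 \<le> 65536 * exp (x\<^sup>2 / 4)\<close>, and the
  exponential has mean \<open>sqrt 2 \<le> 3/2\<close>.\<close>

lemma gaussian_vec_moment8:
  assumes v: "dot d v v = 1"
  shows "(\<integral>\<^sup>+g. ennreal ((dot d v g) ^ 8) \<partial>gaussian_vec d) \<le> ennreal 98304"
proof -
  have "(\<integral>\<^sup>+g. ennreal ((dot d v g) ^ 8) \<partial>gaussian_vec d) \<le>
    (\<integral>\<^sup>+g. ennreal 65536 * ennreal (exp (1/4 * (dot d v g)\<^sup>2 - 0 * dot d g g)) \<partial>gaussian_vec d)"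
  proof (intro nn_integral_mono)
    fix g
    define z where "z = (dot d v g)\<^sup>2 / 4"
    have z: "0 \<le> z" by (simp add: z_def)
    have "z / 4 \<le> exp (z / 4)" using exp_ge_add_one_self[of "z / 4"] by linarith
    then have "(z / 4) ^ 4 \<le> exp (z / 4) ^ 4" using z by (intro power_mono) auto
    also have "\<dots> = exp z" by (simp add: exp_of_nat_mult[symmetric])
    finally have "z ^ 4 \<le> 256 * exp z" by (simp add: power_divide)
    moreover have "(dot d v g) ^ 8 = 256 * z ^ 4"
      by (simp add: z_def power_divide power_mult[symmetric])
    ultimately have "(dot d v g) ^ 8 \<le> 65536 * exp (1/4 * (dot d v g)\<^sup>2)" by (simp add: z_def)
    then show "ennreal ((dot d v g) ^ 8) \<le> ennreal 65536 * ennreal (exp (1/4 * (dot d v g)\<^sup>2 - 0 * dot d g g))"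
      by (subst ennreal_mult[symmetric]) (auto intro: ennreal_leI)
  qed
  also have "\<dots> = ennreal 65536 * ennreal (1 / sqrt (1/2))"
    using gaussian_vec_exp_quadratic[OF v, of 0 "1/4"] by (subst nn_integral_cmult) auto
  also have "\<dots> \<le> ennreal 65536 * ennreal (3/2)"
  proof (intro mult_left_mono ennreal_leI)
    have "2/3 \<le> sqrt (1/2)" by (rule real_le_rsqrt) (simp add: power2_eq_square)
    then show "1 / sqrt (1/2) \<le> 3/2" by (simp add: divide_le_eq)
  qed simp
  also have "\<dots> = ennreal 98304" by (subst ennreal_mult[symmetric]) auto
  finally show ?thesis .
qed

text \<open>Let \<open>X = v \<bullet> g\<close>, let \<open>S\<close> be the squared norm of
  \<open>g\<close>, and \<open>N = S - X\<^sup>2\<close>. With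
  \<open>t = \<bar>X\<bar> / sqrt S\<close> one has \<open>1 - t\<^sup>2 = N / S\<close>, hence
  \<open>1 / (1 - t) \<le> 2 * S / N = 2 * (1 + X\<^sup>2 / N)\<close>. The inequality between
  arithmetic and geometric means separates the square of this into an eighth moment of
  \<open>X\<close> and a fourth inverse moment of \<open>N\<close>.\<close>

lemma uniform_sphere_inverse_moment:
  assumes v: "dot d v v = 1" and d: "11 \<le> d"
  shows "(\<integral>\<^sup>+u. (inverse (ennreal (1 - \<bar>dot d v u\<bar>)))\<^sup>2 \<partial>uniform_sphere d) \<le> ennreal 400000"
proof -
  interpret prob_space "gaussian_vec d" by (rule prob_space_gaussian_vec)
  let ?N = "\<lambda>g. dot d g g - (dot d v g)\<^sup>2"
  have "(\<integral>\<^sup>+u. (inverse (ennreal (1 - \<bar>dot d v u\<bar>)))\<^sup>2 \<partial>uniform_sphere d) =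
     (\<integral>\<^sup>+g. (inverse (ennreal (1 - \<bar>dot d v g / sqrt (dot d g g)\<bar>)))\<^sup>2 \<partial>gaussian_vec d)"
    by (subst nn_integral_uniform_sphere) (auto simp: dot_normalize)
  also have "\<dots> \<le> (\<integral>\<^sup>+g. ennreal 8 + ennreal 4 * ennreal ((dot d v g) ^ 8) + ennreal 4 * inverse (ennreal (?N g)) ^ 4 \<partial>gaussian_vec d)"
  proof (intro nn_integral_mono)
    fix g
    define X S where "X = dot d v g" and "S = dot d g g"
    define N where "N = S - X\<^sup>2"
    have N: "0 \<le> N" and S: "0 \<le> S"
      using dot_Cauchy_Schwarz[of d v g] v by (simp_all add: N_def X_def S_def dot_self_nonneg)
    have "(inverse (ennreal (1 - \<bar>X / sqrt S\<bar>)))\<^sup>2 \<le> ennreal 8 + ennreal 4 * ennreal (X ^ 8) + ennreal 4 * inverse (ennreal N) ^ 4"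
    proof (cases "N = 0")
      case True
      then show ?thesis by (cases "S = 0") (auto simp: ennreal_mult_top)
    next
      case False
      with N have N0: "0 < N" by simp
      then have S0: "0 < S" unfolding N_def using zero_le_power2[of X] by linarith
      define t where "t = \<bar>X / sqrt S\<bar>"
      have t2: "t\<^sup>2 = X\<^sup>2 / S" using S0 by (simp add: t_def power_divide)
      have t2': "1 - t\<^sup>2 = N / S" using S0 by (simp add: t2 N_def field_simps)
      then have "t\<^sup>2 < 1" using N0 S0 by (smt (verit) divide_pos_pos)
      then have t: "0 \<le> t" "t < 1" by (auto simp: t_def power2_less_1_iff)
      have "1 - t\<^sup>2 = (1 - t) * (1 + t)" by (simp add: power2_eq_square algebra_simps)
      also have "\<dots> \<le> (1 - t) * 2" using t by (intro mult_left_mono) auto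
      finally have "N / S \<le> 2 * (1 - t)" using t2' by simp
      then have i: "1 / (1 - t) \<le> 2 * S / N" using t N0 S0 by (simp add: field_simps)
      have "(1 / (1 - t))\<^sup>2 \<le> (2 * S / N)\<^sup>2" using t i by (intro power_mono) auto
      also have "2 * S / N = 2 * (1 + X\<^sup>2 / N)" using N0 by (simp add: N_def field_simps)
      also have "(2 * (1 + X\<^sup>2 / N))\<^sup>2 \<le> 8 + 4 * X ^ 8 + 4 * (1 / N) ^ 4"
      proof -
        define a b where "a = X ^ 4" and "b = (1 / N)\<^sup>2"
        define p where "p = X\<^sup>2 / N"
        have "p\<^sup>2 = a * b" by (simp add: p_def a_def b_def power_divide power_mult[symmetric])
        moreover have "(2 * (1 + p))\<^sup>2 \<le> 8 + 8 * p\<^sup>2"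
          using zero_le_power2[of "1 - p"] by (simp add: power2_eq_square algebra_simps)
        moreover have "8 * (a * b) \<le> 4 * a\<^sup>2 + 4 * b\<^sup>2"
          using zero_le_power2[of "a - b"] by (simp add: power2_eq_square algebra_simps)
        moreover have "a\<^sup>2 = X ^ 8" "b\<^sup>2 = (1 / N) ^ 4" by (simp_all add: a_def b_def power_mult[symmetric])
        ultimately show ?thesis by (simp add: p_def)
      qed
      finally have "(1 / (1 - t))\<^sup>2 \<le> 8 + 4 * X ^ 8 + 4 * (1 / N) ^ 4" .
      then have le: "ennreal ((1 / (1 - t))\<^sup>2) \<le> ennreal (8 + 4 * X ^ 8 + 4 * (1 / N) ^ 4)" by (rule ennreal_leI)
      have r: "ennreal (8 + 4 * X ^ 8 + 4 * q) = ennreal 8 + ennreal 4 * ennreal (X ^ 8) + ennreal 4 * ennreal q"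
        if "0 \<le> q" for q
        using that by (simp add: ennreal_mult')
      have i: "inverse (ennreal (1 - t)) = ennreal (1 / (1 - t))" "inverse (ennreal N) = ennreal (1 / N)"
        using t N0 by (simp_all add: inverse_ennreal inverse_eq_divide)
      have p: "ennreal (1 / (1 - t)) ^ 2 = ennreal ((1 / (1 - t)) ^ 2)" "ennreal (1 / N) ^ 4 = ennreal ((1 / N) ^ 4)"
        using t N0 by (simp_all only: ennreal_power divide_nonneg_nonneg zero_le_one less_imp_le diff_ge_0_iff_ge)
      have "0 \<le> (1 / N) ^ 4" using N0 by simp
      from le[unfolded r[OF this]] show ?thesis unfolding t_def[symmetric] i p .
    qed
    then show "(inverse (ennreal (1 - \<bar>dot d v g / sqrt (dot d g g)\<bar>)))\<^sup>2 \<le>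
       ennreal 8 + ennreal 4 * ennreal ((dot d v g) ^ 8) + ennreal 4 * inverse (ennreal (?N g)) ^ 4"
      by (simp only: X_def S_def N_def)
  qed
  also have "\<dots> = ennreal 8 + ennreal 4 * (\<integral>\<^sup>+g. ennreal ((dot d v g) ^ 8) \<partial>gaussian_vec d) +
     ennreal 4 * (\<integral>\<^sup>+g. inverse (ennreal (?N g)) ^ 4 \<partial>gaussian_vec d)"
    by (simp add: nn_integral_add nn_integral_cmult emeasure_space_1)
  also have "\<dots> \<le> ennreal 8 + ennreal 4 * ennreal 98304 + ennreal 4 * 1"
    using gaussian_vec_moment8[OF v] gaussian_vec_inverse_dist[OF v d]
    by (intro add_mono mult_left_mono) auto
  also have "\<dots> = ennreal (8 + 4 * 98304 + 4)"
    by (simp del: ennreal_numeral flip: ennreal_numeral ennreal_mult ennreal_plus)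
  also have "\<dots> \<le> ennreal 400000" by (intro ennreal_leI) simp
  finally show ?thesis .
qed

text \<open>Exponential Markov inequality with an exponent chosen so that the norm of
  \<open>g\<close> need not be controlled:
  \<open>\<tau> < \<bar>v \<bullet> g\<bar> / \<parallel>g\<parallel>\<close> makes \<open>(v
  \<bullet> g)\<^sup>2 - \<tau>\<^sup>2 * \<parallel>g\<parallel>\<^sup>2\<close>
  nonnegative.\<close>

lemma uniform_sphere_cap:
  assumes v: "dot d v v = 1" and \<tau>: "0 \<le> \<tau>" "\<tau> \<le> 1"
  shows "emeasure (uniform_sphere d) {u \<in> space (vec_space d). \<tau> < \<bar>dot d v u\<bar>} \<le> ennreal (2 * exp (- real d * \<tau>\<^sup>2 / 8))"
proof -
  have "emeasure (uniform_sphere d) {u \<in> space (vec_space d). \<tau> < \<bar>dot d v u\<bar>} =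
      (\<integral>\<^sup>+u. indicator {u \<in> space (vec_space d). \<tau> < \<bar>dot d v u\<bar>} u \<partial>uniform_sphere d)"
    by (subst nn_integral_indicator) auto
  also have "\<dots> = (\<integral>\<^sup>+g. indicator {u \<in> space (vec_space d). \<tau> < \<bar>dot d v u\<bar>} (\<lambda>i\<in>{..<d}. g i / sqrt (dot d g g)) \<partial>gaussian_vec d)"
    by (subst nn_integral_uniform_sphere) auto
  also have "\<dots> \<le> (\<integral>\<^sup>+g. ennreal (exp (1/4 * (dot d v g)\<^sup>2 - \<tau>\<^sup>2/4 * dot d g g)) \<partial>gaussian_vec d)"
  proof (intro nn_integral_mono)
    fix g
    have "1 \<le> exp (1/4 * (dot d v g)\<^sup>2 - \<tau>\<^sup>2/4 * dot d g g)" if "\<tau> < \<bar>dot d v g / sqrt (dot d g g)\<bar>"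
    proof -
      have "\<tau> * sqrt (dot d g g) \<le> \<bar>dot d v g\<bar>"
        using that dot_self_nonneg[of d g] \<tau>
        by (cases "dot d g g = 0") (auto simp: abs_divide less_divide_eq less_imp_le)
      then have "(\<tau> * sqrt (dot d g g))\<^sup>2 \<le> \<bar>dot d v g\<bar>\<^sup>2"
        using \<tau> dot_self_nonneg[of d g] by (intro power_mono) auto
      then have "\<tau>\<^sup>2 * dot d g g \<le> (dot d v g)\<^sup>2"
        using dot_self_nonneg[of d g] by (simp add: power_mult_distrib)
      then show ?thesis by simp
    qed
    then show "indicator {u \<in> space (vec_space d). \<tau> < \<bar>dot d v u\<bar>} (\<lambda>i\<in>{..<d}. g i / sqrt (dot d g g)) \<le>
        ennreal (exp (1/4 * (dot d v g)\<^sup>2 - \<tau>\<^sup>2/4 * dot d g g))"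
      by (auto simp: indicator_def dot_normalize)
  qed
  also have "\<dots> = ennreal (1 / (sqrt (1 + \<tau>\<^sup>2/2) ^ d * sqrt (1 - (1/2) / (1 + \<tau>\<^sup>2/2))))"
    using gaussian_vec_exp_quadratic[OF v, of "\<tau>\<^sup>2/4" "1/4"] zero_le_power2[of \<tau>] by simp
  also have "\<dots> \<le> ennreal (2 * exp (- real d * \<tau>\<^sup>2 / 8))"
  proof (rule ennreal_leI)
    define x where "x = \<tau>\<^sup>2/2"
    have x: "0 \<le> x" "x \<le> 1/2" using \<tau> by (auto simp: x_def power_le_one)
    have "exp (x / 2) \<le> 1 + x"
    proof -
      have "exp (x / 2) \<le> 1 + x/2 + (x/2)\<^sup>2" using x by (intro exp_bound) auto
      also have "(x/2)\<^sup>2 \<le> x/2"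
        using mult_left_mono[of "x/2" 1 "x/2"] x by (simp add: power2_eq_square)
      finally show ?thesis by simp
    qed
    then have "sqrt (exp (x / 2)) \<le> sqrt (1 + x)" by simp
    moreover have "sqrt (exp (x / 2)) = exp (x / 4)"
      by (rule real_sqrt_unique) (auto simp: power2_eq_square exp_add[symmetric])
    ultimately have "exp (x / 4) ^ d \<le> sqrt (1 + x) ^ d" by (intro power_mono) auto
    moreover have "exp (x / 4) ^ d = exp (real d * \<tau>\<^sup>2 / 8)"
      by (simp add: exp_of_nat_mult[symmetric] x_def)
    ultimately have 1: "exp (real d * \<tau>\<^sup>2 / 8) \<le> sqrt (1 + x) ^ d" by simp
    have 2: "1/2 \<le> sqrt (1 - (1/2) / (1 + x))"
    proof (rule real_le_rsqrt)
      have "(1/2) / (1 + x) \<le> 1/2" using x by (simp add: divide_le_eq)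
      then show "(1/2)\<^sup>2 \<le> 1 - (1/2) / (1 + x)" by (simp add: power2_eq_square)
    qed
    have pos: "0 < sqrt (1 + x) ^ d" "0 < sqrt (1 - (1/2) / (1 + x))"
      using x 2 by (simp, linarith)
    from 1 2 have "exp (real d * \<tau>\<^sup>2 / 8) * (1/2) \<le> sqrt (1 + x) ^ d * sqrt (1 - (1/2) / (1 + x))"
      by (intro mult_mono) (auto simp: x)
    then have "1 / (sqrt (1 + x) ^ d * sqrt (1 - (1/2) / (1 + x))) \<le> 1 / (exp (real d * \<tau>\<^sup>2 / 8) * (1/2))"
      using pos by (intro divide_left_mono mult_pos_pos) simp_all
    also have "\<dots> = 2 * exp (- real d * \<tau>\<^sup>2 / 8)" by (simp add: exp_minus field_simps)
    finally show "1 / (sqrt (1 + \<tau>\<^sup>2/2) ^ d * sqrt (1 - (1/2) / (1 + \<tau>\<^sup>2/2))) \<le> 2 * exp (- real d * \<tau>\<^sup>2 / 8)"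
      by (simp only: x_def)
  qed
  finally show ?thesis .
qed

text \<open>Young's inequality \<open>y \<le> 1 / e + e * y\<^sup>2\<close> stands in for
  Cauchy-Schwarz. The weight \<open>e\<close> is the square root of the exponential in the cap
  bound, so that the cap contributes \<open>2 * e\<close> and the second moment
  \<open>400000 * e\<close>.\<close>

lemma uniform_sphere_tail:
  assumes v: "dot d v v = 1" and d: "11 \<le> d" and \<tau>: "0 \<le> \<tau>" "\<tau> \<le> 1"
  shows "(\<integral>\<^sup>+u. inverse (ennreal (1 - \<bar>dot d v u\<bar>)) * indicator {u. \<tau> < \<bar>dot d v u\<bar>} u \<partial>uniform_sphere d)
    \<le> ennreal (400002 * exp (- real d * \<tau>\<^sup>2 / 16))"
proof -
  define e where "e = exp (- real d * \<tau>\<^sup>2 / 16)"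
  have e: "0 < e" "e * e = exp (- real d * \<tau>\<^sup>2 / 8)" by (auto simp: e_def exp_add[symmetric])
  let ?B = "{u \<in> space (vec_space d). \<tau> < \<bar>dot d v u\<bar>}"
  let ?Y = "\<lambda>u. inverse (ennreal (1 - \<bar>dot d v u\<bar>))"
  have young: "y \<le> ennreal (1 / e) + ennreal e * y\<^sup>2" for y :: ennreal
  proof (cases y)
    case (real r)
    have "r \<le> 1 / e + e * r\<^sup>2"
    proof (cases "e * r \<le> 1")
      case True
      then have "r \<le> 1 / e" using e by (simp add: field_simps)
      then show ?thesis using e by (simp add: add_increasing2)
    next
      case False
      then have "r * 1 \<le> r * (e * r)" using real by (intro mult_left_mono) auto
      then show ?thesis using e by (simp add: power2_eq_square mult_ac add_increasing)
    qed
    then show ?thesis using real e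
      by (simp add: ennreal_power ennreal_mult[symmetric] ennreal_plus[symmetric] ennreal_leI del: ennreal_plus)
  next
    case top
    then show ?thesis using e by (simp add: power2_eq_square ennreal_mult_top)
  qed
  have "(\<integral>\<^sup>+u. ?Y u * indicator {u. \<tau> < \<bar>dot d v u\<bar>} u \<partial>uniform_sphere d) \<le>
      (\<integral>\<^sup>+u. ennreal (1 / e) * indicator ?B u + ennreal e * (?Y u)\<^sup>2 \<partial>uniform_sphere d)"
  proof (intro nn_integral_mono)
    fix u assume "u \<in> space (uniform_sphere d)"
    then show "?Y u * indicator {u. \<tau> < \<bar>dot d v u\<bar>} u \<le> ennreal (1 / e) * indicator ?B u + ennreal e * (?Y u)\<^sup>2"
      using young[of "?Y u"] by (auto simp: indicator_def space_uniform_sphere)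
  qed
  also have "\<dots> = ennreal (1 / e) * emeasure (uniform_sphere d) ?B + ennreal e * (\<integral>\<^sup>+u. (?Y u)\<^sup>2 \<partial>uniform_sphere d)"
    by (simp add: nn_integral_add nn_integral_cmult)
  also have "\<dots> \<le> ennreal (1 / e) * ennreal (2 * (e * e)) + ennreal e * ennreal 400000"
    using uniform_sphere_cap[OF v \<tau>] uniform_sphere_inverse_moment[OF v d]
    by (intro add_mono mult_left_mono) (auto simp: e(2))
  also have "\<dots> = ennreal (400002 * e)"
  proof -
    have "ennreal (1 / e) * ennreal (2 * (e * e)) = ennreal (2 * e)" "ennreal e * ennreal 400000 = ennreal (400000 * e)"
      using e(1) by (subst ennreal_mult[symmetric]; simp)+
    then show ?thesis using e(1) by (simp del: ennreal_numeral ennreal_plus flip: ennreal_plus)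
  qed
  finally show ?thesis by (simp add: e_def)
qed

section \<open>Setwise convergence and covariance\<close>

text \<open>Domination by a fixed measure \<open>P\<close> makes the tails of disjoint unions uniformly small, so the sets on which the
  measures converge form a Dynkin system.\<close>

lemma tendsto_measure_sigma_sets:
  fixes M :: "nat \<Rightarrow> 'a measure"
  assumes M: "\<And>n. finite_measure (M n)" "\<And>n. sets (M n) = sets N"
    and N: "finite_measure N" and P: "finite_measure P" "sets P = sets N"
    and dom: "\<And>n A. A \<in> sets N \<Longrightarrow> (measure (M n) A)\<^sup>2 \<le> C * measure P A"
    and gen: "sets N = sigma_sets \<Omega> G" "Int_stable G" "G \<subseteq> Pow \<Omega>"
    and base: "\<And>A. A \<in> G \<Longrightarrow> (\<lambda>n. measure (M n) A) \<longlonglongrightarrow> measure N A"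
    and total: "(\<lambda>n. measure (M n) \<Omega>) \<longlonglongrightarrow> measure N \<Omega>"
    and A: "A \<in> sets N"
  shows "(\<lambda>n. measure (M n) A) \<longlonglongrightarrow> measure N A"
proof -
  have sp: "space N = \<Omega>" using gen(1,3) by (metis sets_eq_imp_space_eq space_measure_of sets_measure_of)
  have spM: "space (M n) = \<Omega>" for n using M(2)[of n] sp by (metis sets_eq_imp_space_eq)
  have "A \<in> sigma_sets \<Omega> G" using A gen by simp
  from gen(2,3) this show ?thesis
  proof (induction rule: sigma_sets_induct_disjoint)
    case (basic A)
    then show ?case by (rule base)
  next
    case empty
    show ?case by simp
  next
    case (compl A)
    then have A: "A \<in> sets N" using gen(1) by simp
    have "measure (M n) (\<Omega> - A) = measure (M n) \<Omega> - measure (M n) A" for n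
      using finite_measure.finite_measure_compl[OF M(1), of A n] A M(2) by (simp add: spM)
    moreover have "measure N (\<Omega> - A) = measure N \<Omega> - measure N A"
      using finite_measure.finite_measure_compl[OF N, of A] A by (simp add: sp)
    ultimately show ?case using compl total by (auto intro: tendsto_diff)
  next
    case (union A)
    have As: "A i \<in> sets N" for i using union(2) gen(1) by auto
    then have UA: "(\<Union>i. A i) \<in> sets N" by auto
    let ?F = "\<lambda>k. \<Union>i<k. A i"
    have inc: "incseq ?F" by (fastforce simp: incseq_def)
    have Un: "(\<Union>k. ?F k) = (\<Union>i. A i)" by auto
    have lim: "(\<lambda>k. measure Q (?F k)) \<longlonglongrightarrow> measure Q (\<Union>i. A i)" if "finite_measure Q" "sets Q = sets N" for Q
      using finite_measure.finite_Lim_measure_incseq[OF that(1), of ?F] As inc that(2) unfolding Un by auto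
    have fin: "measure Q (?F k) = (\<Sum>i<k. measure Q (A i))" if "finite_measure Q" "sets Q = sets N" for Q k
      using As that(2) union(1)
      by (intro finite_measure.finite_measure_finite_Union[OF that(1)]) (auto simp: disjoint_family_on_def)
    have diff: "measure Q (\<Union>i. A i) - measure Q (?F k) = measure Q ((\<Union>i. A i) - ?F k)" if "finite_measure Q" "sets Q = sets N" for Q k
      using As UA that(2) by (subst finite_measure.finite_measure_Diff[OF that(1)]) auto
    define p where "p k = measure P (\<Union>i. A i) - measure P (?F k)" for k
    have "p \<longlonglongrightarrow> measure P (\<Union>i. A i) - measure P (\<Union>i. A i)"
      unfolding p_def by (intro tendsto_diff tendsto_const lim P)
    then have "(\<lambda>k. C * p k) \<longlonglongrightarrow> C * 0" by (intro tendsto_mult) auto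
    then have pk: "(\<lambda>k. sqrt (C * p k)) \<longlonglongrightarrow> 0" using tendsto_real_sqrt by fastforce
    \<comment> \<open>This bound is uniform in \<open>n\<close>; continuity of each single measure
      would not be enough to exchange the limits in \<open>n\<close> and \<open>k\<close>.\<close>
    have tail: "\<bar>measure (M n) (\<Union>i. A i) - measure (M n) (?F k)\<bar> \<le> sqrt (C * p k)" for n k
    proof -
      have "(measure (M n) ((\<Union>i. A i) - ?F k))\<^sup>2 \<le> C * p k"
        unfolding p_def diff[OF P] using As UA by (intro dom) auto
      then have "measure (M n) ((\<Union>i. A i) - ?F k) \<le> sqrt (C * p k)" by (rule real_le_rsqrt)
      then show ?thesis unfolding diff[OF M] by simp
    qed
    show ?case
    proof (rule LIMSEQ_I)
      fix e :: real assume e: "0 < e"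
      have "\<forall>\<^sub>F k in sequentially. sqrt (C * p k) < e / 3"
        using pk e by (intro order_tendstoD(2)) auto
      moreover have "\<forall>\<^sub>F k in sequentially. dist (measure N (?F k)) (measure N (\<Union>i. A i)) < e / 3"
        using lim[OF N] e by (intro tendstoD) auto
      ultimately obtain k where k: "sqrt (C * p k) < e / 3" "dist (measure N (?F k)) (measure N (\<Union>i. A i)) < e / 3"
        using eventually_happens[OF eventually_conj] by force
      have "(\<lambda>n. measure (M n) (?F k)) \<longlonglongrightarrow> measure N (?F k)"
        unfolding fin[OF M] fin[OF N refl] by (intro tendsto_sum union)
      then obtain n0 where n0: "\<forall>n\<ge>n0. norm (measure (M n) (?F k) - measure N (?F k)) < e / 3"
        using e LIMSEQ_D[of _ _ "e/3"] by fastforce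
      then have "norm (measure (M n) (\<Union>i. A i) - measure N (\<Union>i. A i)) < e" if "n0 \<le> n" for n
      proof -
        have "norm (measure (M n) (?F k) - measure N (?F k)) < e / 3" using n0 that by blast
        then show ?thesis using tail[of n k] k unfolding dist_real_def real_norm_def by arith
      qed
      then show "\<exists>no. \<forall>n\<ge>no. norm (measure (M n) (\<Union>i. A i) - measure N (\<Union>i. A i)) < e" by blast
    qed
  qed
qed

lemma nn_integral_layer_cake:
  fixes f :: "'a \<Rightarrow> real"
  assumes M: "sigma_finite_measure M" and [measurable]: "f \<in> borel_measurable M"
    and f: "\<And>x. x \<in> space M \<Longrightarrow> 0 \<le> f x \<and> f x \<le> 1"
  shows "(\<integral>\<^sup>+x. ennreal (f x) \<partial>M) = (\<integral>\<^sup>+t. emeasure M {x \<in> space M. t < f x} * indicator {0..1} t \<partial>lborel)"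
proof -
  interpret M: sigma_finite_measure M by (rule M)
  interpret pair_sigma_finite lborel M by unfold_locales
  have "(\<integral>\<^sup>+x. ennreal (f x) \<partial>M) = (\<integral>\<^sup>+x. \<integral>\<^sup>+t. indicator {t. t < f x} t * indicator {0..1} t \<partial>lborel \<partial>M)"
  proof (intro nn_integral_cong)
    fix x assume "x \<in> space M"
    then have "indicator {t. t < f x} t * indicator {0..1} t = (indicator {0..<f x} t :: ennreal)" for t
      using f[of x] by (auto simp: indicator_def)
    then show "ennreal (f x) = (\<integral>\<^sup>+t. indicator {t. t < f x} t * indicator {0..1} t \<partial>lborel)"
      using f[OF \<open>x \<in> space M\<close>] by simp
  qed
  also have "\<dots> = (\<integral>\<^sup>+t. \<integral>\<^sup>+x. indicator {t. t < f x} t * indicator {0..1} t \<partial>M \<partial>lborel)"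
    by (rule Fubini') measurable
  also have "\<dots> = (\<integral>\<^sup>+t. emeasure M {x \<in> space M. t < f x} * indicator {0..1} t \<partial>lborel)"
  proof (intro nn_integral_cong)
    fix t
    have "(\<integral>\<^sup>+x. indicator {t. t < f x} t * indicator {0..1} t \<partial>M) =
      (\<integral>\<^sup>+x. indicator {x \<in> space M. t < f x} x * indicator {0..1} t \<partial>M)"
      by (intro nn_integral_cong) (auto simp: indicator_def)
    also have "\<dots> = emeasure M {x \<in> space M. t < f x} * indicator {0..1} t"
      by (subst nn_integral_multc) auto
    finally show "(\<integral>\<^sup>+x. indicator {t. t < f x} t * indicator {0..1} t \<partial>M) = emeasure M {x \<in> space M. t < f x} * indicator {0..1} t" .
  qed
  finally show ?thesis .
qed

text \<open>The layer-cake formula writes the integral as an integral over levels \<open>t\<close>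
  of the measures of superlevel sets. These converge for each \<open>t\<close>, and the total masses
  dominate.\<close>

lemma tendsto_nn_integral_setwise:
  fixes M :: "nat \<Rightarrow> 'a measure" and f :: "'a \<Rightarrow> real"
  assumes M: "\<And>n. finite_measure (M n)" "\<And>n. sets (M n) = sets N" "\<And>n. measure (M n) (space N) \<le> K"
    and N: "finite_measure N"
    and conv: "\<And>A. A \<in> sets N \<Longrightarrow> (\<lambda>n. measure (M n) A) \<longlonglongrightarrow> measure N A"
    and [measurable]: "f \<in> borel_measurable N"
    and f: "\<And>x. x \<in> space N \<Longrightarrow> 0 \<le> f x \<and> f x \<le> 1"
  shows "(\<lambda>n. \<integral>\<^sup>+x. ennreal (f x) \<partial>M n) \<longlonglongrightarrow> (\<integral>\<^sup>+x. ennreal (f x) \<partial>N)"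
proof -
  have sp: "space (M n) = space N" for n using M(2) by (rule sets_eq_imp_space_eq)
  note [measurable_cong] = M(2)
  have K: "0 \<le> K" using M(3)[of 0] measure_nonneg order_trans by blast
  have LM: "(\<integral>\<^sup>+x. ennreal (f x) \<partial>M n) = (\<integral>\<^sup>+t. emeasure (M n) {x \<in> space N. t < f x} * indicator {0..1} t \<partial>lborel)" for n
    using nn_integral_layer_cake[of "M n" f] f M(1)[of n] by (simp add: sp finite_measure_def)
  have LN: "(\<integral>\<^sup>+x. ennreal (f x) \<partial>N) = (\<integral>\<^sup>+t. emeasure N {x \<in> space N. t < f x} * indicator {0..1} t \<partial>lborel)"
    using nn_integral_layer_cake[of N f] f N by (simp add: finite_measure_def)
  have meas: "(\<lambda>t. emeasure Q {x \<in> space N. t < f x}) \<in> borel_measurable borel" if "finite_measure Q" "sets Q = sets N" for Q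
  proof -
    interpret Q: finite_measure Q by (rule that)
    note [measurable_cong] = that(2)
    have "space Q = space N" by (rule sets_eq_imp_space_eq[OF that(2)])
    have "(\<lambda>t. \<integral>\<^sup>+x. indicator {x \<in> space N. t < f x} x \<partial>Q) \<in> borel_measurable borel"
      by measurable
    moreover have "(\<integral>\<^sup>+x. indicator {x \<in> space N. t < f x} x \<partial>Q) = emeasure Q {x \<in> space N. t < f x}" for t
      by (rule nn_integral_indicator) measurable
    ultimately show ?thesis by simp
  qed
  note [measurable] = meas[OF M(1,2)] meas[OF N refl]
  show ?thesis unfolding LM LN
  proof (rule nn_integral_dominated_convergence[where w = "\<lambda>t. ennreal K * indicator {0..1} t"])
    show "AE t in lborel. emeasure (M n) {x \<in> space N. t < f x} * indicator {0..1} t \<le> ennreal K * indicator {0..1} t" for n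
    proof (intro AE_I2 mult_right_mono)
      fix t
      have "emeasure (M n) {x \<in> space N. t < f x} \<le> emeasure (M n) (space N)"
        by (intro emeasure_mono) (auto simp: M(2))
      also have "\<dots> = ennreal (measure (M n) (space N))"
        using finite_measure.emeasure_eq_measure[OF M(1)] by blast
      also have "\<dots> \<le> ennreal K" by (intro ennreal_leI M(3))
      finally show "emeasure (M n) {x \<in> space N. t < f x} \<le> ennreal K" .
    qed simp
    show "(\<integral>\<^sup>+t. ennreal K * indicator {0..1::real} t \<partial>lborel) < \<infinity>"
      by (subst nn_integral_cmult_indicator) auto
    show "AE t in lborel. (\<lambda>n. emeasure (M n) {x \<in> space N. t < f x} * indicator {0..1} t)
        \<longlonglongrightarrow> emeasure N {x \<in> space N. t < f x} * indicator {0..1} t"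
    proof (intro AE_I2)
      fix t :: real
      have "(\<lambda>n. ennreal (measure (M n) {x \<in> space N. t < f x})) \<longlonglongrightarrow> ennreal (measure N {x \<in> space N. t < f x})"
        by (intro tendsto_ennrealI conv) measurable
      then have "(\<lambda>n. emeasure (M n) {x \<in> space N. t < f x}) \<longlonglongrightarrow> emeasure N {x \<in> space N. t < f x}"
        using finite_measure.emeasure_eq_measure[OF M(1)] finite_measure.emeasure_eq_measure[OF N] by simp
      then show "(\<lambda>n. emeasure (M n) {x \<in> space N. t < f x} * indicator {0..1} t)
        \<longlonglongrightarrow> emeasure N {x \<in> space N. t < f x} * indicator {0..1} t"
        by (cases "t \<in> {0..1}") auto
    qed
  qed measurable
qed

text \<open>Cauchy-Schwarz for the covariance, together with \<open>f\<^sup>2 \<le> f\<close>, which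
  bounds the variance of \<open>f\<close> by the Bernoulli variance of its mean. That is the
  quantity in the VSTAT tolerance.\<close>

lemma (in prob_space) covariance_bound:
  assumes [measurable]: "f \<in> borel_measurable M" "h \<in> borel_measurable M"
    and f: "\<And>x. x \<in> space M \<Longrightarrow> 0 \<le> f x \<and> f x \<le> (1::real)"
    and h2: "integrable M (\<lambda>x. (h x)\<^sup>2)"
  shows "(expectation (\<lambda>x. f x * h x) - expectation f * expectation h)\<^sup>2 \<le>
    (expectation f * (1 - expectation f)) * (expectation (\<lambda>x. (h x)\<^sup>2) - (expectation h)\<^sup>2)"
proof -
  have h1: "integrable M h" by (rule square_integrable_imp_integrable[OF _ h2]) measurable
  have fi: "integrable M f" using f by (intro integrable_const_bound[of _ 1]) auto
  have f2i: "integrable M (\<lambda>x. (f x)\<^sup>2)" using f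
    by (intro integrable_const_bound[of _ 1]) (auto simp: power_le_one)
  have fh: "integrable M (\<lambda>x. f x * h x)"
  proof (rule Bochner_Integration.integrable_bound[OF h1])
    show "AE x in M. norm (f x * h x) \<le> norm (h x)"
      using f by (intro AE_I2) (auto simp: abs_mult mult_left_le_one_le)
  qed measurable
  define p w where "p = expectation f" and "w = expectation h"
  define X A B where "X = expectation (\<lambda>x. f x * h x) - p * w" and "A = expectation (\<lambda>x. (f x)\<^sup>2) - p\<^sup>2"
    and "B = expectation (\<lambda>x. (h x)\<^sup>2) - w\<^sup>2"
  have quad: "0 \<le> a\<^sup>2 * A + 2 * a * b * X + b\<^sup>2 * B" for a b
  proof -
    have "0 \<le> expectation (\<lambda>x. (a * (f x - p) + b * (h x - w))\<^sup>2)" by (intro Bochner_Integration.integral_nonneg) auto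
    also have "(\<lambda>x. (a * (f x - p) + b * (h x - w))\<^sup>2) =
      (\<lambda>x. a\<^sup>2 * (f x)\<^sup>2 - (2 * a\<^sup>2 * p + 2 * a * b * w) * f x + 2 * a * b * (f x * h x) + b\<^sup>2 * (h x)\<^sup>2
         - (2 * b\<^sup>2 * w + 2 * a * b * p) * h x + (a * p + b * w)\<^sup>2)"
      by (simp add: fun_eq_iff power2_eq_square algebra_simps)
    also have "expectation \<dots> = a\<^sup>2 * expectation (\<lambda>x. (f x)\<^sup>2) - (2 * a\<^sup>2 * p + 2 * a * b * w) * p
        + 2 * a * b * expectation (\<lambda>x. f x * h x) + b\<^sup>2 * expectation (\<lambda>x. (h x)\<^sup>2)
         - (2 * b\<^sup>2 * w + 2 * a * b * p) * w + (a * p + b * w)\<^sup>2"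
      using h1 fi f2i fh h2 by (simp add: p_def w_def prob_space)
    also have "\<dots> = a\<^sup>2 * A + 2 * a * b * X + b\<^sup>2 * B"
      by (simp add: A_def B_def X_def power2_eq_square algebra_simps)
    finally show ?thesis .
  qed
  have A0: "0 \<le> A" and B0: "0 \<le> B" using quad[of 1 0] quad[of 0 1] by auto
  have "X\<^sup>2 \<le> A * B"
  proof (cases "A = 0")
    case True
    have "X = 0"
    proof (rule ccontr)
      assume X: "X \<noteq> 0"
      \<comment> \<open>With \<open>A = 0\<close> the form is linear in \<open>a\<close>, so a
        suitable \<open>a\<close> makes it negative: at \<open>a = - (B + 1)\<close> and
        \<open>b = 2 * X\<close> its value is \<open>- 4 * X\<^sup>2\<close>.\<close>
      have "0 \<le> - 4 * X\<^sup>2" using quad[of "- (B + 1)" "2 * X"] True by (simp add: power2_eq_square algebra_simps)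
      then show False using X by simp
    qed
    then show ?thesis using True by simp
  next
    case False
    then have "0 < A" using A0 by simp
    have "0 \<le> A * (A * B - X\<^sup>2)" using quad[of X "- A"] by (simp add: power2_eq_square algebra_simps)
    then show ?thesis using \<open>0 < A\<close> by (simp add: zero_le_mult_iff)
  qed
  moreover have "A \<le> p * (1 - p)"
  proof -
    have "expectation (\<lambda>x. (f x)\<^sup>2) \<le> expectation f"
      using f fi f2i by (intro integral_mono) (auto simp: power2_eq_square mult_left_le)
    then show ?thesis by (simp add: A_def p_def power2_eq_square algebra_simps)
  qed
  ultimately have "X\<^sup>2 \<le> p * (1 - p) * B" using B0 by (meson mult_right_mono order_trans)
  then show ?thesis by (simp add: X_def p_def w_def B_def)
qed

section \<open>Mixtures of alternatives\<close>

context lattice_noise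
begin

lemma smooth_pos: assumes "0 < \<tau>" shows "0 < smooth E \<tau> x"
proof (rule ccontr)
  assume "\<not> 0 < smooth E \<tau> x"
  then have "smooth E \<tau> x = 0" by simp
  then have "AE z in E. ennreal (normal_density 0 \<tau> (x - z)) = 0"
    unfolding smooth_def by (subst (asm) nn_integral_0_iff_AE) auto
  then have "AE z in E. False"
    using normal_density_pos[OF assms] by (auto simp: not_le[symmetric] ennreal_eq_0_iff)
  then show False by simp
qed

lemma smooth_finite: assumes "0 < \<tau>" shows "smooth E \<tau> x < \<top>"
proof -
  have "smooth E \<tau> x \<le> (\<integral>\<^sup>+z. ennreal (1 / sqrt (2 * pi * \<tau>\<^sup>2)) \<partial>E)"
    unfolding smooth_def using assms
    by (intro nn_integral_mono ennreal_leI) (simp add: normal_density_def divide_right_mono)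
  also have "\<dots> < \<top>" using E.emeasure_space_1 by simp
  finally show ?thesis .
qed

lemma response_density_pos: "0 < response_density y"
  and response_density_finite: "response_density y < \<top>"
  unfolding response_density_def using rho by (simp_all add: smooth_pos smooth_finite)

section \<open>The null distribution, the alternatives and their interpolations\<close>

lemma response_law_density: "response_law \<rho> E = density lborel response_density"
proof (rule measure_eqI)
  show "sets (response_law \<rho> E) = sets (density lborel response_density)"
    by (simp add: response_law_def convolution_def)
  fix A assume "A \<in> sets (response_law \<rho> E)"
  then have A [measurable]: "A \<in> sets borel" by (simp add: response_law_def convolution_def)
  interpret G: prob_space "gaussian 0 \<rho>" using rho by (intro prob_space_gaussian)
  interpret P: pair_sigma_finite "gaussian 0 \<rho>" E by unfold_locales
  interpret Q: pair_sigma_finite lborel E by unfold_locales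
  have "emeasure (response_law \<rho> E) A = (\<integral>\<^sup>+y. indicator A y \<partial>response_law \<rho> E)"
    by (simp add: response_law_def convolution_def)
  also have "\<dots> = (\<integral>\<^sup>+p. indicator A (fst p + snd p) \<partial>(gaussian 0 \<rho> \<Otimes>\<^sub>M E))"
    unfolding response_law_def convolution_def by (subst nn_integral_distr) (auto simp: case_prod_beta')
  also have "\<dots> = (\<integral>\<^sup>+z. \<integral>\<^sup>+x. indicator A (x + z) \<partial>gaussian 0 \<rho> \<partial>E)"
    by (subst P.nn_integral_snd[symmetric]) auto
  also have "\<dots> = (\<integral>\<^sup>+z. \<integral>\<^sup>+y. ennreal (normal_density 0 \<rho> (y - z)) * indicator A y \<partial>lborel \<partial>E)"
  proof (intro nn_integral_cong)
    fix z
    have "(\<integral>\<^sup>+x. indicator A (x + z) \<partial>gaussian 0 \<rho>) = (\<integral>\<^sup>+x. ennreal (normal_density 0 \<rho> x) * indicator A (x + z) \<partial>lborel)"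
      by (rule nn_integral_gaussian) measurable
    also have "\<dots> = (\<integral>\<^sup>+x. ennreal (normal_density 0 \<rho> ((z + x) - z)) * indicator A (z + x) \<partial>lborel)"
      by (simp add: add.commute)
    also have "\<dots> = (\<integral>\<^sup>+y. ennreal (normal_density 0 \<rho> (y - z)) * indicator A y \<partial>lborel)"
      by (rule nn_integral_lborel_shift[where f="\<lambda>y. ennreal (normal_density 0 \<rho> (y - z)) * indicator A y"]) measurable
    finally show "(\<integral>\<^sup>+x. indicator A (x + z) \<partial>gaussian 0 \<rho>) = (\<integral>\<^sup>+y. ennreal (normal_density 0 \<rho> (y - z)) * indicator A y \<partial>lborel)" .
  qed
  also have "\<dots> = (\<integral>\<^sup>+y. \<integral>\<^sup>+z. ennreal (normal_density 0 \<rho> (y - z)) * indicator A y \<partial>E \<partial>lborel)"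
    by (rule Q.Fubini') measurable
  also have "\<dots> = (\<integral>\<^sup>+y. response_density y * indicator A y \<partial>lborel)"
    unfolding response_density_def smooth_def by (intro nn_integral_cong nn_integral_multc) measurable
  also have "\<dots> = emeasure (density lborel response_density) A"
    by (subst emeasure_density) auto
  finally show "emeasure (response_law \<rho> E) A = emeasure (density lborel response_density) A" .
qed

lemma prob_space_response: "prob_space (response_law \<rho> E)"
proof -
  interpret G: prob_space "gaussian 0 \<rho>" using rho by (intro prob_space_gaussian)
  interpret P: pair_prob_space "gaussian 0 \<rho>" E by unfold_locales
  show ?thesis unfolding response_law_def convolution_def
    by (rule P.prob_space_distr) measurable
qed

lemma sets_response [measurable_cong, simp]: "sets (response_law \<rho> E) = sets borel"
  by (simp add: response_law_def convolution_def)

lemma sets_null [measurable_cong, simp]: "sets (null_dist d \<rho> E) = sets (point_space d)"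
  unfolding null_dist_def by (intro sets_pair_measure_cong) auto

lemma space_null: "space (null_dist d \<rho> E) = space (point_space d)"
  by (rule sets_eq_imp_space_eq) simp

lemma prob_space_null: "prob_space (null_dist d \<rho> E)"
proof -
  interpret gv: prob_space "gaussian_vec d" by (rule prob_space_gaussian_vec)
  interpret R: prob_space "response_law \<rho> E" by (rule prob_space_response)
  interpret P: pair_prob_space "gaussian_vec d" "response_law \<rho> E" by unfold_locales
  show ?thesis unfolding null_dist_def by (rule P.prob_space_axioms)
qed

lemma nn_integral_null:
  assumes [measurable]: "g \<in> borel_measurable (point_space d)"
  shows "(\<integral>\<^sup>+p. g p \<partial>null_dist d \<rho> E) = (\<integral>\<^sup>+y. \<integral>\<^sup>+x. response_density y * g (x, y) \<partial>gaussian_vec d \<partial>lborel)"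
proof -
  interpret gv: prob_space "gaussian_vec d" by (rule prob_space_gaussian_vec)
  interpret R: prob_space "response_law \<rho> E" by (rule prob_space_response)
  interpret P: pair_sigma_finite "gaussian_vec d" "response_law \<rho> E" by unfold_locales
  have "(\<integral>\<^sup>+p. g p \<partial>null_dist d \<rho> E) = (\<integral>\<^sup>+y. \<integral>\<^sup>+x. g (x, y) \<partial>gaussian_vec d \<partial>response_law \<rho> E)"
    unfolding null_dist_def by (subst P.nn_integral_snd) auto
  also have "\<dots> = (\<integral>\<^sup>+y. response_density y * (\<integral>\<^sup>+x. g (x, y) \<partial>gaussian_vec d) \<partial>lborel)"
    unfolding response_law_density by (subst nn_integral_density) auto
  also have "\<dots> = (\<integral>\<^sup>+y. \<integral>\<^sup>+x. response_density y * g (x, y) \<partial>gaussian_vec d \<partial>lborel)"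
    by (intro nn_integral_cong) (subst nn_integral_cmult, auto)
  finally show ?thesis .
qed

lemma nn_integral_gaussian_noise:
  assumes "0 < \<epsilon>" and [measurable]: "k \<in> borel_measurable borel"
  shows "(\<integral>\<^sup>+z. \<integral>\<^sup>+h. k (a + \<epsilon> * h + z) \<partial>gaussian 0 1 \<partial>E) = (\<integral>\<^sup>+y. smooth E \<epsilon> (y - a) * k y \<partial>lborel)"
proof -
  interpret Q: pair_sigma_finite lborel E by unfold_locales
  have "(\<integral>\<^sup>+h. k (a + \<epsilon> * h + z) \<partial>gaussian 0 1) = (\<integral>\<^sup>+y. ennreal (normal_density 0 \<epsilon> ((y - a) - z)) * k y \<partial>lborel)" for z
  proof -
    have n: "ennreal \<epsilon> * ennreal (normal_density 0 \<epsilon> (\<epsilon> * h)) = ennreal (std_normal_density h)" for h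
      using assms(1) normal_density_scale[OF assms(1) assms(1), of h] by (subst ennreal_mult'[symmetric]) auto
    have "(\<integral>\<^sup>+y. ennreal (normal_density 0 \<epsilon> ((y - a) - z)) * k y \<partial>lborel) =
       ennreal \<epsilon> * (\<integral>\<^sup>+h. ennreal (normal_density 0 \<epsilon> (\<epsilon> * h)) * k ((a + z) + \<epsilon> * h) \<partial>lborel)"
      using assms(1) by (subst nn_integral_real_affine[where c=\<epsilon> and t="a + z"]) (auto simp: algebra_simps)
    also have "\<dots> = (\<integral>\<^sup>+h. ennreal (std_normal_density h) * k ((a + z) + \<epsilon> * h) \<partial>lborel)"
      by (subst nn_integral_cmult[symmetric]) (auto simp: mult.assoc[symmetric] n)
    also have "\<dots> = (\<integral>\<^sup>+h. k (a + \<epsilon> * h + z) \<partial>gaussian 0 1)"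
      by (subst nn_integral_gaussian) (auto simp: algebra_simps)
    finally show ?thesis ..
  qed
  then have "(\<integral>\<^sup>+z. \<integral>\<^sup>+h. k (a + \<epsilon> * h + z) \<partial>gaussian 0 1 \<partial>E) =
      (\<integral>\<^sup>+z. \<integral>\<^sup>+y. ennreal (normal_density 0 \<epsilon> ((y - a) - z)) * k y \<partial>lborel \<partial>E)" by simp
  also have "\<dots> = (\<integral>\<^sup>+y. \<integral>\<^sup>+z. ennreal (normal_density 0 \<epsilon> ((y - a) - z)) * k y \<partial>E \<partial>lborel)"
    by (rule Q.Fubini') measurable
  also have "\<dots> = (\<integral>\<^sup>+y. smooth E \<epsilon> (y - a) * k y \<partial>lborel)"
    unfolding smooth_def by (intro nn_integral_cong nn_integral_multc) measurable
  finally show ?thesis .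
qed

text \<open>One probability space carries the direction, the covariates, the lattice noise and the
  interpolation noise for all \<open>r\<close> simultaneously, so that letting
  \<open>r \<rightarrow> 1\<close> is pointwise convergence of \<open>observe\<close>.\<close>

definition latent :: "nat \<Rightarrow> (((nat \<Rightarrow> real) \<times> (nat \<Rightarrow> real)) \<times> (real \<times> real)) measure" where
  "latent d = (uniform_sphere d \<Otimes>\<^sub>M gaussian_vec d) \<Otimes>\<^sub>M (E \<Otimes>\<^sub>M gaussian 0 1)"

definition observe :: "nat \<Rightarrow> real \<Rightarrow> ((nat \<Rightarrow> real) \<times> (nat \<Rightarrow> real)) \<times> (real \<times> real) \<Rightarrow> point" where
  "observe d r = (\<lambda>((v, x), (z, h)). (x, \<rho> * r * dot d v x + \<rho> * sqrt (1 - r\<^sup>2) * h + z))"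

text \<open>For \<open>r < 1\<close> part of the signal \<open>v \<bullet> x\<close> is replaced by independent noise, which makes the joint law
  absolutely continuous; \<open>r = 1\<close> is the alternative averaged over \<open>v \<in> V\<close>.\<close>

definition mixture :: "nat \<Rightarrow> (nat \<Rightarrow> real) set \<Rightarrow> real \<Rightarrow> point measure" where
  "mixture d V r = distr (density (latent d) (\<lambda>w. indicator V (fst (fst w)))) (point_space d) (observe d r)"

lemma sets_latent [measurable_cong]: "sets (latent d) = sets ((vec_space d \<Otimes>\<^sub>M vec_space d) \<Otimes>\<^sub>M (borel \<Otimes>\<^sub>M borel))"
  unfolding latent_def by (intro sets_pair_measure_cong) auto

lemma measurable_observe [measurable]: "observe d r \<in> measurable (latent d) (point_space d)"
  unfolding observe_def case_prod_beta' by measurable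

lemma prob_space_latent: "prob_space (latent d)"
proof -
  interpret U: prob_space "uniform_sphere d" by (rule prob_space_uniform_sphere)
  interpret gv: prob_space "gaussian_vec d" by (rule prob_space_gaussian_vec)
  interpret G: prob_space "gaussian 0 1" by (rule prob_space_gaussian) simp
  interpret P1: pair_prob_space "uniform_sphere d" "gaussian_vec d" by unfold_locales
  interpret P2: pair_prob_space E "gaussian 0 1" by unfold_locales
  interpret P3: pair_prob_space "uniform_sphere d \<Otimes>\<^sub>M gaussian_vec d" "E \<Otimes>\<^sub>M gaussian 0 1" by unfold_locales
  show ?thesis unfolding latent_def by (rule P3.prob_space_axioms)
qed

lemma nn_integral_latent:
  assumes [measurable]: "f \<in> borel_measurable (latent d)"
  shows "(\<integral>\<^sup>+w. f w \<partial>latent d) =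
    (\<integral>\<^sup>+v. \<integral>\<^sup>+x. \<integral>\<^sup>+z. \<integral>\<^sup>+h. f ((v, x), (z, h)) \<partial>gaussian 0 1 \<partial>E \<partial>gaussian_vec d \<partial>uniform_sphere d)"
proof -
  interpret U: prob_space "uniform_sphere d" by (rule prob_space_uniform_sphere)
  interpret gv: prob_space "gaussian_vec d" by (rule prob_space_gaussian_vec)
  interpret G: prob_space "gaussian 0 1" by (rule prob_space_gaussian) simp
  interpret P1: pair_prob_space "uniform_sphere d" "gaussian_vec d" by unfold_locales
  interpret P2: pair_prob_space E "gaussian 0 1" by unfold_locales
  interpret P3: pair_prob_space "uniform_sphere d \<Otimes>\<^sub>M gaussian_vec d" "E \<Otimes>\<^sub>M gaussian 0 1" by unfold_locales
  have m: "f \<in> borel_measurable ((uniform_sphere d \<Otimes>\<^sub>M gaussian_vec d) \<Otimes>\<^sub>M (E \<Otimes>\<^sub>M gaussian 0 1))"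
    using assms by (simp add: latent_def)
  have "(\<integral>\<^sup>+w. f w \<partial>latent d) = (\<integral>\<^sup>+a. \<integral>\<^sup>+b. f (a, b) \<partial>(E \<Otimes>\<^sub>M gaussian 0 1) \<partial>(uniform_sphere d \<Otimes>\<^sub>M gaussian_vec d))"
    unfolding latent_def by (rule P2.nn_integral_fst[symmetric, OF m])
  also have "\<dots> = (\<integral>\<^sup>+a. \<integral>\<^sup>+z. \<integral>\<^sup>+h. f (a, (z, h)) \<partial>gaussian 0 1 \<partial>E \<partial>(uniform_sphere d \<Otimes>\<^sub>M gaussian_vec d))"
    by (intro nn_integral_cong G.nn_integral_fst[symmetric]) (use m in measurable)
  also have "\<dots> = (\<integral>\<^sup>+v. \<integral>\<^sup>+x. \<integral>\<^sup>+z. \<integral>\<^sup>+h. f ((v, x), (z, h)) \<partial>gaussian 0 1 \<partial>E \<partial>gaussian_vec d \<partial>uniform_sphere d)"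
    by (rule gv.nn_integral_fst[symmetric]) (use m in measurable)
  finally show ?thesis .
qed

lemma nn_integral_mixture:
  assumes [measurable]: "V \<in> sets (vec_space d)" "g \<in> borel_measurable (point_space d)"
  shows "(\<integral>\<^sup>+p. g p \<partial>mixture d V r) =
    (\<integral>\<^sup>+w. indicator V (fst (fst w)) * g (observe d r w) \<partial>latent d)"
proof -
  have "(\<integral>\<^sup>+p. g p \<partial>mixture d V r) = (\<integral>\<^sup>+w. g (observe d r w) \<partial>density (latent d) (\<lambda>w. indicator V (fst (fst w))))"
    unfolding mixture_def by (subst nn_integral_distr) auto
  also have "\<dots> = (\<integral>\<^sup>+w. indicator V (fst (fst w)) * g (observe d r w) \<partial>latent d)"
    by (subst nn_integral_density) auto
  finally show ?thesis .
qed

lemma sets_mixture [measurable_cong, simp]: "sets (mixture d V r) = sets (point_space d)"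
  and space_mixture: "space (mixture d V r) = space (point_space d)"
  by (simp_all add: mixture_def)

lemma nn_integral_mixture_iterated:
  assumes [measurable]: "V \<in> sets (vec_space d)" "g \<in> borel_measurable (point_space d)"
  shows "(\<integral>\<^sup>+p. g p \<partial>mixture d V r) =
    (\<integral>\<^sup>+v. indicator V v * (\<integral>\<^sup>+x. \<integral>\<^sup>+z. \<integral>\<^sup>+h. g (x, \<rho> * r * dot d v x + \<rho> * sqrt (1 - r\<^sup>2) * h + z)
      \<partial>gaussian 0 1 \<partial>E \<partial>gaussian_vec d) \<partial>uniform_sphere d)"
proof -
  have "(\<integral>\<^sup>+p. g p \<partial>mixture d V r) = (\<integral>\<^sup>+v. \<integral>\<^sup>+x. \<integral>\<^sup>+z. \<integral>\<^sup>+h. indicator V v *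
      g (x, \<rho> * r * dot d v x + \<rho> * sqrt (1 - r\<^sup>2) * h + z) \<partial>gaussian 0 1 \<partial>E \<partial>gaussian_vec d \<partial>uniform_sphere d)"
    unfolding nn_integral_mixture[OF assms] by (subst nn_integral_latent, measurable) (simp only: observe_def prod.case fst_conv)
  also have "\<dots> = (\<integral>\<^sup>+v. indicator V v * (\<integral>\<^sup>+x. \<integral>\<^sup>+z. \<integral>\<^sup>+h. g (x, \<rho> * r * dot d v x + \<rho> * sqrt (1 - r\<^sup>2) * h + z)
      \<partial>gaussian 0 1 \<partial>E \<partial>gaussian_vec d) \<partial>uniform_sphere d)"
    by (intro nn_integral_cong) (auto simp: indicator_def)
  finally show ?thesis .
qed

lemma prob_space_alt: "prob_space (alt_dist d \<rho> E v)"
proof -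
  interpret gv: prob_space "gaussian_vec d" by (rule prob_space_gaussian_vec)
  interpret P: pair_prob_space "gaussian_vec d" E by unfold_locales
  show ?thesis unfolding alt_dist_def case_prod_beta' by (rule P.prob_space_distr) measurable
qed

lemma sets_alt [measurable_cong, simp]: "sets (alt_dist d \<rho> E v) = sets (point_space d)"
  and space_alt: "space (alt_dist d \<rho> E v) = space (point_space d)"
  by (simp_all add: alt_dist_def)

lemma nn_integral_alt:
  assumes [measurable]: "g \<in> borel_measurable (point_space d)"
  shows "(\<integral>\<^sup>+p. g p \<partial>alt_dist d \<rho> E v) = (\<integral>\<^sup>+x. \<integral>\<^sup>+z. g (x, \<rho> * dot d v x + z) \<partial>E \<partial>gaussian_vec d)"
proof -
  have m [measurable]: "(\<lambda>p. (fst p, \<rho> * dot d v (fst p) + snd p)) \<in> measurable (gaussian_vec d \<Otimes>\<^sub>M E) (point_space d)"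
    by measurable
  have "(\<integral>\<^sup>+p. g p \<partial>alt_dist d \<rho> E v) = (\<integral>\<^sup>+p. g (fst p, \<rho> * dot d v (fst p) + snd p) \<partial>(gaussian_vec d \<Otimes>\<^sub>M E))"
    unfolding alt_dist_def case_prod_beta' by (subst nn_integral_distr) auto
  also have "\<dots> = (\<integral>\<^sup>+x. \<integral>\<^sup>+z. g (x, \<rho> * dot d v x + z) \<partial>E \<partial>gaussian_vec d)"
    by (subst E.nn_integral_fst[symmetric]) auto
  finally show ?thesis .
qed

lemma nn_integral_mixture_1:
  assumes [measurable]: "V \<in> sets (vec_space d)" "g \<in> borel_measurable (point_space d)"
  shows "(\<integral>\<^sup>+p. g p \<partial>mixture d V 1) = (\<integral>\<^sup>+v\<in>V. (\<integral>\<^sup>+p. g p \<partial>alt_dist d \<rho> E v) \<partial>uniform_sphere d)"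
proof -
  interpret G: prob_space "gaussian 0 1" by (rule prob_space_gaussian) simp
  show ?thesis
    by (simp add: nn_integral_mixture_iterated nn_integral_alt G.emeasure_space_1 mult.commute del: space_gaussian)
qed

lemma nn_integral_mixture_lt_1:
  assumes [measurable]: "V \<in> sets (vec_space d)" "g \<in> borel_measurable (point_space d)" and r: "0 \<le> r" "r < 1"
  shows "(\<integral>\<^sup>+p. g p \<partial>mixture d V r) =
    (\<integral>\<^sup>+v. indicator V v * (\<integral>\<^sup>+x. \<integral>\<^sup>+y. alt_density d r v x y * g (x, y) \<partial>lborel \<partial>gaussian_vec d) \<partial>uniform_sphere d)"
proof -
  have "r\<^sup>2 < 1" using r by (simp add: power_less_one_iff)
  then have pos: "0 < \<rho> * sqrt (1 - r\<^sup>2)" using rho by simp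
  have "(\<integral>\<^sup>+z. \<integral>\<^sup>+h. g (x, \<rho> * r * dot d v x + \<rho> * sqrt (1 - r\<^sup>2) * h + z) \<partial>gaussian 0 1 \<partial>E) =
      (\<integral>\<^sup>+y. alt_density d r v x y * g (x, y) \<partial>lborel)" if "x \<in> space (gaussian_vec d)" for v x
  proof -
    have [measurable]: "x \<in> space (vec_space d)" using that by (simp add: space_gaussian_vec)
    show ?thesis unfolding alt_density_def
      by (rule nn_integral_gaussian_noise[OF pos]) measurable
  qed
  then show ?thesis unfolding nn_integral_mixture_iterated[OF assms(1,2)]
    by (intro nn_integral_cong arg_cong2[where f="(*)"] refl) simp
qed

text \<open>For \<open>r < 1\<close> this is the density of \<open>mixture d V r\<close> with
  respect to the null distribution; the covariates have the same law under both, so only densities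
  of \<open>y\<close> appear.\<close>

definition mix_ratio :: "nat \<Rightarrow> (nat \<Rightarrow> real) set \<Rightarrow> real \<Rightarrow> point \<Rightarrow> ennreal" where
  "mix_ratio d V r = (\<lambda>(x, y). (\<integral>\<^sup>+v. indicator V v * alt_density d r v x y \<partial>uniform_sphere d) / response_density y)"

lemma measurable_mix_ratio [measurable]:
  assumes [measurable]: "V \<in> sets (vec_space d)"
  shows "mix_ratio d V r \<in> borel_measurable (point_space d)"
proof -
  interpret U: prob_space "uniform_sphere d" by (rule prob_space_uniform_sphere)
  show ?thesis unfolding mix_ratio_def case_prod_beta' by measurable
qed

lemma nn_integral_mix_ratio:
  assumes [measurable]: "V \<in> sets (vec_space d)" "g \<in> borel_measurable (point_space d)" and r: "0 \<le> r" "r < 1"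
  shows "(\<integral>\<^sup>+p. mix_ratio d V r p * g p \<partial>null_dist d \<rho> E) = (\<integral>\<^sup>+p. g p \<partial>mixture d V r)"
proof -
  interpret U: prob_space "uniform_sphere d" by (rule prob_space_uniform_sphere)
  interpret gv: prob_space "gaussian_vec d" by (rule prob_space_gaussian_vec)
  interpret P1: pair_sigma_finite lborel "gaussian_vec d" by unfold_locales
  interpret P2: pair_sigma_finite "uniform_sphere d" "gaussian_vec d" by unfold_locales
  interpret P3: pair_sigma_finite "uniform_sphere d" lborel by unfold_locales
  let ?k = "\<lambda>v x y. indicator V v * (alt_density d r v x y * g (x, y))"
  have "(\<integral>\<^sup>+p. mix_ratio d V r p * g p \<partial>null_dist d \<rho> E) =
    (\<integral>\<^sup>+y. \<integral>\<^sup>+x. \<integral>\<^sup>+v. ?k v x y \<partial>uniform_sphere d \<partial>gaussian_vec d \<partial>lborel)"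
  proof (subst nn_integral_null, measurable, intro nn_integral_cong)
    fix x y assume x: "x \<in> space (gaussian_vec d)"
    have [measurable]: "x \<in> space (vec_space d)" using x by (simp add: space_gaussian_vec)
    have *: "response_density y * (a / response_density y * b) = a * b" for a b
    proof -
      have "response_density y * (a / response_density y) = a"
        using response_density_pos[of y] response_density_finite[of y]
        by (metis ennreal_times_divide mult.commute mult_divide_eq_ennreal order_less_irrefl)
      then show ?thesis by (simp add: mult.assoc[symmetric])
    qed
    have "response_density y * (mix_ratio d V r (x, y) * g (x, y)) =
        (\<integral>\<^sup>+v. indicator V v * alt_density d r v x y \<partial>uniform_sphere d) * g (x, y)"
      unfolding mix_ratio_def prod.case * ..
    also have "\<dots> = (\<integral>\<^sup>+v. ?k v x y \<partial>uniform_sphere d)"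
      by (subst nn_integral_multc[symmetric]) (auto simp: mult.assoc)
    finally show "response_density y * (mix_ratio d V r (x, y) * g (x, y)) =
       (\<integral>\<^sup>+v. ?k v x y \<partial>uniform_sphere d)" .
  qed
  also have "\<dots> = (\<integral>\<^sup>+y. \<integral>\<^sup>+v. \<integral>\<^sup>+x. ?k v x y \<partial>gaussian_vec d \<partial>uniform_sphere d \<partial>lborel)"
    by (intro nn_integral_cong P2.Fubini') measurable
  also have "\<dots> = (\<integral>\<^sup>+v. \<integral>\<^sup>+y. \<integral>\<^sup>+x. ?k v x y \<partial>gaussian_vec d \<partial>lborel \<partial>uniform_sphere d)"
    by (intro P3.Fubini') measurable
  also have "\<dots> = (\<integral>\<^sup>+v. \<integral>\<^sup>+x. \<integral>\<^sup>+y. ?k v x y \<partial>lborel \<partial>gaussian_vec d \<partial>uniform_sphere d)"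
    by (intro nn_integral_cong P1.Fubini'[symmetric]) measurable
  also have "\<dots> = (\<integral>\<^sup>+v. indicator V v * (\<integral>\<^sup>+x. \<integral>\<^sup>+y. alt_density d r v x y * g (x, y) \<partial>lborel \<partial>gaussian_vec d) \<partial>uniform_sphere d)"
    by (intro nn_integral_cong) (auto simp: indicator_def)
  also have "\<dots> = (\<integral>\<^sup>+p. g p \<partial>mixture d V r)"
    by (rule nn_integral_mixture_lt_1[symmetric]) (use r in measurable)
  finally show ?thesis .
qed

text \<open>The square of an average over \<open>V\<close> is a double average over independent
  \<open>v\<close> and \<open>u\<close>. Exchanging the integrals brings the pairwise correlation
  inside.\<close>

lemma nn_integral_mix_ratio_square:
  assumes [measurable]: "V \<in> sets (vec_space d)"
  shows "(\<integral>\<^sup>+p. (mix_ratio d V r p)\<^sup>2 \<partial>null_dist d \<rho> E) =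
    (\<integral>\<^sup>+v. indicator V v * (\<integral>\<^sup>+u. indicator V u * correlation d r v u \<partial>uniform_sphere d) \<partial>uniform_sphere d)"
proof -
  interpret U: prob_space "uniform_sphere d" by (rule prob_space_uniform_sphere)
  interpret gv: prob_space "gaussian_vec d" by (rule prob_space_gaussian_vec)
  interpret P2: pair_sigma_finite "uniform_sphere d" "gaussian_vec d" by unfold_locales
  interpret P3: pair_sigma_finite "uniform_sphere d" lborel by unfold_locales
  let ?q = "alt_density d r" and ?U = "uniform_sphere d" and ?\<gamma> = "gaussian_vec d"
  let ?k = "\<lambda>v u x y. indicator V v * (indicator V u * (?q v x y * ?q u x y / response_density y))"
  have "(\<integral>\<^sup>+p. (mix_ratio d V r p)\<^sup>2 \<partial>null_dist d \<rho> E) =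
    (\<integral>\<^sup>+y. \<integral>\<^sup>+x. \<integral>\<^sup>+v. \<integral>\<^sup>+u. ?k v u x y \<partial>?U \<partial>?U \<partial>?\<gamma> \<partial>lborel)"
  proof (subst nn_integral_null, measurable, intro nn_integral_cong)
    fix x y assume x: "x \<in> space ?\<gamma>"
    have [measurable]: "x \<in> space (vec_space d)" using x by (simp add: space_gaussian_vec)
    let ?I = "\<integral>\<^sup>+v. indicator V v * ?q v x y \<partial>?U"
    have "response_density y * (a / response_density y)\<^sup>2 = a * a / response_density y" for a
    proof -
      have "response_density y * (a / response_density y) = a"
        using response_density_pos[of y] response_density_finite[of y]
        by (metis ennreal_times_divide mult.commute mult_divide_eq_ennreal order_less_irrefl)
      then show ?thesis by (simp add: power2_eq_square mult.assoc[symmetric] ennreal_times_divide)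
    qed
    then have "response_density y * (mix_ratio d V r (x, y))\<^sup>2 = ?I * ?I / response_density y"
      unfolding mix_ratio_def prod.case .
    also have "?I * ?I = (\<integral>\<^sup>+v. \<integral>\<^sup>+u. (indicator V v * ?q v x y) * (indicator V u * ?q u x y) \<partial>?U \<partial>?U)"
      by (subst nn_integral_cmult, measurable, subst nn_integral_multc, measurable)
    also have "\<dots> / response_density y = (\<integral>\<^sup>+v. \<integral>\<^sup>+u. (indicator V v * ?q v x y) * (indicator V u * ?q u x y) / response_density y \<partial>?U \<partial>?U)"
      by (subst nn_integral_divide[symmetric], measurable, intro nn_integral_cong nn_integral_divide[symmetric], measurable)
    also have "\<dots> = (\<integral>\<^sup>+v. \<integral>\<^sup>+u. ?k v u x y \<partial>?U \<partial>?U)"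
      by (intro nn_integral_cong) (auto simp: indicator_def)
    finally show "response_density y * (mix_ratio d V r (x, y))\<^sup>2 =
       (\<integral>\<^sup>+v. \<integral>\<^sup>+u. ?k v u x y \<partial>?U \<partial>?U)" .
  qed
  also have "\<dots> = (\<integral>\<^sup>+y. \<integral>\<^sup>+v. \<integral>\<^sup>+x. \<integral>\<^sup>+u. ?k v u x y \<partial>?U \<partial>?\<gamma> \<partial>?U \<partial>lborel)"
    by (intro nn_integral_cong P2.Fubini') measurable
  also have "\<dots> = (\<integral>\<^sup>+y. \<integral>\<^sup>+v. \<integral>\<^sup>+u. \<integral>\<^sup>+x. ?k v u x y \<partial>?\<gamma> \<partial>?U \<partial>?U \<partial>lborel)"
    by (intro nn_integral_cong P2.Fubini') measurable
  also have "\<dots> = (\<integral>\<^sup>+v. \<integral>\<^sup>+y. \<integral>\<^sup>+u. \<integral>\<^sup>+x. ?k v u x y \<partial>?\<gamma> \<partial>?U \<partial>lborel \<partial>?U)"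
    by (intro P3.Fubini') measurable
  also have "\<dots> = (\<integral>\<^sup>+v. \<integral>\<^sup>+u. \<integral>\<^sup>+y. \<integral>\<^sup>+x. ?k v u x y \<partial>?\<gamma> \<partial>lborel \<partial>?U \<partial>?U)"
    by (intro nn_integral_cong P3.Fubini') measurable
  also have "\<dots> = (\<integral>\<^sup>+v. indicator V v * (\<integral>\<^sup>+u. indicator V u * correlation d r v u \<partial>?U) \<partial>?U)"
  proof (intro nn_integral_cong)
    fix v assume v: "v \<in> space ?U"
    then have [measurable]: "v \<in> space (vec_space d)" by (simp add: space_uniform_sphere)
    have "(\<integral>\<^sup>+y. \<integral>\<^sup>+x. ?q v x y * ?q u x y / response_density y \<partial>?\<gamma> \<partial>lborel) = correlation d r v u" for u
      unfolding correlation_def by (intro nn_integral_cong nn_integral_divide) measurable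
    then show "(\<integral>\<^sup>+u. \<integral>\<^sup>+y. \<integral>\<^sup>+x. ?k v u x y \<partial>?\<gamma> \<partial>lborel \<partial>?U)
       = indicator V v * (\<integral>\<^sup>+u. indicator V u * correlation d r v u \<partial>?U)"
      by (cases "v \<in> V") (auto intro!: nn_integral_cong simp: indicator_def)
  qed
  finally show ?thesis .
qed

end

section \<open>Removing the interpolation noise: the limit r \<rightarrow> 1\<close>

lemma sets_point_space_generated:
  "sets (point_space d) = sigma_sets (space (point_space d)) {A \<times> B | A B. A \<in> sets (vec_space d) \<and> B \<in> range atMost}"
  (is "_ = sigma_sets _ ?G")
proof -
  have "sets (point_space d) = sets (sigma (space (vec_space d) \<times> space borel) {A \<times> B | A B. A \<in> sets (vec_space d) \<and> B \<in> range atMost})"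
  proof (rule sets_pair_eq)
    show "sets (vec_space d) \<subseteq> Pow (space (vec_space d))" by (rule sets.space_closed)
    show "sets (vec_space d) = sigma_sets (space (vec_space d)) (sets (vec_space d))"
      by (simp add: sets.sigma_sets_eq)
    show "countable {space (vec_space d)}" "{space (vec_space d)} \<subseteq> sets (vec_space d)" "\<Union>{space (vec_space d)} = space (vec_space d)"
      by auto
    show "range atMost \<subseteq> Pow (space (borel :: real measure))" by simp
    show "sets (borel :: real measure) = sigma_sets (space borel) (range atMost)"
      by (subst borel_eq_atMost) (simp add: full_SetCompr_eq)
    show "countable (range (\<lambda>n. atMost (real n)))" "range (\<lambda>n. atMost (real n)) \<subseteq> range atMost" by auto
    show "\<Union> (range (\<lambda>n. atMost (real n))) = space borel"
      using real_arch_simple by auto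
  qed
  also have "\<dots> = sigma_sets (space (vec_space d) \<times> space borel) ?G"
    using sets.sets_into_space[of _ "vec_space d"] by (intro sets_measure_of) auto
  finally show ?thesis by (simp add: space_pair_measure)
qed

text \<open>Conditioning on the other coordinates leaves a one-dimensional Gaussian hitting a point,
  unless the last coefficient vanishes and the dimension can be lowered.\<close>

lemma gaussian_vec_hyperplane:
  assumes "dot d v v \<noteq> 0"
  shows "(\<integral>\<^sup>+x. indicator {t} (dot d v x) \<partial>gaussian_vec d) = 0"
  using assms
proof (induction d arbitrary: t)
  case 0
  then show ?case by (simp add: dot_def)
next
  case (Suc d)
  have "(\<integral>\<^sup>+x. indicator {t} (dot (Suc d) v x) \<partial>gaussian_vec (Suc d)) =
    (\<integral>\<^sup>+x. \<integral>\<^sup>+y. indicator {t} (dot d v x + v d * y) \<partial>gaussian 0 1 \<partial>gaussian_vec d)"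
    by (subst nn_integral_gaussian_vec_Suc) auto
  also have "\<dots> = 0"
  proof (cases "v d = 0")
    case True
    interpret G: prob_space "gaussian 0 1" by (rule prob_space_gaussian) simp
    have "dot d v v \<noteq> 0" using Suc.prems True by (simp add: dot_Suc)
    then show ?thesis using Suc.IH[of t] True G.emeasure_space_1 by simp
  next
    case False
    have "(\<integral>\<^sup>+y. indicator {t} (a + v d * y) \<partial>gaussian 0 1) = 0" for a
    proof -
      have "(\<integral>\<^sup>+y. indicator {t} (a + v d * y) \<partial>gaussian 0 1) =
          (\<integral>\<^sup>+y. ennreal (std_normal_density y) * indicator {t} (a + v d * y) \<partial>lborel)"
        by (rule nn_integral_gaussian) measurable
      also have "\<dots> = 0"
      proof (subst nn_integral_0_iff_AE, measurable, rule AE_mp[OF AE_lborel_singleton[of "(t - a) / v d"]], intro AE_I2 impI)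
        fix y assume "y \<noteq> (t - a) / v d"
        then have "a + v d * y \<noteq> t" using False by (auto simp: field_simps)
        then show "ennreal (std_normal_density y) * indicator {t} (a + v d * y) = 0" by simp
      qed
      finally show ?thesis .
    qed
    then show ?thesis by simp
  qed
  finally show ?case .
qed

context lattice_noise
begin

lemma emeasure_mixture_space:
  assumes [measurable]: "V \<in> sets (vec_space d)"
  shows "emeasure (mixture d V r) (space (point_space d)) = emeasure (uniform_sphere d) V"
proof -
  interpret gv: prob_space "gaussian_vec d" by (rule prob_space_gaussian_vec)
  interpret G: prob_space "gaussian 0 1" by (rule prob_space_gaussian) simp
  have "emeasure (mixture d V r) (space (point_space d)) = (\<integral>\<^sup>+p. 1 \<partial>mixture d V r)"
    by (simp add: space_mixture)
  also have "\<dots> = (\<integral>\<^sup>+v. indicator V v \<partial>uniform_sphere d)"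
    using G.emeasure_space_1 E.emeasure_space_1 gv.emeasure_space_1
    by (subst nn_integral_mixture_iterated) auto
  finally show ?thesis by simp
qed

lemma finite_measure_mixture:
  assumes "V \<in> sets (vec_space d)"
  shows "finite_measure (mixture d V r)"
proof
  interpret U: prob_space "uniform_sphere d" by (rule prob_space_uniform_sphere)
  show "emeasure (mixture d V r) (space (mixture d V r)) \<noteq> \<infinity>"
    using emeasure_mixture_space[OF assms] by (simp add: space_mixture)
qed

lemma measure_mixture_space:
  assumes "V \<in> sets (vec_space d)"
  shows "measure (mixture d V r) (space (point_space d)) = measure (uniform_sphere d) V"
  using emeasure_mixture_space[OF assms] by (simp add: measure_def)

text \<open>Although \<open>z\<close> is discrete, the Gaussian part \<open>v \<bullet> x\<close>
  keeps \<open>y\<close> from having atoms. Hence the end point of a half-line is negligible in the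
  limit.\<close>

lemma AE_latent_response:
  assumes d: "0 < d"
  shows "AE w in latent d. snd (observe d 1 w) \<noteq> b"
proof -
  interpret gv: prob_space "gaussian_vec d" by (rule prob_space_gaussian_vec)
  interpret G: prob_space "gaussian 0 1" by (rule prob_space_gaussian) simp
  interpret P: pair_sigma_finite E "gaussian_vec d" by unfold_locales
  have "(\<integral>\<^sup>+w. indicator {b} (snd (observe d 1 w)) \<partial>latent d) =
    (\<integral>\<^sup>+v. \<integral>\<^sup>+x. \<integral>\<^sup>+z. \<integral>\<^sup>+h. indicator {b} (snd (observe d 1 ((v, x), (z, h)))) \<partial>gaussian 0 1 \<partial>E \<partial>gaussian_vec d \<partial>uniform_sphere d)"
    by (rule nn_integral_latent) measurable
  also have "\<dots> = (\<integral>\<^sup>+v. \<integral>\<^sup>+x. \<integral>\<^sup>+z. indicator {b} (\<rho> * dot d v x + z) \<partial>E \<partial>gaussian_vec d \<partial>uniform_sphere d)"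
    using G.emeasure_space_1 by (simp add: observe_def)
  also have "\<dots> = (\<integral>\<^sup>+v. 0 \<partial>uniform_sphere d)"
  proof (rule nn_integral_cong_AE, rule AE_mp[OF AE_uniform_sphere_unit[OF d]], intro AE_I2 impI)
    fix v assume "v \<in> unit_sphere d"
    then have v: "dot d v v \<noteq> 0" by (auto simp: unit_sphere_def)
    have "(\<integral>\<^sup>+x. \<integral>\<^sup>+z. indicator {b} (\<rho> * dot d v x + z) \<partial>E \<partial>gaussian_vec d) =
      (\<integral>\<^sup>+z. \<integral>\<^sup>+x. indicator {b} (\<rho> * dot d v x + z) \<partial>gaussian_vec d \<partial>E)"
      by (rule P.Fubini') measurable
    also have "\<dots> = (\<integral>\<^sup>+z. \<integral>\<^sup>+x. indicator {(b - z) / \<rho>} (dot d v x) \<partial>gaussian_vec d \<partial>E)"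
      using rho by (intro nn_integral_cong) (auto simp: indicator_def field_simps)
    also have "\<dots> = 0" by (simp add: gaussian_vec_hyperplane[OF v])
    finally show "(\<integral>\<^sup>+x. \<integral>\<^sup>+z. indicator {b} (\<rho> * dot d v x + z) \<partial>E \<partial>gaussian_vec d) = 0" .
  qed
  finally have "(\<integral>\<^sup>+w. indicator {b} (snd (observe d 1 w)) \<partial>latent d) = 0" by simp
  then have "AE w in latent d. (indicator {b} (snd (observe d 1 w)) :: ennreal) = 0"
    by (subst (asm) nn_integral_0_iff_AE) measurable
  then show ?thesis by (rule AE_mp) (auto simp: indicator_def)
qed

text \<open>On the latent space the response at level \<open>r n\<close> converges pointwise to the
  response at level 1, so membership in a half-line is eventually constant except when the limit
  hits the end point.\<close>

lemma tendsto_mixture_rectangle: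
  assumes d: "0 < d" and [measurable]: "V \<in> sets (vec_space d)" "A \<in> sets (vec_space d)"
    and r: "r \<longlonglongrightarrow> 1"
  shows "(\<lambda>n. measure (mixture d V (r n)) (A \<times> {..b})) \<longlonglongrightarrow> measure (mixture d V 1) (A \<times> {..b})"
proof -
  interpret L: prob_space "latent d" by (rule prob_space_latent)
  let ?g = "\<lambda>r w. indicator V (fst (fst w)) * (indicator (A \<times> {..b}) (observe d r w) :: ennreal)"
  have eq: "emeasure (mixture d V r) (A \<times> {..b}) = (\<integral>\<^sup>+w. ?g r w \<partial>latent d)" for r
  proof -
    have "emeasure (mixture d V r) (A \<times> {..b}) = (\<integral>\<^sup>+p. indicator (A \<times> {..b}) p \<partial>mixture d V r)"
      by (rule nn_integral_indicator[symmetric]) simp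
    then show ?thesis by (subst (asm) nn_integral_mixture) measurable
  qed
  have "(\<lambda>n. \<integral>\<^sup>+w. ?g (r n) w \<partial>latent d) \<longlonglongrightarrow> (\<integral>\<^sup>+w. ?g 1 w \<partial>latent d)"
  proof (rule nn_integral_dominated_convergence[where w = "\<lambda>_. 1"])
    show "AE w in latent d. ?g (r n) w \<le> 1" for n by (auto simp: indicator_def)
    show "(\<integral>\<^sup>+w. 1 \<partial>latent d) < \<infinity>" by (simp add: L.emeasure_space_1)
    show "AE w in latent d. (\<lambda>n. ?g (r n) w) \<longlonglongrightarrow> ?g 1 w"
    proof (rule AE_mp[OF AE_latent_response[OF d, of b]], intro AE_I2 impI)
      fix w :: "((nat \<Rightarrow> real) \<times> (nat \<Rightarrow> real)) \<times> (real \<times> real)" assume neq: "snd (observe d 1 w) \<noteq> b"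
      obtain v x z h where w: "w = ((v, x), (z, h))" by (metis prod.collapse)
      have ob: "observe d t w = (x, snd (observe d t w))" for t by (simp add: w observe_def)
      have lim: "(\<lambda>n. snd (observe d (r n) w)) \<longlonglongrightarrow> snd (observe d 1 w)"
        unfolding w observe_def by (auto intro!: tendsto_eq_intros r)
      have "\<forall>\<^sub>F n in sequentially. (snd (observe d (r n) w) \<le> b) = (snd (observe d 1 w) \<le> b)"
      proof (cases "snd (observe d 1 w) < b")
        case True
        then show ?thesis using order_tendstoD(2)[OF lim True] by (auto elim: eventually_mono)
      next
        case False
        then have gt: "b < snd (observe d 1 w)" using neq by simp
        then show ?thesis using order_tendstoD(1)[OF lim gt] by (auto elim: eventually_mono)
      qed
      then have "\<forall>\<^sub>F n in sequentially. ?g (r n) w = ?g 1 w"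
        by (rule eventually_mono) (subst (1 2) ob, simp add: indicator_def)
      then show "(\<lambda>n. ?g (r n) w) \<longlonglongrightarrow> ?g 1 w" by (rule tendsto_eventually)
    qed
  qed measurable
  then have "(\<lambda>n. emeasure (mixture d V (r n)) (A \<times> {..b})) \<longlonglongrightarrow> emeasure (mixture d V 1) (A \<times> {..b})"
    unfolding eq .
  moreover have "emeasure (mixture d V t) (A \<times> {..b}) = ennreal (measure (mixture d V t) (A \<times> {..b}))" for t
    using finite_measure.emeasure_eq_measure[OF finite_measure_mixture] by simp
  ultimately show ?thesis by simp
qed

text \<open>Queries are arbitrary measurable functions, so weak convergence would not suffice. The
  uniform second-moment bound \<open>B\<close> gives, by Cauchy-Schwarz, the square-root domination
  by the null distribution that upgrades convergence on rectangles to convergence on all measurable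
  sets.\<close>

lemma tendsto_mixture:
  fixes f :: "point \<Rightarrow> real"
  assumes d: "0 < d" and V [measurable]: "V \<in> sets (vec_space d)"
    and r: "r \<longlonglongrightarrow> 1" "\<And>n. 0 \<le> r n \<and> r n < 1"
    and B: "\<And>n. (\<integral>\<^sup>+p. (mix_ratio d V (r n) p)\<^sup>2 \<partial>null_dist d \<rho> E) \<le> ennreal B" "0 \<le> B"
    and [measurable]: "f \<in> borel_measurable (point_space d)"
    and f: "\<And>p. p \<in> space (point_space d) \<Longrightarrow> 0 \<le> f p \<and> f p \<le> 1"
  shows "(\<lambda>n. \<integral>\<^sup>+p. ennreal (f p) \<partial>mixture d V (r n)) \<longlonglongrightarrow> (\<integral>\<^sup>+p. ennreal (f p) \<partial>mixture d V 1)"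
proof -
  interpret U: prob_space "uniform_sphere d" by (rule prob_space_uniform_sphere)
  interpret N: prob_space "null_dist d \<rho> E" by (rule prob_space_null)
  have dom: "(measure (mixture d V (r n)) A)\<^sup>2 \<le> B * measure (null_dist d \<rho> E) A" if A: "A \<in> sets (mixture d V 1)" for n A
  proof -
    have [measurable]: "A \<in> sets (point_space d)" using A by simp
    have e: "emeasure (mixture d V (r n)) A = (\<integral>\<^sup>+p. mix_ratio d V (r n) p * indicator A p \<partial>null_dist d \<rho> E)"
      using r(2)[of n] by (subst nn_integral_mix_ratio) auto
    have "(emeasure (mixture d V (r n)) A)\<^sup>2 \<le> (\<integral>\<^sup>+p. (mix_ratio d V (r n) p)\<^sup>2 \<partial>null_dist d \<rho> E) * (\<integral>\<^sup>+p. (indicator A p)\<^sup>2 \<partial>null_dist d \<rho> E)"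
      unfolding e by (rule Cauchy_Schwarz_nn_integral) measurable
    also have "(\<integral>\<^sup>+p. (indicator A p)\<^sup>2 \<partial>null_dist d \<rho> E) = emeasure (null_dist d \<rho> E) A"
    proof -
      have "(indicator A p)\<^sup>2 = (indicator A p :: ennreal)" for p by (auto simp: indicator_def)
      then show ?thesis by simp
    qed
    also have "(\<integral>\<^sup>+p. (mix_ratio d V (r n) p)\<^sup>2 \<partial>null_dist d \<rho> E) * emeasure (null_dist d \<rho> E) A \<le> ennreal B * emeasure (null_dist d \<rho> E) A"
      by (intro mult_right_mono B) auto
    also have "\<dots> = ennreal (B * measure (null_dist d \<rho> E) A)"
      using B(2) by (simp add: N.emeasure_eq_measure ennreal_mult)
    also have "emeasure (mixture d V (r n)) A = ennreal (measure (mixture d V (r n)) A)"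
      using finite_measure.emeasure_eq_measure[OF finite_measure_mixture[OF V]] by blast
    finally show ?thesis using B(2) by (simp add: ennreal_power)
  qed
  have conv: "(\<lambda>n. measure (mixture d V (r n)) A) \<longlonglongrightarrow> measure (mixture d V 1) A" if "A \<in> sets (mixture d V 1)" for A
  proof (rule tendsto_measure_sigma_sets[where P = "null_dist d \<rho> E" and C = B])
    show "sets (mixture d V 1) = sigma_sets (space (point_space d)) {A \<times> B | A B. A \<in> sets (vec_space d) \<and> B \<in> range atMost}"
      using sets_point_space_generated by simp
    show "Int_stable {A \<times> B | A B. A \<in> sets (vec_space d) \<and> B \<in> range (atMost :: real \<Rightarrow> real set)}"
    proof (rule Int_stableI)
      fix X Y assume "X \<in> {A \<times> B | A B. A \<in> sets (vec_space d) \<and> B \<in> range (atMost :: real \<Rightarrow> real set)}"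
        "Y \<in> {A \<times> B | A B. A \<in> sets (vec_space d) \<and> B \<in> range (atMost :: real \<Rightarrow> real set)}"
      then obtain A A' b b' where "X = A \<times> {..b}" "Y = A' \<times> {..b'}" and A: "A \<in> sets (vec_space d)" "A' \<in> sets (vec_space d)"
        by auto
      then have "X \<inter> Y = (A \<inter> A') \<times> {..min b b'}" by auto
      then show "X \<inter> Y \<in> {A \<times> B | A B. A \<in> sets (vec_space d) \<and> B \<in> range (atMost :: real \<Rightarrow> real set)}"
        using A by blast
    qed
    show "{A \<times> B | A B. A \<in> sets (vec_space d) \<and> B \<in> range (atMost :: real \<Rightarrow> real set)} \<subseteq> Pow (space (point_space d))"
      using sets.sets_into_space[of _ "vec_space d"] by (auto simp: space_pair_measure)
    show "(\<lambda>n. measure (mixture d V (r n)) A) \<longlonglongrightarrow> measure (mixture d V 1) A"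
      if "A \<in> {A \<times> B | A B. A \<in> sets (vec_space d) \<and> B \<in> range (atMost :: real \<Rightarrow> real set)}" for A
      using that tendsto_mixture_rectangle[OF d V _ r(1)] by auto
    show "(\<lambda>n. measure (mixture d V (r n)) (space (point_space d))) \<longlonglongrightarrow> measure (mixture d V 1) (space (point_space d))"
      by (simp add: measure_mixture_space)
  qed (use that in \<open>auto intro: finite_measure_mixture dom N.finite_measure_axioms\<close>)
  show ?thesis
  proof (rule tendsto_nn_integral_setwise[where K = 1])
    show "measure (mixture d V (r n)) (space (mixture d V 1)) \<le> 1" for n
      by (simp add: space_mixture measure_mixture_space U.prob_le_1)
  qed (auto intro: finite_measure_mixture conv simp: f space_mixture)
qed

text \<open>Let \<open>w\<close> be the measure of \<open>V\<close>. Gaps of one sign cannot cancel,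
  so the mixture over \<open>V\<close> shifts the integral of \<open>f\<close> by at least
  \<open>\<tau> * w\<close>, while the covariance bound allows a squared shift of at most
  \<open>p0 * (1 - p0) * (\<eta> * w\<^sup>2 + \<xi> * w)\<close>. A tolerance with
  \<open>\<tau>\<^sup>2 \<ge> 2 * \<eta> * (p0 * (1 - p0))\<close> makes the left side twice the
  \<open>\<eta>\<close> term, which leaves \<open>\<eta> * w \<le> \<xi>\<close>.\<close>

lemma query_gap:
  fixes f :: "point \<Rightarrow> real"
  assumes d: "0 < d"
    and corr: "\<And>V r. V \<in> sets (vec_space d) \<Longrightarrow> 0 \<le> r \<Longrightarrow> r < 1 \<Longrightarrow>
      (\<integral>\<^sup>+v. indicator V v * (\<integral>\<^sup>+u. indicator V u * correlation d r v u \<partial>uniform_sphere d) \<partial>uniform_sphere d) \<le>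
      ennreal ((1 + \<eta>) * (measure (uniform_sphere d) V)\<^sup>2 + \<xi> * measure (uniform_sphere d) V)"
    and \<eta>: "0 < \<eta>" and \<xi>: "0 \<le> \<xi>"
    and [measurable]: "f \<in> borel_measurable (point_space d)"
    and f: "\<And>p. p \<in> space (point_space d) \<Longrightarrow> 0 \<le> f p \<and> f p \<le> 1"
    and p0: "p0 = integral\<^sup>L (null_dist d \<rho> E) f"
    and \<tau>: "0 < \<tau>" "2 * \<eta> * (p0 * (1 - p0)) \<le> \<tau>\<^sup>2"
    and V [measurable]: "V \<in> sets (vec_space d)"
    and gap: "\<And>v. v \<in> V \<Longrightarrow> p0 + \<tau> \<le> integral\<^sup>L (alt_dist d \<rho> E v) f"
  shows "measure (uniform_sphere d) V \<le> \<xi> / \<eta>"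
proof -
  interpret U: prob_space "uniform_sphere d" by (rule prob_space_uniform_sphere)
  interpret N: prob_space "null_dist d \<rho> E" by (rule prob_space_null)
  define w where "w = measure (uniform_sphere d) V"
  define B where "B = (1 + \<eta>) * w\<^sup>2 + \<xi> * w"
  have w0: "0 \<le> w" by (simp add: w_def)
  have B0: "0 \<le> B" using \<eta> \<xi> w0 by (simp add: B_def)
  define r where "r n = 1 - inverse (real (Suc n))" for n
  have r: "r \<longlonglongrightarrow> 1" "0 \<le> r n \<and> r n < 1" for n
  proof -
    have "(\<lambda>n. 1 - inverse (real (Suc n))) \<longlonglongrightarrow> 1 - 0"
      by (intro tendsto_diff tendsto_const LIMSEQ_inverse_real_of_nat)
    then show "r \<longlonglongrightarrow> 1" by (simp add: r_def[abs_def])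
    have "inverse (real (Suc n)) \<le> 1" by (simp add: inverse_eq_divide)
    then show "0 \<le> r n \<and> r n < 1" by (simp add: r_def)
  qed
  have B: "(\<integral>\<^sup>+p. (mix_ratio d V (r n) p)\<^sup>2 \<partial>null_dist d \<rho> E) \<le> ennreal B" for n
    unfolding nn_integral_mix_ratio_square[OF V] B_def w_def using r(2)[of n] by (intro corr V) auto
  define X where "X n = (\<integral>\<^sup>+p. ennreal (f p) \<partial>mixture d V (r n))" for n
  define X1 where "X1 = (\<integral>\<^sup>+p. ennreal (f p) \<partial>mixture d V 1)"
  have lim: "X \<longlonglongrightarrow> X1"
    unfolding X_def[abs_def] X1_def by (rule tendsto_mixture[OF d V r B B0]) (auto simp: f)
  have X1_fin: "X1 \<noteq> \<top>"
  proof -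
    have "X1 \<le> (\<integral>\<^sup>+p. 1 \<partial>mixture d V 1)"
      unfolding X1_def using f by (intro nn_integral_mono) (auto simp: space_mixture)
    also have "\<dots> = ennreal w" using emeasure_mixture_space[OF V, of 1] by (simp add: space_mixture w_def U.emeasure_eq_measure)
    finally show ?thesis by (auto simp: top_unique)
  qed
  have bound: "(enn2real (X n) - p0 * w)\<^sup>2 \<le> p0 * (1 - p0) * (B - w\<^sup>2)" for n
  proof -
    define h where "h p = enn2real (mix_ratio d V (r n) p)" for p
    have [measurable]: "h \<in> borel_measurable (null_dist d \<rho> E)" unfolding h_def by measurable
    have "(\<integral>\<^sup>+p. (mix_ratio d V (r n) p)\<^sup>2 \<partial>null_dist d \<rho> E) \<noteq> \<infinity>" using B[of n] by (auto simp: top_unique)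
    then have "AE p in null_dist d \<rho> E. (mix_ratio d V (r n) p)\<^sup>2 \<noteq> \<infinity>"
      by (intro nn_integral_noteq_infinite) measurable
    then have H: "AE p in null_dist d \<rho> E. mix_ratio d V (r n) p = ennreal (h p)"
      by (rule AE_mp) (auto simp: h_def less_top power2_eq_square ennreal_mult_eq_top_iff)
    have int2: "(\<integral>\<^sup>+p. ennreal ((h p)\<^sup>2) \<partial>null_dist d \<rho> E) = (\<integral>\<^sup>+p. (mix_ratio d V (r n) p)\<^sup>2 \<partial>null_dist d \<rho> E)"
    proof (intro nn_integral_cong_AE, rule AE_mp[OF H], intro AE_I2 impI)
      fix p assume eq: "mix_ratio d V (r n) p = ennreal (h p)"
      have "0 \<le> h p" by (simp add: h_def)
      then show "ennreal ((h p)\<^sup>2) = (mix_ratio d V (r n) p)\<^sup>2" unfolding eq by (simp add: ennreal_power)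
    qed
    then have h2: "integrable (null_dist d \<rho> E) (\<lambda>p. (h p)\<^sup>2)"
      using B[of n] by (intro integrableI_nonneg) (auto intro: le_less_trans)
    have e2: "N.expectation (\<lambda>p. (h p)\<^sup>2) \<le> B"
    proof -
      have "ennreal (N.expectation (\<lambda>p. (h p)\<^sup>2)) \<le> ennreal B"
        using B[of n] int2 h2 by (simp add: nn_integral_eq_integral)
      then show ?thesis using B0 by (simp only: ennreal_le_iff)
    qed
    have e1: "N.expectation h = w"
    proof -
      have "(\<integral>\<^sup>+p. ennreal (h p) \<partial>null_dist d \<rho> E) = (\<integral>\<^sup>+p. mix_ratio d V (r n) p * 1 \<partial>null_dist d \<rho> E)"
        using H by (intro nn_integral_cong_AE) auto
      also have "\<dots> = (\<integral>\<^sup>+p. 1 \<partial>mixture d V (r n))"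
        using r(2)[of n] by (intro nn_integral_mix_ratio) auto
      also have "\<dots> = ennreal w"
        using emeasure_mixture_space[OF V, of "r n"] by (simp add: space_mixture w_def U.emeasure_eq_measure)
      finally show ?thesis using w0 by (subst integral_eq_nn_integral) (auto simp: h_def)
    qed
    have ef: "N.expectation (\<lambda>p. f p * h p) = enn2real (X n)"
    proof -
      have "(\<integral>\<^sup>+p. ennreal (f p * h p) \<partial>null_dist d \<rho> E) = (\<integral>\<^sup>+p. mix_ratio d V (r n) p * ennreal (f p) \<partial>null_dist d \<rho> E)"
        using H f by (intro nn_integral_cong_AE) (auto simp: space_null ennreal_mult' mult.commute h_def)
      also have "\<dots> = X n"
        unfolding X_def using r(2)[of n] by (intro nn_integral_mix_ratio) auto
      finally show ?thesis using f by (subst integral_eq_nn_integral) (auto simp: h_def space_null)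
    qed
    have p01: "0 \<le> p0" "p0 \<le> 1"
      unfolding p0 using f by (auto simp: space_null intro!: Bochner_Integration.integral_nonneg N.integral_le_const N.integrable_const_bound[of _ 1])
    have "(enn2real (X n) - p0 * w)\<^sup>2 \<le> p0 * (1 - p0) * (N.expectation (\<lambda>p. (h p)\<^sup>2) - w\<^sup>2)"
      using N.covariance_bound[of f h] f h2 by (simp add: ef e1 p0 space_null)
    also have "\<dots> \<le> p0 * (1 - p0) * (B - w\<^sup>2)" using e2 p01 by (intro mult_left_mono) auto
    finally show ?thesis .
  qed
  have "(\<lambda>n. enn2real (X n)) \<longlonglongrightarrow> enn2real X1"
  proof (intro tendsto_enn2real)
    have "ennreal (enn2real X1) = X1" using X1_fin by (simp add: less_top)
    then show "X \<longlonglongrightarrow> ennreal (enn2real X1)" using lim by simp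
  qed simp
  from tendsto_power[OF tendsto_diff[OF this tendsto_const]]
  have "(\<lambda>n. (enn2real (X n) - p0 * w)\<^sup>2) \<longlonglongrightarrow> (enn2real X1 - p0 * w)\<^sup>2" .
  then have sq: "(enn2real X1 - p0 * w)\<^sup>2 \<le> p0 * (1 - p0) * (B - w\<^sup>2)"
    by (rule LIMSEQ_le_const2) (use bound in auto)
  have p01: "0 \<le> p0" "p0 \<le> 1"
    unfolding p0 using f by (auto simp: space_null intro!: Bochner_Integration.integral_nonneg N.integral_le_const N.integrable_const_bound[of _ 1])
  have "ennreal ((p0 + \<tau>) * w) \<le> X1"
  proof -
    have "ennreal ((p0 + \<tau>) * w) = (\<integral>\<^sup>+v. ennreal (p0 + \<tau>) * indicator V v \<partial>uniform_sphere d)"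
      using p01 \<tau> w0 by (subst nn_integral_cmult_indicator) (auto simp: w_def U.emeasure_eq_measure ennreal_mult)
    also have "\<dots> \<le> (\<integral>\<^sup>+v\<in>V. (\<integral>\<^sup>+p. ennreal (f p) \<partial>alt_dist d \<rho> E v) \<partial>uniform_sphere d)"
    proof (intro nn_integral_mono)
      fix v
      interpret Q: prob_space "alt_dist d \<rho> E v" by (rule prob_space_alt)
      have "(\<integral>\<^sup>+p. ennreal (f p) \<partial>alt_dist d \<rho> E v) = ennreal (integral\<^sup>L (alt_dist d \<rho> E v) f)"
        using f by (intro nn_integral_eq_integral Q.integrable_const_bound[of _ 1]) (auto simp: space_alt)
      then show "ennreal (p0 + \<tau>) * indicator V v \<le> (\<integral>\<^sup>+p. ennreal (f p) \<partial>alt_dist d \<rho> E v) * indicator V v"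
        using gap[of v] by (auto simp: indicator_def intro!: ennreal_leI)
    qed
    also have "\<dots> = X1" unfolding X1_def by (rule nn_integral_mixture_1[symmetric]) measurable
    finally show ?thesis .
  qed
  then have "(p0 + \<tau>) * w \<le> enn2real X1"
    using X1_fin enn2real_mono[of "ennreal ((p0 + \<tau>) * w)" X1] p01 \<tau> w0 by (simp add: less_top)
  then have "\<tau> * w \<le> enn2real X1 - p0 * w" by (simp add: algebra_simps)
  then have "(\<tau> * w)\<^sup>2 \<le> (enn2real X1 - p0 * w)\<^sup>2" using \<tau> w0 by (intro power_mono) auto
  with sq have main: "\<tau>\<^sup>2 * w\<^sup>2 \<le> p0 * (1 - p0) * (\<eta> * w\<^sup>2 + \<xi> * w)"
    by (simp add: B_def power_mult_distrib algebra_simps)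
  show ?thesis
  proof (cases "w = 0")
    case True
    then show ?thesis using \<eta> \<xi> by (simp add: w_def)
  next
    case False
    then have w: "0 < w" using w0 by simp
    define q where "q = p0 * (1 - p0)"
    \<comment> \<open>If the null mean were 0 or 1, the covariance bound would force the shift to
      vanish, which contradicts \<open>\<tau> > 0\<close> and \<open>w > 0\<close>.\<close>
    have "q \<noteq> 0"
    proof
      assume "q = 0"
      then have "\<tau>\<^sup>2 * w\<^sup>2 \<le> 0" using main by (simp add: q_def[symmetric])
      then show False using \<tau> w by (simp add: mult_le_0_iff not_le[symmetric])
    qed
    then have q: "0 < q" using p01 by (simp add: q_def less_le)
    have "2 * \<eta> * q * w\<^sup>2 \<le> \<tau>\<^sup>2 * w\<^sup>2" using \<tau>(2) by (intro mult_right_mono) (auto simp: q_def)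
    also have "\<dots> \<le> q * (\<eta> * w\<^sup>2 + \<xi> * w)" using main by (simp add: q_def)
    finally have "q * w * (\<eta> * w) \<le> q * w * \<xi>" by (simp add: power2_eq_square algebra_simps)
    then have "\<eta> * w \<le> \<xi>" using q w by simp
    then show ?thesis using \<eta> by (simp add: w_def field_simps)
  qed
qed

end

section \<open>Statistical query algorithms\<close>

text \<open>The answers of an oracle that ignores the transcript, continued beyond a guess with
  dummy answers 0. The list of index \<open>n\<close> always has length \<open>n\<close>, so its
  entries can be treated as coordinates of a random vector.\<close>

fun answer_seq :: "strategy \<Rightarrow> (query \<Rightarrow> real) \<Rightarrow> nat \<Rightarrow> real list" where
  "answer_seq S g 0 = []"
| "answer_seq S g (Suc n) = answer_seq S g n @ [case S (answer_seq S g n) of Query q \<Rightarrow> g q | Guess b \<Rightarrow> 0]"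

lemma length_answer_seq [simp]: "length (answer_seq S g n) = n"
  by (induction n) auto

lemma answer_seq_nth: "i < n \<Longrightarrow> answer_seq S g n ! i = answer_seq S g (Suc i) ! i"
  by (induction n) (auto simp: nth_append less_Suc_eq)

lemma run_answer_seq:
  assumes "\<And>k. k < n \<Longrightarrow> verdict (S (answer_seq S g k)) = None"
  shows "map snd (run S (\<lambda>\<tau>. g) n) = answer_seq S g n"
  using assms
proof (induction n)
  case (Suc n)
  then have IH: "map snd (run S (\<lambda>\<tau>. g) n) = answer_seq S g n" by simp
  obtain q where "S (answer_seq S g n) = Query q"
    using Suc.prems[of n] by (cases "S (answer_seq S g n)") auto
  then show ?case using IH by (simp add: Let_def)
qed simp

lemma run_stops:
  assumes "S (map snd (run S r n)) = Guess b"
  shows "run S r (n + k) = run S r n"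
  using assms by (induction k) (auto simp: Let_def)

text \<open>After a guess \<open>run\<close> is frozen, whereas \<open>answer_seq\<close> goes on
  and may meet further guesses. Only the first verdict along \<open>answer_seq\<close> is the
  output.\<close>

lemma outputs_iff:
  "outputs S (\<lambda>\<tau>. g) b \<longleftrightarrow>
    (\<exists>n. verdict (S (answer_seq S g n)) = Some b \<and> (\<forall>k<n. verdict (S (answer_seq S g k)) = None))"
  (is "?L \<longleftrightarrow> ?R")
proof
  assume ?R
  then obtain n where n: "verdict (S (answer_seq S g n)) = Some b" "\<forall>k<n. verdict (S (answer_seq S g k)) = None" by blast
  then have "map snd (run S (\<lambda>\<tau>. g) n) = answer_seq S g n" by (intro run_answer_seq) auto
  moreover have "S (answer_seq S g n) = Guess b" using n(1) by (cases "S (answer_seq S g n)") auto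
  ultimately show ?L unfolding outputs_def by (intro exI[of _ n]) simp
next
  assume ?L
  then obtain m where m: "S (map snd (run S (\<lambda>\<tau>. g) m)) = Guess b" by (auto simp: outputs_def)
  have "\<exists>n\<le>m. verdict (S (answer_seq S g n)) \<noteq> None"
  proof (rule ccontr)
    assume "\<not> ?thesis"
    then have none: "\<forall>n\<le>m. verdict (S (answer_seq S g n)) = None" by blast
    then have "map snd (run S (\<lambda>\<tau>. g) m) = answer_seq S g m" by (intro run_answer_seq) auto
    with m none show False by fastforce
  qed
  then obtain n0 where n0: "n0 \<le> m" "verdict (S (answer_seq S g n0)) \<noteq> None" by blast
  define n where "n = (LEAST n. verdict (S (answer_seq S g n)) \<noteq> None)"
  have n: "verdict (S (answer_seq S g n)) \<noteq> None" "n \<le> n0"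
    unfolding n_def using n0(2) by (rule LeastI, intro Least_le)
  have before: "verdict (S (answer_seq S g k)) = None" if "k < n" for k
    using not_less_Least[OF that[unfolded n_def]] by simp
  have r: "map snd (run S (\<lambda>\<tau>. g) n) = answer_seq S g n" by (rule run_answer_seq) (rule before)
  obtain b' where b': "S (answer_seq S g n) = Guess b'" using n(1) by (cases "S (answer_seq S g n)") auto
  have "run S (\<lambda>\<tau>. g) (n + (m - n)) = run S (\<lambda>\<tau>. g) n" by (rule run_stops) (simp add: r b')
  then have "run S (\<lambda>\<tau>. g) m = run S (\<lambda>\<tau>. g) n" using n(2) n0(1) by simp
  with m r b' have "b' = b" by simp
  then show ?R using b' before by (intro exI[of _ n]) auto
qed

lemma outputs_unique:
  assumes "outputs S (\<lambda>\<tau>. g) b" "outputs S (\<lambda>\<tau>. g) b'"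
  shows "b = b'"
proof -
  obtain n where n: "verdict (S (answer_seq S g n)) = Some b" "\<forall>k<n. verdict (S (answer_seq S g k)) = None"
    using assms(1) unfolding outputs_iff by blast
  obtain n' where n': "verdict (S (answer_seq S g n')) = Some b'" "\<forall>k<n'. verdict (S (answer_seq S g k)) = None"
    using assms(2) unfolding outputs_iff by blast
  have "n = n'" using n n' by (metis linorder_neqE_nat option.distinct(1))
  then show ?thesis using n n' by simp
qed

text \<open>Agreement is required only at the queries asked along the run with \<open>g\<close>.
  This couples the run under an alternative to the run under the null hypothesis.\<close>

lemma answer_seq_cong:
  assumes "\<And>k q. k < n \<Longrightarrow> S (answer_seq S g k) = Query q \<Longrightarrow> g' q = g q"
  shows "answer_seq S g' n = answer_seq S g n"
  using assms
proof (induction n)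
  case (Suc n)
  have "answer_seq S g' n = answer_seq S g n"
    using Suc.prems by (intro Suc.IH) (auto intro: less_SucI)
  then show ?case using Suc.prems[of n] by (auto split: action.split)
qed simp

text \<open>By induction each answer is measurable, being a measurable function of the seed, the
  parameter and the earlier answers; the output is then a countable combination of verdict
  events.\<close>

lemma sets_outputs:
  fixes g :: "'x \<Rightarrow> query \<Rightarrow> real"
  assumes alg: "sq_algorithm d M A" and w [measurable]: "w \<in> measurable X M"
    and resp: "\<And>n. (\<lambda>(x, u). let a = A (w x) (map u [0..<n]) in
        if verdict a = None then g x (query_fun a, query_acc a) else 0) \<in> borel_measurable (X \<Otimes>\<^sub>M vec_space n)"
  shows "{x \<in> space X. outputs (A (w x)) (\<lambda>\<tau>. g x) b} \<in> sets X"
proof -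
  define u where "u x i = answer_seq (A (w x)) (g x) (Suc i) ! i" for x i
  have seq: "answer_seq (A (w x)) (g x) n = map (u x) [0..<n]" for x n
    by (rule nth_equalityI) (auto simp: u_def answer_seq_nth)
  let ?act = "\<lambda>n x. A (w x) (answer_seq (A (w x)) (g x) n)"
  have mp: "map (restrict (u x) {..<n}) [0..<n] = map (u x) [0..<n]" for x n by auto
  have u_eq: "u x n = (let a = A (w x) (map (restrict (u x) {..<n}) [0..<n]) in
      if verdict a = None then g x (query_fun a, query_acc a) else 0)" for x n
  proof -
    have "u x n = (case ?act n x of Query q \<Rightarrow> g x q | Guess b \<Rightarrow> 0)"
      by (simp add: u_def nth_append)
    then show ?thesis unfolding mp seq[symmetric] by (cases "?act n x") (auto simp: Let_def)
  qed
  have meas_vec: "(\<lambda>x. restrict (u x) {..<n}) \<in> measurable X (vec_space n)"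
    if "\<And>i. i < n \<Longrightarrow> (\<lambda>x. u x i) \<in> borel_measurable X" for n
    using that by (intro measurable_restrict) auto
  have meas_u: "(\<lambda>x. u x n) \<in> borel_measurable X" for n
  proof (induction n rule: less_induct)
    case (less n)
    have [measurable]: "(\<lambda>x. restrict (u x) {..<n}) \<in> measurable X (vec_space n)"
      by (rule meas_vec) (rule less)
    have "(\<lambda>x. (x, restrict (u x) {..<n})) \<in> measurable X (X \<Otimes>\<^sub>M vec_space n)" by measurable
    from measurable_compose[OF this resp[of n]] show ?case
      unfolding u_eq[of _ n] by simp
  qed
  have verdict_meas: "(\<lambda>x. verdict (?act n x)) \<in> measurable X (count_space UNIV)" for n
  proof -
    have [measurable]: "(\<lambda>x. restrict (u x) {..<n}) \<in> measurable X (vec_space n)"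
      by (rule meas_vec) (rule meas_u)
    have m: "(\<lambda>x. (w x, restrict (u x) {..<n})) \<in> measurable X (M \<Otimes>\<^sub>M vec_space n)" by measurable
    have "(\<lambda>(\<omega>, u). verdict (A \<omega> (map u [0..<n]))) \<in> measurable (M \<Otimes>\<^sub>M vec_space n) (count_space UNIV)"
      using alg unfolding sq_algorithm_def by (simp add: Let_def case_prod_beta')
    from measurable_compose[OF m this] show ?thesis by (simp add: mp seq[symmetric])
  qed
  have ev: "{x \<in> space X. verdict (?act n x) = c} \<in> sets X" for n c
    using measurable_sets[OF verdict_meas, of "{c}" n] by (simp add: vimage_def Int_def conj_commute)
  have [measurable]: "Measurable.pred X (\<lambda>x. verdict (?act n x) = c)" for n c
    using ev[of n c] by (simp add: pred_def)
  show ?thesis unfolding outputs_iff by measurable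
qed

lemma measurable_query_fun:
  assumes alg: "sq_algorithm d M A"
  shows "(\<lambda>((\<omega>, u), z). query_fun (A \<omega> (map u [0..<n])) z) \<in> borel_measurable ((M \<Otimes>\<^sub>M vec_space n) \<Otimes>\<^sub>M point_space d)"
  using alg unfolding sq_algorithm_def by (simp add: Let_def case_prod_beta')

lemma measurable_verdict:
  assumes alg: "sq_algorithm d M A"
  shows "(\<lambda>(\<omega>, u). verdict (A \<omega> (map u [0..<n]))) \<in> measurable (M \<Otimes>\<^sub>M vec_space n) (count_space UNIV)"
  using alg unfolding sq_algorithm_def by (simp add: Let_def case_prod_beta')

lemma measurable_query_acc:
  assumes alg: "sq_algorithm d M A"
  shows "(\<lambda>(\<omega>, u). query_acc (A \<omega> (map u [0..<n]))) \<in> measurable (M \<Otimes>\<^sub>M vec_space n) (count_space UNIV)"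
  using alg unfolding sq_algorithm_def by (simp add: Let_def case_prod_beta')

lemma measurable_query_fun_single:
  assumes alg: "sq_algorithm d M A" and "\<omega> \<in> space M" "u \<in> space (vec_space n)"
  shows "query_fun (A \<omega> (map u [0..<n])) \<in> borel_measurable (point_space d)"
proof -
  have "(\<omega>, u) \<in> space (M \<Otimes>\<^sub>M vec_space n)" using assms by (simp add: space_pair_measure)
  from measurable_Pair2[OF measurable_query_fun[OF alg] this] show ?thesis by simp
qed

text \<open>The adversary gives the null answer whenever this is within the tolerance, so that an algorithm learns nothing until
  one of its queries separates the alternative from the null hypothesis.\<close>

definition stubborn_oracle :: "point measure \<Rightarrow> vstat_oracle" where
  "stubborn_oracle P D \<tau> q =
    (if vstat_answer D q (integral\<^sup>L P (fst q)) then integral\<^sup>L P (fst q) else integral\<^sup>L D (fst q))"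

lemma vstat_answer_mean: "vstat_answer D (f, m) (integral\<^sup>L D f)"
  by (simp add: vstat_answer_def le_max_iff_disj)

lemma valid_stubborn_oracle: "valid_oracle d \<D> (stubborn_oracle P)"
  unfolding valid_oracle_def stubborn_oracle_def by (auto intro: vstat_answer_mean)

lemma stubborn_oracle_null [simp]: "stubborn_oracle P P \<tau> q = integral\<^sup>L P (fst q)"
  by (simp add: stubborn_oracle_def)

context lattice_noise
begin

section \<open>Measurability of the oracle answers in seed, direction and earlier answers\<close>

lemma measurable_null_mean:
  assumes alg: "sq_algorithm d M A"
  shows "(\<lambda>(\<omega>, u). integral\<^sup>L (null_dist d \<rho> E) (query_fun (A \<omega> (map u [0..<n])))) \<in> borel_measurable (M \<Otimes>\<^sub>M vec_space n)"
proof -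
  interpret N: prob_space "null_dist d \<rho> E" by (rule prob_space_null)
  have [measurable]: "(\<lambda>(p, z). query_fun (A (fst p) (map (snd p) [0..<n])) z) \<in> borel_measurable ((M \<Otimes>\<^sub>M vec_space n) \<Otimes>\<^sub>M null_dist d \<rho> E)"
    using measurable_query_fun[OF alg, of n] by (simp add: case_prod_beta' cong: measurable_cong_sets sets_pair_measure_cong)
  show ?thesis unfolding case_prod_beta' by (rule N.borel_measurable_lebesgue_integral) measurable
qed

text \<open>The direction moves from the measure into the integrand. Measurability in
  \<open>v\<close> then becomes measurability of a parameter integral over a fixed product
  measure.\<close>

lemma integral_alt:
  fixes f :: "point \<Rightarrow> real"
  assumes [measurable]: "f \<in> borel_measurable (point_space d)"
  shows "integral\<^sup>L (alt_dist d \<rho> E v) f = (\<integral>p. f (fst p, \<rho> * dot d v (fst p) + snd p) \<partial>(gaussian_vec d \<Otimes>\<^sub>M E))"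
proof -
  have m [measurable]: "(\<lambda>p. (fst p, \<rho> * dot d v (fst p) + snd p)) \<in> measurable (gaussian_vec d \<Otimes>\<^sub>M E) (point_space d)"
    by measurable
  show ?thesis unfolding alt_dist_def case_prod_beta' by (rule integral_distr[OF m assms])
qed

lemma measurable_alt_mean:
  assumes alg: "sq_algorithm d M A"
  shows "(\<lambda>((v, \<omega>), u). integral\<^sup>L (alt_dist d \<rho> E v) (query_fun (A \<omega> (map u [0..<n]))))
    \<in> borel_measurable ((uniform_sphere d \<Otimes>\<^sub>M M) \<Otimes>\<^sub>M vec_space n)"
proof -
  interpret gv: prob_space "gaussian_vec d" by (rule prob_space_gaussian_vec)
  interpret P: pair_prob_space "gaussian_vec d" E by unfold_locales
  let ?X = "(uniform_sphere d \<Otimes>\<^sub>M M) \<Otimes>\<^sub>M vec_space n"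
  have [measurable]: "(\<lambda>q. (((snd (fst (fst q))), snd (fst q)), (fst (snd q), \<rho> * dot d (fst (fst (fst q))) (fst (snd q)) + snd (snd q))))
     \<in> measurable (?X \<Otimes>\<^sub>M (gaussian_vec d \<Otimes>\<^sub>M E)) ((M \<Otimes>\<^sub>M vec_space n) \<Otimes>\<^sub>M point_space d)"
    by measurable
  have "(\<lambda>(p, z). query_fun (A (snd (fst p)) (map (snd p) [0..<n])) (fst z, \<rho> * dot d (fst (fst p)) (fst z) + snd z))
     \<in> borel_measurable (?X \<Otimes>\<^sub>M (gaussian_vec d \<Otimes>\<^sub>M E))"
    using measurable_compose[OF _ measurable_query_fun[OF alg, of n], of
        "\<lambda>q. (((snd (fst (fst q))), snd (fst q)), (fst (snd q), \<rho> * dot d (fst (fst (fst q))) (fst (snd q)) + snd (snd q)))"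
        "?X \<Otimes>\<^sub>M (gaussian_vec d \<Otimes>\<^sub>M E)"]
    by (simp add: case_prod_beta')
  then have "(\<lambda>p. \<integral>z. query_fun (A (snd (fst p)) (map (snd p) [0..<n])) (fst z, \<rho> * dot d (fst (fst p)) (fst z) + snd z) \<partial>(gaussian_vec d \<Otimes>\<^sub>M E))
     \<in> borel_measurable ?X"
    by (rule P.borel_measurable_lebesgue_integral)
  then show ?thesis
    by (rule measurable_cong[THEN iffD1, rotated])
      (auto simp: space_pair_measure space_uniform_sphere integral_alt measurable_query_fun_single[OF alg])
qed

lemma measurable_response_null:
  assumes alg: "sq_algorithm d M A"
  shows "(\<lambda>(\<omega>, u). let a = A \<omega> (map u [0..<n]) in if verdict a = None then
      stubborn_oracle (null_dist d \<rho> E) (null_dist d \<rho> E) \<tau> (query_fun a, query_acc a) else 0)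
    \<in> borel_measurable (M \<Otimes>\<^sub>M vec_space n)"
proof -
  have [measurable]: "(\<lambda>p. verdict (A (fst p) (map (snd p) [0..<n]))) \<in> measurable (M \<Otimes>\<^sub>M vec_space n) (count_space UNIV)"
    "(\<lambda>p. integral\<^sup>L (null_dist d \<rho> E) (query_fun (A (fst p) (map (snd p) [0..<n])))) \<in> borel_measurable (M \<Otimes>\<^sub>M vec_space n)"
    using measurable_null_mean[OF alg, of n] measurable_verdict[OF alg, of n] by (simp_all add: case_prod_beta')
  show ?thesis unfolding Let_def case_prod_beta' stubborn_oracle_null fst_conv by measurable
qed

lemma measurable_response_alt:
  assumes alg: "sq_algorithm d M A"
  shows "(\<lambda>((v, \<omega>), u). let a = A \<omega> (map u [0..<n]) in if verdict a = None then
      stubborn_oracle (null_dist d \<rho> E) (alt_dist d \<rho> E v) \<tau> (query_fun a, query_acc a) else 0)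
    \<in> borel_measurable ((uniform_sphere d \<Otimes>\<^sub>M M) \<Otimes>\<^sub>M vec_space n)"
proof -
  let ?X = "(uniform_sphere d \<Otimes>\<^sub>M M) \<Otimes>\<^sub>M vec_space n"
  have pr: "(\<lambda>p. (snd (fst p), snd p)) \<in> measurable ?X (M \<Otimes>\<^sub>M vec_space n)" by measurable
  have [measurable]: "(\<lambda>p. integral\<^sup>L (null_dist d \<rho> E) (query_fun (A (snd (fst p)) (map (snd p) [0..<n])))) \<in> borel_measurable ?X"
    using measurable_compose[OF pr measurable_null_mean[OF alg, of n]] by simp
  have [measurable]: "(\<lambda>p. verdict (A (snd (fst p)) (map (snd p) [0..<n]))) \<in> measurable ?X (count_space UNIV)"
    using measurable_compose[OF pr measurable_verdict[OF alg, of n]] by simp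
  have acc: "(\<lambda>p. query_acc (A (snd (fst p)) (map (snd p) [0..<n]))) \<in> measurable ?X (count_space UNIV)"
    using measurable_compose[OF pr measurable_query_acc[OF alg, of n]] by simp
  have [measurable]: "(\<lambda>p. real (query_acc (A (snd (fst p)) (map (snd p) [0..<n])))) \<in> borel_measurable ?X"
    by (rule measurable_compose[OF acc]) simp
  have [measurable]: "(\<lambda>p. integral\<^sup>L (alt_dist d \<rho> E (fst (fst p))) (query_fun (A (snd (fst p)) (map (snd p) [0..<n])))) \<in> borel_measurable ?X"
    using measurable_alt_mean[OF alg, of n] by (simp add: case_prod_beta')
  show ?thesis
    unfolding stubborn_oracle_def vstat_answer_def Let_def case_prod_beta' fst_conv snd_conv by measurable
qed

lemma null_in_test_dists:
  assumes "0 < d"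
  shows "null_dist d \<rho> E \<in> test_dists d \<rho> E"
proof -
  define e where "e = (\<lambda>i\<in>{..<d}. if i = 0 then 1 else 0 :: real)"
  have "dot d e e = (\<Sum>i<d. if i = 0 then 1 else 0)"
    unfolding dot_def e_def by (intro sum.cong) auto
  also have "\<dots> = 1" using assms by (simp add: sum.delta)
  finally have "e \<in> unit_sphere d" by (auto simp: unit_sphere_def e_def)
  then show ?thesis unfolding test_dists_def test_dist_def by force
qed

lemma run_length:
  assumes "\<And>k. k < n \<Longrightarrow> verdict (S (answer_seq S g k)) = None"
  shows "length (run S (\<lambda>\<tau>. g) n) = n"
  using arg_cong[OF run_answer_seq[where S=S and g=g and n=n, OF assms], of length] by simp

text \<open>For a fixed seed the null run asks fewer than \<open>q0\<close> queries, and by a union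
  bound all but a fraction 1/4 of the directions answer them exactly as the null hypothesis does.
  Hence the probability of guessing \<open>True\<close> rises by at most 1/4 under the alternative,
  and the success probability is at most \<open>(1 + 1/4) / 2 = 5/8 < 2/3\<close>.\<close>

lemma sq_reduction:
  assumes d: "0 < d"
    and hard: "\<And>f m. valid_query d (f, m) \<Longrightarrow> real m < m0 \<Longrightarrow>
      measure (uniform_sphere d) {v \<in> space (vec_space d). \<not> vstat_answer (alt_dist d \<rho> E v) (f, m) (integral\<^sup>L (null_dist d \<rho> E) f)} \<le> \<beta>"
    and \<beta>: "0 \<le> \<beta>" "q0 * \<beta> \<le> 1/4"
    and alg: "sq_algorithm d M A" and solves: "solves_test d \<rho> E M A (2/3)"
    and len: "\<And>\<tau>. \<tau> \<in> possible_runs d \<rho> E M A \<Longrightarrow> real (length \<tau>) < q0"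
    and acc: "\<And>\<tau> f m u. \<tau> \<in> possible_runs d \<rho> E M A \<Longrightarrow> ((f, m), u) \<in> set \<tau> \<Longrightarrow> real m < m0"
  shows False
proof -
  let ?N = "null_dist d \<rho> E" and ?Q = "alt_dist d \<rho> E" and ?U = "uniform_sphere d"
  interpret U: prob_space ?U by (rule prob_space_uniform_sphere)
  interpret M: prob_space M using alg by (simp add: sq_algorithm_def)
  interpret UM: pair_prob_space ?U M by unfold_locales
  define orc where "orc = stubborn_oracle ?N"
  define g0 where "g0 q = integral\<^sup>L ?N (fst q)" for q :: query
  define g1 where "g1 v q = (if vstat_answer (?Q v) q (g0 q) then g0 q else integral\<^sup>L (?Q v) (fst q))" for v and q :: query
  have orc0: "orc ?N = (\<lambda>\<tau>. g0)" by (simp add: orc_def g0_def fun_eq_iff)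
  have orc1: "orc (?Q v) = (\<lambda>\<tau>. g1 v)" for v by (simp add: orc_def g0_def g1_def fun_eq_iff stubborn_oracle_def)
  define S0 where "S0 b = {\<omega> \<in> space M. outputs (A \<omega>) (\<lambda>\<tau>. g0) b}" for b
  define S1 where "S1 = {p \<in> space (?U \<Otimes>\<^sub>M M). outputs (A (snd p)) (\<lambda>\<tau>. g1 (fst p)) True}"
  have S0m [measurable]: "S0 b \<in> sets M" for b
    \<comment> \<open>The stubborn oracle does not look at the transcript, so any value can be
      supplied for it.\<close>
    unfolding S0_def using measurable_response_null[OF alg, of _ undefined]
    by (intro sets_outputs[OF alg, where w="\<lambda>x. x"]) (auto simp: g0_def cong: if_cong)
  have S1m [measurable]: "S1 \<in> sets (?U \<Otimes>\<^sub>M M)"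
    unfolding S1_def
  proof (rule sets_outputs[OF alg])
    show "(\<lambda>(x, u). let a = A (snd x) (map u [0..<n]) in if verdict a = None then g1 (fst x) (query_fun a, query_acc a) else 0)
        \<in> borel_measurable ((?U \<Otimes>\<^sub>M M) \<Otimes>\<^sub>M vec_space n)" for n
      using measurable_response_alt[OF alg, of n undefined]
      by (simp add: case_prod_beta' g1_def g0_def stubborn_oracle_def cong: if_cong)
  qed measurable
  have sect: "emeasure ?U {v \<in> space ?U. (v, \<omega>) \<in> S1} \<le> indicator (S0 True) \<omega> + ennreal (1/4)" if \<omega>: "\<omega> \<in> space M" for \<omega>
  proof -
    let ?S = "A \<omega>"
    have poss: "run ?S (\<lambda>\<tau>. g0) n \<in> possible_runs d \<rho> E M A" for n
      unfolding possible_runs_def using \<omega> null_in_test_dists[OF d] orc0[symmetric] valid_stubborn_oracle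
      by (auto simp: orc_def intro!: exI[of _ \<omega>] exI[of _ orc] exI[of _ ?N] exI[of _ n])
    \<comment> \<open>A seed that never guesses would produce runs of every length, against the
      bound \<open>q0\<close>.\<close>
    have "\<exists>n. verdict (?S (answer_seq ?S g0 n)) \<noteq> None"
    proof (rule ccontr)
      assume "\<not> ?thesis"
      then have "length (run ?S (\<lambda>\<tau>. g0) n) = n" for n by (intro run_length) auto
      then have "real n < q0" for n using len[OF poss, of n] by simp
      then show False using reals_Archimedean2[of q0] by (meson less_asym)
    qed
    then obtain n' where n': "verdict (?S (answer_seq ?S g0 n')) \<noteq> None" by blast
    define n where "n = (LEAST n. verdict (?S (answer_seq ?S g0 n)) \<noteq> None)"
    have n: "verdict (?S (answer_seq ?S g0 n)) \<noteq> None" unfolding n_def using n' by (rule LeastI)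
    have before: "verdict (?S (answer_seq ?S g0 k)) = None" if "k < n" for k
      using not_less_Least[OF that[unfolded n_def]] by simp
    have lenn: "real n < q0" using len[OF poss, of n] run_length[of n ?S g0] before by simp
    obtain b where b: "verdict (?S (answer_seq ?S g0 n)) = Some b" using n by auto
    have out0: "outputs ?S (\<lambda>\<tau>. g0) b" unfolding outputs_iff using b before by blast
    show ?thesis
    proof (cases b)
      case True
      then have "\<omega> \<in> S0 True" using out0 \<omega> by (simp add: S0_def)
      have "emeasure ?U {v \<in> space ?U. (v, \<omega>) \<in> S1} \<le> 1" by (rule U.emeasure_le_1)
      then show ?thesis using \<open>\<omega> \<in> S0 True\<close> by (simp add: add_increasing2)
    next
      case False
      \<comment> \<open>The directions for which the null answer to the query number
        \<open>k\<close> of the null run is out of tolerance. Outside their union the run under the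
        alternative copies the null run up to its guess \<open>False\<close>.\<close>
      define bad where "bad k = {v \<in> space (vec_space d). \<not> vstat_answer (?Q v)
          (query_fun (?S (answer_seq ?S g0 k)), query_acc (?S (answer_seq ?S g0 k)))
          (integral\<^sup>L ?N (query_fun (?S (answer_seq ?S g0 k))))}" for k
      have badm: "bad k \<in> sets (vec_space d)" and badp: "measure ?U (bad k) \<le> \<beta>" if k: "k < n" for k
      proof -
        obtain f m where q: "?S (answer_seq ?S g0 k) = Query (f, m)"
          using before[OF k] by (cases "?S (answer_seq ?S g0 k)") auto
        have valid: "valid_query d (f, m)"
          using alg \<omega> q unfolding sq_algorithm_def by blast
        have "((f, m), g0 (f, m)) \<in> set (run ?S (\<lambda>\<tau>. g0) (Suc k))"
        proof -
          have "map snd (run ?S (\<lambda>\<tau>. g0) k) = answer_seq ?S g0 k"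
            using before k by (intro run_answer_seq) auto
          then show ?thesis by (simp add: Let_def q)
        qed
        then have m: "real m < m0" by (rule acc[OF poss])
        show "measure ?U (bad k) \<le> \<beta>" unfolding bad_def using hard[OF valid m] by (simp add: q)
        have [measurable]: "f \<in> borel_measurable (point_space d)" using valid by (simp add: valid_query_def)
        interpret gv: prob_space "gaussian_vec d" by (rule prob_space_gaussian_vec)
        interpret P: pair_prob_space "gaussian_vec d" E by unfold_locales
        have [measurable]: "(\<lambda>v. integral\<^sup>L (?Q v) f) \<in> borel_measurable (vec_space d)"
          unfolding integral_alt[OF \<open>f \<in> borel_measurable (point_space d)\<close>]
          by (rule P.borel_measurable_lebesgue_integral) measurable
        show "bad k \<in> sets (vec_space d)"
          unfolding bad_def q vstat_answer_def Let_def by simp measurable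
      qed
      have "{v \<in> space ?U. (v, \<omega>) \<in> S1} \<subseteq> (\<Union>k<n. bad k)"
      proof
        fix v assume "v \<in> {v \<in> space ?U. (v, \<omega>) \<in> S1}"
        then have v: "v \<in> space (vec_space d)" and out: "outputs ?S (\<lambda>\<tau>. g1 v) True"
          by (auto simp: S1_def space_uniform_sphere)
        show "v \<in> (\<Union>k<n. bad k)"
        proof (rule ccontr)
          assume nb: "v \<notin> (\<Union>k<n. bad k)"
          have eq: "answer_seq ?S (g1 v) j = answer_seq ?S g0 j" if "j \<le> n" for j
          proof (rule answer_seq_cong)
            fix k q assume k: "k < j" and q: "?S (answer_seq ?S g0 k) = Query q"
            have "v \<notin> bad k" using nb k that by auto
            then have "vstat_answer (?Q v) q (g0 q)" using v by (simp add: bad_def q g0_def)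
            then show "g1 v q = g0 q" by (simp add: g1_def)
          qed
          have "outputs ?S (\<lambda>\<tau>. g1 v) b"
            unfolding outputs_iff using b before eq by (intro exI[of _ n]) auto
          then show False using outputs_unique[OF out] False by blast
        qed
      qed
      then have "measure ?U {v \<in> space ?U. (v, \<omega>) \<in> S1} \<le> measure ?U (\<Union>k<n. bad k)"
        using badm by (intro U.finite_measure_mono) auto
      also have "\<dots> \<le> (\<Sum>k<n. measure ?U (bad k))"
        using badm by (intro U.finite_measure_subadditive_finite) auto
      also have "\<dots> \<le> (\<Sum>k<n. \<beta>)" using badp by (intro sum_mono) auto
      also have "\<dots> = real n * \<beta>" by simp
      also have "\<dots> \<le> q0 * \<beta>" using lenn \<beta> by (intro mult_right_mono) auto
      finally have "emeasure ?U {v \<in> space ?U. (v, \<omega>) \<in> S1} \<le> ennreal (1/4)"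
        using \<beta>(2) unfolding U.emeasure_eq_measure by (intro ennreal_leI) linarith
      then show ?thesis by (simp add: add_increasing)
    qed
  qed
  have e1: "emeasure (?U \<Otimes>\<^sub>M M) S1 \<le> ennreal (measure M (S0 True) + 1/4)"
  proof -
    have "emeasure (?U \<Otimes>\<^sub>M M) S1 = (\<integral>\<^sup>+\<omega>. emeasure ?U ((\<lambda>v. (v, \<omega>)) -` S1) \<partial>M)"
      by (rule UM.emeasure_pair_measure_alt2[OF S1m])
    also have "\<dots> \<le> (\<integral>\<^sup>+\<omega>. indicator (S0 True) \<omega> + ennreal (1/4) \<partial>M)"
    proof (intro nn_integral_mono)
      fix \<omega> assume \<omega>: "\<omega> \<in> space M"
      have "(\<lambda>v. (v, \<omega>)) -` S1 = {v \<in> space ?U. (v, \<omega>) \<in> S1}"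
        by (auto simp: S1_def space_pair_measure)
      then show "emeasure ?U ((\<lambda>v. (v, \<omega>)) -` S1) \<le> indicator (S0 True) \<omega> + ennreal (1/4)"
        using sect[OF \<omega>] by simp
    qed
    also have "\<dots> = emeasure M (S0 True) + ennreal (1/4)"
      by (subst nn_integral_add) (auto simp: M.emeasure_space_1)
    finally show ?thesis by (simp add: M.emeasure_eq_measure)
  qed
  have "S0 True \<inter> S0 False = {}"
    unfolding S0_def using outputs_unique by blast
  then have "measure M (S0 True) + measure M (S0 False) = measure M (S0 True \<union> S0 False)"
    by (intro M.finite_measure_Union[symmetric]) auto
  then have sum1: "measure M (S0 True) + measure M (S0 False) \<le> 1" by simp
  let ?succ = "success_event d \<rho> E M A orc"
  have succ: "?succ = {False} \<times> (space ?U \<times> S0 False) \<union> {True} \<times> S1"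
  proof -
    have "orc (test_dist d \<rho> E \<Gamma> v) = (\<lambda>\<tau>. if \<Gamma> then g1 v else g0)" for \<Gamma> v
      by (simp add: test_dist_def orc0 orc1)
    then show ?thesis
      unfolding success_event_def S0_def S1_def test_space_def by (auto simp: space_pair_measure split: if_splits)
  qed
  \<comment> \<open>Needed because \<open>solves_test\<close> says something only about oracles
    whose success event is measurable.\<close>
  have succm: "?succ \<in> sets (test_space d M)"
    unfolding succ test_space_def by (intro sets.Un pair_measureI sets.top S0m S1m) simp_all
  have "emeasure (test_space d M) ?succ = (\<integral>\<^sup>+\<Gamma>. emeasure (?U \<Otimes>\<^sub>M M) (Pair \<Gamma> -` ?succ) \<partial>measure_pmf (bernoulli_pmf (1/2)))"
    using succm unfolding test_space_def by (rule UM.emeasure_pair_measure_alt)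
  also have "\<dots> = emeasure (?U \<Otimes>\<^sub>M M) S1 * ennreal (1/2) + emeasure (?U \<Otimes>\<^sub>M M) (space ?U \<times> S0 False) * ennreal (1/2)"
  proof -
    have "Pair True -` ?succ = S1" "Pair False -` ?succ = space ?U \<times> S0 False" by (auto simp: succ)
    then show ?thesis by (subst nn_integral_bernoulli_pmf) auto
  qed
  also have "emeasure (?U \<Otimes>\<^sub>M M) (space ?U \<times> S0 False) = ennreal (measure M (S0 False))"
    using sets.top[of ?U]
    by (subst M.emeasure_pair_measure_Times) (auto simp: U.emeasure_space_1 M.emeasure_eq_measure simp del: sets_uniform_sphere)
  also have "emeasure (?U \<Otimes>\<^sub>M M) S1 * ennreal (1/2) + ennreal (measure M (S0 False)) * ennreal (1/2) \<le>
      ennreal (measure M (S0 True) + 1/4) * ennreal (1/2) + ennreal (measure M (S0 False)) * ennreal (1/2)"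
    by (intro add_right_mono mult_right_mono e1) simp
  also have "\<dots> = ennreal ((measure M (S0 True) + 1/4) / 2 + measure M (S0 False) / 2)"
  proof -
    have half: "ennreal x * ennreal (1/2) = ennreal (x / 2)" if "0 \<le> x" for x
      using that by (subst ennreal_mult[symmetric]) auto
    have "0 \<le> measure M (S0 True) + 1/4" by (simp add: add_nonneg_nonneg)
    from half[OF this] half[OF measure_nonneg[of M "S0 False"]] show ?thesis
      by (simp only:) (subst ennreal_plus[symmetric], auto)
  qed
  also have "\<dots> \<le> ennreal (5/8)" 
  proof (rule ennreal_leI)
    have "(x + 1/4) / 2 + y / 2 \<le> 5/8" if "x + y \<le> 1" for x y :: real
      using that by (simp add: field_simps)
    from this[OF sum1] show "(measure M (S0 True) + 1/4) / 2 + measure M (S0 False) / 2 \<le> 5/8" .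
  qed
  finally have "measure (test_space d M) ?succ \<le> 5/8"
    unfolding measure_def by (intro enn2real_leI) auto
  moreover have "2/3 \<le> measure (test_space d M) ?succ"
    using solves succm valid_stubborn_oracle unfolding solves_test_def orc_def by blast
  ultimately show False by simp
qed

end

section \<open>Uninformative queries\<close>

text \<open>The tolerance involves the mean \<open>p\<close> under the alternative, but
  \<open>query_gap\<close> needs one in terms of the null mean. If the gap \<open>a\<close> exceeds
  the tolerance, then \<open>p * (1 - p)\<close> and, because of \<open>a > 1 / m\<close>, also
  \<open>a\<close> are below \<open>m * a\<^sup>2\<close>. Since the Bernoulli variance is
  1-Lipschitz in the mean, \<open>p0 * (1 - p0) \<le> 2 * m * a\<^sup>2\<close>.\<close>

lemma vstat_answer_failure:
  assumes m: "1 \<le> m" and p: "0 \<le> p" "p \<le> 1" and p0: "0 \<le> p0" "p0 \<le> (1::real)"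
    and fail: "max (1 / real m) (sqrt (p * (1 - p) / real m)) < \<bar>p0 - p\<bar>"
  shows "max (1 / real m) (sqrt (p0 * (1 - p0) / (2 * real m))) \<le> \<bar>p0 - p\<bar>"
proof -
  define a where "a = \<bar>p0 - p\<bar>"
  have m0: "0 < real m" using m by simp
  have a: "1 / real m < a" "sqrt (p * (1 - p) / real m) < a" using fail by (auto simp: a_def)
  have a0: "0 < a" using a(1) m0 by (smt (verit) divide_pos_pos)
  have "p * (1 - p) / real m < a\<^sup>2"
    using a(2) a0 by (meson not_le real_le_rsqrt less_imp_le real_sqrt_less_iff sqrt_le_D linorder_not_less)
  then have 1: "p * (1 - p) < real m * a\<^sup>2" using m0 by (simp add: field_simps)
  have "a < real m * a\<^sup>2"
  proof -
    have "1 < real m * a" using a(1) m0 by (simp add: field_simps)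
    then have "1 * a < real m * a * a" using a0 by (intro mult_strict_right_mono) auto
    then show ?thesis by (simp add: power2_eq_square mult.assoc)
  qed
  moreover have "p0 * (1 - p0) \<le> p * (1 - p) + a"
  proof -
    have "p0 * (1 - p0) - p * (1 - p) = (p0 - p) * (1 - p0 - p)" by (simp add: algebra_simps)
    also have "\<dots> \<le> \<bar>(p0 - p) * (1 - p0 - p)\<bar>" by simp
    also have "\<dots> \<le> a * 1" unfolding abs_mult a_def using p p0 by (intro mult_left_mono) auto
    finally show ?thesis by simp
  qed
  ultimately have "p0 * (1 - p0) \<le> 2 * real m * a\<^sup>2" using 1 by linarith
  then have "p0 * (1 - p0) / (2 * real m) \<le> a\<^sup>2" using m0 by (simp add: field_simps)
  then have "sqrt (p0 * (1 - p0) / (2 * real m)) \<le> a" using a0 by (intro real_le_lsqrt) auto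
  then show ?thesis using a(1) by (simp add: a_def)
qed

context lattice_noise
begin

text \<open>For small \<open>\<rho>\<close> the lattice Gaussian is much wider than the noise, so
  observing it shrinks the noise variance by a factor of at least
  \<open>sd\<^sup>2 \<ge> 3/4\<close> only.\<close>

lemma posterior_variance:
  assumes \<rho>: "\<rho> \<le> 1/2" and \<tau>: "0 < \<tau>" "\<tau>\<^sup>2 = \<rho>\<^sup>2 * a" "a \<le> 1"
  shows "3/4 * (\<rho>\<^sup>2 / s\<^sup>2 * a) \<le> sd\<^sup>2 * \<tau>\<^sup>2 / (sd\<^sup>2 + \<tau>\<^sup>2) / s\<^sup>2"
proof -
  have r: "\<rho>\<^sup>2 \<le> 1/4" using power_mono[OF \<rho>, of 2] rho by (simp add: power_divide)
  then have sd34: "3/4 \<le> sd\<^sup>2" by (simp add: sd(2))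
  have le1: "sd\<^sup>2 + \<tau>\<^sup>2 \<le> 1" using \<tau> rho2 mult_left_mono[of a 1 "\<rho>\<^sup>2"] by (simp add: sd(2))
  have "3/4 * \<tau>\<^sup>2 \<le> sd\<^sup>2 * \<tau>\<^sup>2" using sd34 by (intro mult_right_mono) auto
  also have "\<dots> \<le> sd\<^sup>2 * \<tau>\<^sup>2 / (sd\<^sup>2 + \<tau>\<^sup>2)"
    using le1 \<tau>(1) sd(1) by (simp add: le_divide_eq add_pos_pos mult_left_le)
  finally have "3/4 * \<tau>\<^sup>2 / s\<^sup>2 \<le> sd\<^sup>2 * \<tau>\<^sup>2 / (sd\<^sup>2 + \<tau>\<^sup>2) / s\<^sup>2" by (rule divide_right_mono) simp
  then show ?thesis by (simp add: \<tau>(2))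
qed

text \<open>The noise variance in units of the squared lattice spacing, which governs how invisible
  the lattice is.\<close>

definition \<Lambda> :: real where "\<Lambda> = \<rho>\<^sup>2 / s\<^sup>2"

text \<open>The bound of \<open>theta_bounds\<close> at variance \<open>\<Lambda> / 4\<close>. The
  quarter leaves room for the variance lost to the posterior and to the common part of two
  correlated responses.\<close>

definition theta_error :: real where "theta_error = 4 * exp (- \<Lambda> / 32)"

lemma theta_near:
  assumes "4 \<le> \<Lambda>" "\<Lambda> / 4 \<le> V"
  shows "theta V x \<le> 1 + ennreal theta_error" "1 \<le> theta V x + ennreal theta_error"
proof -
  have V: "1 \<le> V" using assms by linarith
  have "4 * exp (- V / 8) \<le> theta_error" using assms by (simp add: theta_error_def)
  then have e: "ennreal (4 * exp (- V / 8)) \<le> ennreal theta_error" by (rule ennreal_leI)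
  show "theta V x \<le> 1 + ennreal theta_error"
    by (rule order_trans[OF theta_bounds(1)[OF V] add_left_mono[OF e]])
  show "1 \<le> theta V x + ennreal theta_error"
    by (rule order_trans[OF theta_bounds(2)[OF V] add_left_mono[OF e]])
qed

lemma theta_marginal:
  assumes "\<rho> \<le> 1/2" "4 \<le> \<Lambda>"
  shows "1 \<le> theta (sd\<^sup>2 * \<rho>\<^sup>2 / s\<^sup>2) x + ennreal theta_error" "1 \<le> theta (sd\<^sup>2 / s\<^sup>2) x + ennreal theta_error"
proof -
  have r: "\<rho>\<^sup>2 \<le> 1/4" using power_mono[OF assms(1), of 2] rho by (simp add: power_divide)
  have 1: "\<Lambda> / 4 \<le> sd\<^sup>2 * \<rho>\<^sup>2 / s\<^sup>2"
  proof -
    have "1/4 * \<Lambda> \<le> sd\<^sup>2 * \<Lambda>" using r by (intro mult_right_mono) (auto simp: sd(2) \<Lambda>_def)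
    then show ?thesis by (simp add: \<Lambda>_def)
  qed
  also have "sd\<^sup>2 * \<rho>\<^sup>2 / s\<^sup>2 \<le> sd\<^sup>2 / s\<^sup>2"
    using rho2 by (intro divide_right_mono mult_left_le) auto
  finally have 2: "\<Lambda> / 4 \<le> sd\<^sup>2 / s\<^sup>2" .
  show "1 \<le> theta (sd\<^sup>2 * \<rho>\<^sup>2 / s\<^sup>2) x + ennreal theta_error" by (rule theta_near(2)[OF assms(2) 1])
  show "1 \<le> theta (sd\<^sup>2 / s\<^sup>2) x + ennreal theta_error" by (rule theta_near(2)[OF assms(2) 2])
qed

text \<open>Since \<open>\<bar>c\<bar> \<le> 1/2\<close>, at least half of the noise variance is not
  shared and the theta functions are close to 1. With
  \<open>x = \<rho>\<^sup>2 * \<tau> \<le> 1/8\<close>, the lattice costs a factor of at most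
  \<open>1 + x\<close> and the Gaussian model at most \<open>1 / (1 - x)\<close>; the product is at
  most \<open>1 + 3 * x\<close>.\<close>

lemma correlation_near:
  assumes \<rho>: "\<rho> \<le> 1/2" and snr: "4 \<le> \<Lambda>" and \<delta>: "theta_error \<le> 1/10"
    and r: "0 \<le> r" "r < 1" and v: "dot d v v = 1" and u: "dot d u u = 1"
    and \<tau>: "\<tau> \<le> 1/2" and t: "\<bar>dot d v u\<bar> \<le> \<tau>" and small: "7 * theta_error \<le> \<rho>\<^sup>2 * \<tau>"
  shows "correlation d r v u \<le> ennreal (1 + 3 * (\<rho>\<^sup>2 * \<tau>))"
proof -
  define \<delta> where "\<delta> = theta_error"
  have d0: "0 \<le> \<delta>" by (simp add: \<delta>_def theta_error_def)
  define c where "c = r\<^sup>2 * dot d v u"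
  have r2: "0 \<le> r\<^sup>2" "r\<^sup>2 \<le> 1" using r by (auto simp: power_le_one)
  have c: "\<bar>c\<bar> \<le> \<tau>"
  proof -
    have "\<bar>c\<bar> \<le> 1 * \<bar>dot d v u\<bar>" unfolding c_def abs_mult using r2 by (intro mult_right_mono) auto
    then show ?thesis using t by simp
  qed
  have c1: "\<bar>c\<bar> < 1" using c \<tau> by linarith
  have rr: "\<rho>\<^sup>2 \<le> 1/4" using power_mono[OF \<rho>, of 2] rho by (simp add: power_divide)
  define t' where "t' = \<rho> * sqrt (1 - \<bar>c\<bar>)"
  have t': "0 < t'" "t'\<^sup>2 = \<rho>\<^sup>2 * (1 - \<bar>c\<bar>)" using rho c1 by (auto simp: t'_def power_mult_distrib)
  have V: "\<Lambda> / 4 \<le> sd\<^sup>2 * t'\<^sup>2 / (sd\<^sup>2 + t'\<^sup>2) / s\<^sup>2"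
  proof -
    have "\<Lambda> * (1/2) \<le> \<Lambda> * (1 - \<bar>c\<bar>)" using c \<tau> snr by (intro mult_left_mono) auto
    then have "\<Lambda> / 4 \<le> 3/4 * (\<Lambda> * (1 - \<bar>c\<bar>))" using snr by simp
    also have "\<dots> \<le> sd\<^sup>2 * t'\<^sup>2 / (sd\<^sup>2 + t'\<^sup>2) / s\<^sup>2"
      unfolding \<Lambda>_def by (rule posterior_variance[OF \<rho> t']) simp
    finally show ?thesis .
  qed
  have "correlation d r v u \<le> ennreal (((1 + \<delta>) / (1 - \<delta>))\<^sup>2 / (1 - \<rho>\<^sup>2 * c))"
    using \<delta> d0 unfolding \<delta>_def
    by (intro correlation_le[OF r v u c_def c1 t'_def] theta_near(1)[OF snr V] theta_marginal[OF \<rho> snr]) auto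
  also have "\<dots> \<le> ennreal (1 + 3 * (\<rho>\<^sup>2 * \<tau>))"
  proof (rule ennreal_leI)
    define x where "x = \<rho>\<^sup>2 * \<tau>"
    have x: "0 \<le> x" "x \<le> 1/8"
      using rr \<tau> t mult_mono[OF rr \<tau>] by (auto simp: x_def)
    have xc: "\<rho>\<^sup>2 * c \<le> x" unfolding x_def using c by (intro mult_left_mono) auto
    have "(1 + \<delta>) / (1 - \<delta>) \<le> 1 + 5/2 * \<delta>"
    proof -
      have "5 * \<delta> * \<delta> \<le> 5 * \<delta> * (1/10)" using \<delta> d0 unfolding \<delta>_def by (intro mult_left_mono) auto
      then have "1 + \<delta> \<le> (1 + 5/2 * \<delta>) * (1 - \<delta>)" using d0 by (simp add: algebra_simps)
      then show ?thesis using \<delta> by (simp add: divide_le_eq \<delta>_def)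
    qed
    then have "((1 + \<delta>) / (1 - \<delta>))\<^sup>2 \<le> (1 + 5/2 * \<delta>)\<^sup>2"
      using d0 \<delta> by (intro power_mono) (auto simp: \<delta>_def)
    also have "\<dots> \<le> 1 + 6 * \<delta>"
    proof -
      have "25 * \<delta> * \<delta> \<le> 25 * \<delta> * (1/10)" using \<delta> d0 unfolding \<delta>_def by (intro mult_left_mono) auto
      then show ?thesis using d0 by (simp add: power2_eq_square algebra_simps)
    qed
    also have "\<dots> \<le> 1 + x" using small d0 by (simp add: x_def \<delta>_def)
    finally have 1: "((1 + \<delta>) / (1 - \<delta>))\<^sup>2 \<le> 1 + x" .
    have 2: "1 / (1 - \<rho>\<^sup>2 * c) \<le> 1 / (1 - x)"
      using xc x by (intro divide_left_mono mult_pos_pos) auto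
    have "((1 + \<delta>) / (1 - \<delta>))\<^sup>2 / (1 - \<rho>\<^sup>2 * c) = ((1 + \<delta>) / (1 - \<delta>))\<^sup>2 * (1 / (1 - \<rho>\<^sup>2 * c))" by simp
    also have "\<dots> \<le> (1 + x) * (1 / (1 - x))"
      using 1 2 x xc by (intro mult_mono) auto
    also have "\<dots> \<le> 1 + 3 * x"
    proof -
      have "3 * x * x \<le> 3 * x * (1/8)" using x by (intro mult_left_mono) auto
      then have "1 + x \<le> (1 + 3 * x) * (1 - x)" using x by (simp add: algebra_simps)
      then show ?thesis using x by (simp add: divide_le_eq)
    qed
    finally show "((1 + \<delta>) / (1 - \<delta>))\<^sup>2 / (1 - \<rho>\<^sup>2 * c) \<le> 1 + 3 * (\<rho>\<^sup>2 * \<tau>)" by (simp add: x_def)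
  qed
  finally show ?thesis .
qed

text \<open>When the responses share nearly all their noise, only the crude bound on
  \<open>theta\<close> is left, with deviation at most
  \<open>D = 1 / sqrt (1 - \<bar>c\<bar>)\<close>. It enters squared, whence the singularity
  \<open>1 / (1 - \<bar>c\<bar>)\<close>. Passing from \<open>c\<close> to \<open>dot d v u\<close>
  makes the bound uniform in \<open>r\<close>; the constant is
  \<open>400/81 * 4/3 < 7\<close>.\<close>

lemma correlation_far:
  assumes \<rho>: "\<rho> \<le> 1/2" and snr: "4 \<le> \<Lambda>" and \<delta>: "theta_error \<le> 1/10"
    and r: "0 \<le> r" "r < 1" and v: "dot d v v = 1" and u: "dot d u u = 1"
  shows "correlation d r v u \<le> ennreal 7 * inverse (ennreal (1 - \<bar>dot d v u\<bar>))"
proof (cases "\<bar>dot d v u\<bar> = 1")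
  case True
  then show ?thesis by (simp add: ennreal_mult_top)
next
  case False
  with abs_dot_le_one[OF v u] have t: "\<bar>dot d v u\<bar> < 1" by simp
  define \<delta> where "\<delta> = theta_error"
  have d0: "0 \<le> \<delta>" "\<delta> \<le> 1/10" using \<delta> by (auto simp: \<delta>_def theta_error_def)
  define c where "c = r\<^sup>2 * dot d v u"
  have r2: "0 \<le> r\<^sup>2" "r\<^sup>2 \<le> 1" using r by (auto simp: power_le_one)
  have c: "\<bar>c\<bar> \<le> \<bar>dot d v u\<bar>"
  proof -
    have "\<bar>c\<bar> \<le> 1 * \<bar>dot d v u\<bar>" unfolding c_def abs_mult using r2 by (intro mult_right_mono) auto
    then show ?thesis by simp
  qed
  have c1: "\<bar>c\<bar> < 1" using c t by linarith
  have rr: "\<rho>\<^sup>2 \<le> 1/4" using power_mono[OF \<rho>, of 2] rho by (simp add: power_divide)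
  define t' where "t' = \<rho> * sqrt (1 - \<bar>c\<bar>)"
  have t': "0 < t'" "t'\<^sup>2 = \<rho>\<^sup>2 * (1 - \<bar>c\<bar>)" using rho c1 by (auto simp: t'_def power_mult_distrib)
  define D where "D = 1 / sqrt (1 - \<bar>c\<bar>)"
  have D: "1 \<le> D" "D\<^sup>2 = 1 / (1 - \<bar>c\<bar>)" using c1 by (auto simp: D_def power_divide)
  let ?V = "sd\<^sup>2 * t'\<^sup>2 / (sd\<^sup>2 + t'\<^sup>2) / s\<^sup>2"
  have V: "1 - \<bar>c\<bar> \<le> ?V"
  proof -
    have "(4/3) * (1 - \<bar>c\<bar>) \<le> \<Lambda> * (1 - \<bar>c\<bar>)" using c1 snr by (intro mult_right_mono) auto
    then have "1 - \<bar>c\<bar> \<le> 3/4 * (\<Lambda> * (1 - \<bar>c\<bar>))" by simp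
    also have "\<dots> \<le> ?V"
      unfolding \<Lambda>_def by (rule posterior_variance[OF \<rho> t']) simp
    finally show ?thesis .
  qed
  have thD: "theta ?V x \<le> 1 + ennreal D" for x
  proof -
    have V0: "0 < ?V" using V c1 by linarith
    have "1 / sqrt ?V \<le> D"
      unfolding D_def using V V0 c1 by (intro divide_left_mono mult_pos_pos real_sqrt_le_mono) auto
    then have "1 + ennreal (1 / sqrt ?V) \<le> 1 + ennreal D" by (intro add_left_mono ennreal_leI)
    then show ?thesis using theta_crude(1)[OF V0, of x] by (rule order_trans[rotated])
  qed
  have "correlation d r v u \<le> ennreal (((1 + D) / (1 - \<delta>))\<^sup>2 / (1 - \<rho>\<^sup>2 * c))"
    using d0 D unfolding \<delta>_def
    by (intro correlation_le[OF r v u c_def c1 t'_def] thD theta_marginal[OF \<rho> snr]) auto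
  also have "\<dots> \<le> ennreal (7 * (1 / (1 - \<bar>dot d v u\<bar>)))"
  proof (rule ennreal_leI)
    have "(1 + D) / (1 - \<delta>) \<le> (2 * D) / (9/10)" using D d0 by (intro frac_le) auto
    then have "((1 + D) / (1 - \<delta>))\<^sup>2 \<le> ((2 * D) / (9/10))\<^sup>2" using D d0 by (intro power_mono) auto
    also have "\<dots> = 400/81 * D\<^sup>2" by (simp add: power2_eq_square)
    finally have 1: "((1 + D) / (1 - \<delta>))\<^sup>2 \<le> 400/81 * D\<^sup>2" .
    have "\<rho>\<^sup>2 * c \<le> 1/4 * 1"
    proof -
      have "\<rho>\<^sup>2 * c \<le> \<rho>\<^sup>2 * 1" using c1 by (intro mult_left_mono) auto
      then show ?thesis using rr by simp
    qed
    then have 2: "1 / (1 - \<rho>\<^sup>2 * c) \<le> 4/3" "0 \<le> 1 / (1 - \<rho>\<^sup>2 * c)" by (auto simp: divide_le_eq)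
    have "((1 + D) / (1 - \<delta>))\<^sup>2 / (1 - \<rho>\<^sup>2 * c) = ((1 + D) / (1 - \<delta>))\<^sup>2 * (1 / (1 - \<rho>\<^sup>2 * c))" by simp
    also have "\<dots> \<le> (400/81 * D\<^sup>2) * (4/3)" by (rule mult_mono[OF 1 2(1)]) (use 2 in auto)
    also have "\<dots> \<le> 7 * D\<^sup>2" by simp
    also have "\<dots> \<le> 7 * (1 / (1 - \<bar>dot d v u\<bar>))"
      unfolding D(2) using c t by (intro mult_left_mono divide_left_mono mult_pos_pos) auto
    finally show "((1 + D) / (1 - \<delta>))\<^sup>2 / (1 - \<rho>\<^sup>2 * c) \<le> 7 * (1 / (1 - \<bar>dot d v u\<bar>))" .
  qed
  also have "\<dots> = ennreal 7 * inverse (ennreal (1 - \<bar>dot d v u\<bar>))"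
    using t by (subst ennreal_mult) (auto simp: inverse_ennreal inverse_eq_divide)
  finally show ?thesis .
qed

text \<open>Far pairs are bounded with the restriction of \<open>u\<close> to \<open>V\<close>
  dropped. Their contribution is therefore linear instead of quadratic in the measure of
  \<open>V\<close>, but exponentially small; its factor is
  \<open>7 * 400002 < 3000000\<close>.\<close>

lemma correlation_average:
  assumes \<rho>: "\<rho> \<le> 1/2" and snr: "4 \<le> \<Lambda>" and \<delta>: "theta_error \<le> 1/10"
    and \<tau>: "0 \<le> \<tau>" "\<tau> \<le> 1/2" and small: "7 * theta_error \<le> \<rho>\<^sup>2 * \<tau>" and d: "11 \<le> d"
    and V [measurable]: "V \<in> sets (vec_space d)" and r: "0 \<le> r" "r < 1"
  shows "(\<integral>\<^sup>+v. indicator V v * (\<integral>\<^sup>+u. indicator V u * correlation d r v u \<partial>uniform_sphere d) \<partial>uniform_sphere d) \<le>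
    ennreal ((1 + 3 * (\<rho>\<^sup>2 * \<tau>)) * (measure (uniform_sphere d) V)\<^sup>2 +
      3000000 * exp (- real d * \<tau>\<^sup>2 / 16) * measure (uniform_sphere d) V)"
proof -
  interpret U: prob_space "uniform_sphere d" by (rule prob_space_uniform_sphere)
  have d0: "0 < d" using d by simp
  define w where "w = measure (uniform_sphere d) V"
  define e where "e = exp (- real d * \<tau>\<^sup>2 / 16)"
  let ?K = "ennreal (1 + 3 * (\<rho>\<^sup>2 * \<tau>))"
  let ?Y = "\<lambda>v u. inverse (ennreal (1 - \<bar>dot d v u\<bar>)) * indicator {u. \<tau> < \<bar>dot d v u\<bar>} u"
  have inner: "(\<integral>\<^sup>+u. indicator V u * correlation d r v u \<partial>uniform_sphere d) \<le> ennreal ((1 + 3 * (\<rho>\<^sup>2 * \<tau>)) * w + 3000000 * e)"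
    if "v \<in> unit_sphere d" for v
  proof -
    have v: "dot d v v = 1" using that by (simp add: unit_sphere_def)
    have [measurable]: "(\<lambda>u. ?Y v u) \<in> borel_measurable (uniform_sphere d)"
    proof -
      have "(\<lambda>u. ?Y v u) = (\<lambda>u. inverse (ennreal (1 - \<bar>dot d v u\<bar>)) * indicator {\<tau><..} \<bar>dot d v u\<bar>)"
        by (auto simp: fun_eq_iff indicator_def)
      then show ?thesis by simp
    qed
    have "(\<integral>\<^sup>+u. indicator V u * correlation d r v u \<partial>uniform_sphere d) \<le> (\<integral>\<^sup>+u. ?K * indicator V u + ennreal 7 * ?Y v u \<partial>uniform_sphere d)"
    proof (rule nn_integral_mono_AE, rule AE_mp[OF AE_uniform_sphere_unit[OF d0]], intro AE_I2 impI)
      fix u assume "u \<in> unit_sphere d"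
      then have u: "dot d u u = 1" by (simp add: unit_sphere_def)
      show "indicator V u * correlation d r v u \<le> ?K * indicator V u + ennreal 7 * ?Y v u"
      proof (cases "\<tau> < \<bar>dot d v u\<bar>")
        case True
        have "indicator V u * correlation d r v u \<le> 1 * (ennreal 7 * ?Y v u)"
          using correlation_far[OF \<rho> snr \<delta> r v u] True by (intro mult_mono) (auto simp: indicator_def)
        then show ?thesis by (simp add: add_increasing)
      next
        case False
        then have "correlation d r v u \<le> ?K"
          by (intro correlation_near[OF \<rho> snr \<delta> r v u \<tau>(2) _ small]) simp
        then show ?thesis by (auto simp: indicator_def add_increasing2)
      qed
    qed
    also have "\<dots> = ?K * emeasure (uniform_sphere d) V + ennreal 7 * (\<integral>\<^sup>+u. ?Y v u \<partial>uniform_sphere d)"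
      by (subst nn_integral_add) (auto simp: nn_integral_cmult)
    also have "\<dots> \<le> ?K * ennreal w + ennreal 7 * ennreal (400002 * e)"
      using uniform_sphere_tail[OF v d, of \<tau>] \<tau>
      by (intro add_mono mult_left_mono) (auto simp: w_def e_def U.emeasure_eq_measure)
    also have "\<dots> = ennreal ((1 + 3 * (\<rho>\<^sup>2 * \<tau>)) * w + 7 * (400002 * e))"
    proof -
      have "?K * ennreal w = ennreal ((1 + 3 * (\<rho>\<^sup>2 * \<tau>)) * w)" "ennreal 7 * ennreal (400002 * e) = ennreal (7 * (400002 * e))"
        using \<tau> by (subst ennreal_mult[symmetric]; simp add: w_def e_def)+
      then show ?thesis using \<tau> by (simp only:) (subst ennreal_plus[symmetric], auto simp: w_def e_def)
    qed
    also have "\<dots> \<le> ennreal ((1 + 3 * (\<rho>\<^sup>2 * \<tau>)) * w + 3000000 * e)"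
      by (intro ennreal_leI) (simp add: e_def)
    finally show ?thesis .
  qed
  have "(\<integral>\<^sup>+v. indicator V v * (\<integral>\<^sup>+u. indicator V u * correlation d r v u \<partial>uniform_sphere d) \<partial>uniform_sphere d) \<le>
      (\<integral>\<^sup>+v. ennreal ((1 + 3 * (\<rho>\<^sup>2 * \<tau>)) * w + 3000000 * e) * indicator V v \<partial>uniform_sphere d)"
  proof (rule nn_integral_mono_AE, rule AE_mp[OF AE_uniform_sphere_unit[OF d0]], intro AE_I2 impI)
    fix v assume "v \<in> unit_sphere d"
    from inner[OF this]
    show "indicator V v * (\<integral>\<^sup>+u. indicator V u * correlation d r v u \<partial>uniform_sphere d) \<le>
        ennreal ((1 + 3 * (\<rho>\<^sup>2 * \<tau>)) * w + 3000000 * e) * indicator V v"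
      by (cases "v \<in> V") simp_all
  qed
  also have "\<dots> = ennreal ((1 + 3 * (\<rho>\<^sup>2 * \<tau>)) * w + 3000000 * e) * ennreal w"
    by (subst nn_integral_cmult_indicator) (auto simp: w_def U.emeasure_eq_measure)
  also have "\<dots> = ennreal ((1 + 3 * (\<rho>\<^sup>2 * \<tau>)) * w\<^sup>2 + 3000000 * e * w)"
  proof -
    have "0 \<le> (1 + 3 * (\<rho>\<^sup>2 * \<tau>)) * w + 3000000 * e" "0 \<le> w"
      using \<tau> by (auto intro!: add_nonneg_nonneg mult_nonneg_nonneg simp: w_def e_def)
    from ennreal_mult[OF this, symmetric] show ?thesis by (simp add: power2_eq_square algebra_simps)
  qed
  finally show ?thesis by (simp add: w_def e_def)
qed

text \<open>With \<open>\<eta> = 3 * \<rho>\<^sup>2 * \<tau>\<close> the condition on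
  \<open>m\<close> reads \<open>2 * \<eta> \<le> 1 / (2 * m)\<close>, which is what
  \<open>query_gap\<close> asks of the tolerance from \<open>vstat_answer_failure\<close>. Upward
  and downward gaps are treated separately, each costing \<open>\<xi> / \<eta>\<close>.\<close>

lemma query_uninformative:
  assumes \<rho>: "\<rho> \<le> 1/2" and snr: "4 \<le> \<Lambda>" and \<delta>: "theta_error \<le> 1/10"
    and \<tau>: "0 < \<tau>" "\<tau> \<le> 1/2" and small: "7 * theta_error \<le> \<rho>\<^sup>2 * \<tau>" and d: "11 \<le> d"
    and q: "valid_query d (f, m)" and acc: "12 * (\<rho>\<^sup>2 * \<tau>) * real m \<le> 1"
  shows "measure (uniform_sphere d) {v \<in> space (vec_space d). \<not> vstat_answer (alt_dist d \<rho> E v) (f, m) (integral\<^sup>L (null_dist d \<rho> E) f)}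
    \<le> 2000000 * exp (- real d * \<tau>\<^sup>2 / 16) / (\<rho>\<^sup>2 * \<tau>)"
proof -
  interpret U: prob_space "uniform_sphere d" by (rule prob_space_uniform_sphere)
  interpret N: prob_space "null_dist d \<rho> E" by (rule prob_space_null)
  interpret gv: prob_space "gaussian_vec d" by (rule prob_space_gaussian_vec)
  interpret P: pair_prob_space "gaussian_vec d" E by unfold_locales
  have fm [measurable]: "f \<in> borel_measurable (point_space d)" and f: "\<And>p. p \<in> space (point_space d) \<Longrightarrow> 0 \<le> f p \<and> f p \<le> 1"
    and m: "1 \<le> m" using q by (auto simp: valid_query_def)
  have d0: "0 < d" using d by simp
  define p0 where "p0 = integral\<^sup>L (null_dist d \<rho> E) f"
  define p where "p v = integral\<^sup>L (alt_dist d \<rho> E v) f" for v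
  have fN: "integrable (null_dist d \<rho> E) f" using f by (intro N.integrable_const_bound[of _ 1]) (auto simp: space_null)
  have p01: "0 \<le> p0" "p0 \<le> 1"
    unfolding p0_def using f fN by (auto simp: space_null intro!: Bochner_Integration.integral_nonneg N.integral_le_const)
  have fQ: "integrable (alt_dist d \<rho> E v) f" and pv: "0 \<le> p v" "p v \<le> 1" and p_compl: "integral\<^sup>L (alt_dist d \<rho> E v) (\<lambda>x. 1 - f x) = 1 - p v" for v
  proof -
    interpret Q: prob_space "alt_dist d \<rho> E v" by (rule prob_space_alt)
    show i: "integrable (alt_dist d \<rho> E v) f" using f by (intro Q.integrable_const_bound[of _ 1]) (auto simp: space_alt)
    show "0 \<le> p v" "p v \<le> 1"
      unfolding p_def using f i by (auto simp: space_alt intro!: Bochner_Integration.integral_nonneg Q.integral_le_const)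
    show "integral\<^sup>L (alt_dist d \<rho> E v) (\<lambda>x. 1 - f x) = 1 - p v"
      using i by (simp add: p_def Q.prob_space)
  qed
  have pm [measurable]: "p \<in> borel_measurable (vec_space d)"
    unfolding p_def integral_alt[OF fm] by (rule P.borel_measurable_lebesgue_integral) measurable
  define t where "t = max (1 / real m) (sqrt (p0 * (1 - p0) / (2 * real m)))"
  have t0: "0 < t" using m by (simp add: t_def less_max_iff_disj)
  define \<eta> where "\<eta> = 3 * (\<rho>\<^sup>2 * \<tau>)"
  have \<eta>: "0 < \<eta>" using \<tau> rho2 by (simp add: \<eta>_def)
  have t2: "2 * \<eta> * (p0 * (1 - p0)) \<le> t\<^sup>2"
  proof -
    have "2 * \<eta> \<le> 1 / (2 * real m)" using acc m by (simp add: \<eta>_def field_simps)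
    then have "2 * \<eta> * (p0 * (1 - p0)) \<le> 1 / (2 * real m) * (p0 * (1 - p0))"
      using p01 by (intro mult_right_mono) auto
    also have "\<dots> = (sqrt (p0 * (1 - p0) / (2 * real m)))\<^sup>2" using p01 by simp
    also have "\<dots> \<le> t\<^sup>2" using p01 by (intro power_mono) (auto simp: t_def)
    finally show ?thesis .
  qed
  define \<xi> where "\<xi> = 3000000 * exp (- real d * \<tau>\<^sup>2 / 16)"
  have \<xi>: "0 \<le> \<xi>" by (simp add: \<xi>_def)
  note corr = correlation_average[OF \<rho> snr \<delta> less_imp_le[OF \<tau>(1)] \<tau>(2) small d, folded \<eta>_def \<xi>_def]
  define V1 where "V1 = {v \<in> space (vec_space d). p0 + t \<le> p v}"
  define V2 where "V2 = {v \<in> space (vec_space d). p v + t \<le> p0}"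
  have [measurable]: "V1 \<in> sets (vec_space d)" "V2 \<in> sets (vec_space d)"
    unfolding V1_def V2_def by (intro borel_measurable_le borel_measurable_add borel_measurable_const pm)+
  have "measure (uniform_sphere d) V1 \<le> \<xi> / \<eta>"
  proof (rule query_gap[OF d0 corr \<eta> \<xi> fm f p0_def t0 t2])
    show "p0 + t \<le> integral\<^sup>L (alt_dist d \<rho> E v) f" if "v \<in> V1" for v
      using that by (simp add: V1_def p_def)
  qed auto
  moreover have "measure (uniform_sphere d) V2 \<le> \<xi> / \<eta>"
  \<comment> \<open>A downward gap of \<open>f\<close> is an upward gap of \<open>1 - f\<close>, and
    the Bernoulli variance is the same.\<close>
  proof (rule query_gap[OF d0 corr \<eta> \<xi>, where f = "\<lambda>x. 1 - f x" and ?p0.0 = "1 - p0" and \<tau> = t])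
    show "1 - p0 = integral\<^sup>L (null_dist d \<rho> E) (\<lambda>x. 1 - f x)" using fN by (simp add: p0_def N.prob_space)
    show "2 * \<eta> * ((1 - p0) * (1 - (1 - p0))) \<le> t\<^sup>2" using t2 by (simp add: mult.commute)
    show "1 - p0 + t \<le> integral\<^sup>L (alt_dist d \<rho> E v) (\<lambda>x. 1 - f x)" if "v \<in> V2" for v
      using that unfolding p_compl by (simp add: V2_def)
  qed (use f t0 in auto)
  moreover have "{v \<in> space (vec_space d). \<not> vstat_answer (alt_dist d \<rho> E v) (f, m) p0} \<subseteq> V1 \<union> V2"
  proof
    fix v assume v: "v \<in> {v \<in> space (vec_space d). \<not> vstat_answer (alt_dist d \<rho> E v) (f, m) p0}"
    then have "max (1 / real m) (sqrt (p v * (1 - p v) / real m)) < \<bar>p0 - p v\<bar>"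
      by (auto simp: vstat_answer_def Let_def p_def[symmetric])
    then have "t \<le> \<bar>p0 - p v\<bar>" unfolding t_def by (rule vstat_answer_failure[OF m pv p01])
    then show "v \<in> V1 \<union> V2" using v by (auto simp: V1_def V2_def abs_if split: if_splits)
  qed
  then have "measure (uniform_sphere d) {v \<in> space (vec_space d). \<not> vstat_answer (alt_dist d \<rho> E v) (f, m) p0} \<le> measure (uniform_sphere d) (V1 \<union> V2)"
    by (intro U.finite_measure_mono) auto
  moreover have "measure (uniform_sphere d) (V1 \<union> V2) \<le> measure (uniform_sphere d) V1 + measure (uniform_sphere d) V2"
    by (intro measure_Un_le) auto
  ultimately have "measure (uniform_sphere d) {v \<in> space (vec_space d). \<not> vstat_answer (alt_dist d \<rho> E v) (f, m) p0} \<le> \<xi> / \<eta> + \<xi> / \<eta>"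
    by linarith
  also have "\<dots> = 2000000 * exp (- real d * \<tau>\<^sup>2 / 16) / (\<rho>\<^sup>2 * \<tau>)"
    by (simp add: \<xi>_def \<eta>_def)
  finally show ?thesis by (simp add: p0_def)
qed

end

section \<open>The lower bound\<close>

lemma lattice_spacing_large:
  fixes b c :: real
  assumes "0 < b" "0 < c"
  shows "\<forall>\<^sub>F L in at_top. 28 * exp (- (b * L\<^sup>2) / 32) \<le> c * exp (- 2 * L)"
  using assms by real_asymp

text \<open>The three terms in the exponent come from the number of queries, from the lower bound on
  \<open>\<rho>\<^sup>2 * \<tau>\<close> in the denominator, and from the tail of the inner product
  of two random directions.\<close>

lemma union_bound_small:
  fixes c :: real
  assumes "0 < c"
  shows "\<forall>\<^sub>F L in at_top. 2000000 / c * exp (L ^ 3 + 2 * L - L ^ 4 / 16) \<le> 1 / 4"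
  using assms by real_asymp

text \<open>The lower bound on \<alpha> makes \<open>L\<close> at most
  \<open>ln d + ln d ^ (a + 1)\<close>. That \<open>L\<^sup>2 / sqrt d\<close> is then at most 1/2
  is the only place where \<alpha> must not be too small.\<close>

lemma polylog_dimension:
  "\<forall>\<^sub>F d::nat in sequentially. 2 * (ln (real d) + ln (real d) ^ (a + 1))\<^sup>2 \<le> sqrt (real d)"
proof -
  have 1: "\<forall>\<^sub>F x::real in at_top. ln x ^ (2 * a + 2) / sqrt x < 1 / 8"
    by (rule order_tendstoD(2)[of _ 0]) (real_asymp, simp)
  have 2: "\<forall>\<^sub>F x::real in at_top. 1 \<le> ln x" by real_asymp
  have "\<forall>\<^sub>F x::real in at_top. 2 * (ln x + ln x ^ (a + 1))\<^sup>2 \<le> sqrt x"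
    using 1 2 eventually_gt_at_top[of 0]
  proof eventually_elim
    case (elim x)
    have "ln x ^ 1 \<le> ln x ^ (a + 1)" using elim(2) by (intro power_increasing) auto
    then have "(ln x + ln x ^ (a + 1))\<^sup>2 \<le> (2 * ln x ^ (a + 1))\<^sup>2" using elim(2) by (intro power_mono) auto
    also have "\<dots> = 4 * (ln x ^ (a + 1))\<^sup>2" by (simp only: power_mult_distrib) simp
    also have "\<dots> = 4 * ln x ^ ((a + 1) * 2)" by (simp only: power_mult)
    also have "(a + 1) * 2 = 2 * a + 2" by simp
    finally have "2 * (ln x + ln x ^ (a + 1))\<^sup>2 \<le> 8 * ln x ^ (2 * a + 2)" by simp
    also have "\<dots> \<le> sqrt x" using elim(1,3) by (simp add: divide_less_eq)
    finally show ?case .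
  qed
  from eventually_compose_filterlim[OF this filterlim_real_sequentially] show ?thesis .
qed

text \<open>As \<alpha> varies freely with \<open>d\<close>, the conditions are required for all
  \<open>L \<ge> ln d\<close> at once; only the last one needs an upper bound on
  \<open>L\<close>.\<close>

lemma large_dimension:
  fixes c\<^sub>1 c\<^sub>2 \<kappa>' :: real and a :: nat
  assumes "0 < c\<^sub>1" "0 < \<kappa>'"
  obtains d\<^sub>0 where
    "\<And>d L. d\<^sub>0 \<le> d \<Longrightarrow> ln (real d) \<le> L \<Longrightarrow>
      11 \<le> d \<and> 1 \<le> L \<and> 25 / c\<^sub>1 \<le> L \<and> 12 * 3 * c\<^sub>2 \<le> L \<and> 256 \<le> c\<^sub>1 / \<kappa>'\<^sup>2 * L\<^sup>2 \<and>
      28 * exp (- (c\<^sub>1 / \<kappa>'\<^sup>2 * L\<^sup>2) / 32) \<le> c\<^sub>1 * exp (- 2 * L) \<and>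
      2000000 / c\<^sub>1 * exp (L ^ 3 + 2 * L - L ^ 4 / 16) \<le> 1 / 4 \<and>
      (L \<le> ln (real d) + ln (real d) ^ (a + 1) \<longrightarrow> 2 * L\<^sup>2 \<le> sqrt (real d))"
proof -
  define b where "b = c\<^sub>1 / \<kappa>'\<^sup>2"
  have b: "0 < b" using assms by (simp add: b_def)
  have "\<forall>\<^sub>F L in at_top. 256 \<le> b * L\<^sup>2" using b by real_asymp
  then have "\<forall>\<^sub>F L in at_top. 1 \<le> L \<and> 25 / c\<^sub>1 \<le> L \<and> 12 * 3 * c\<^sub>2 \<le> L \<and> 256 \<le> b * L\<^sup>2 \<and>
      28 * exp (- (b * L\<^sup>2) / 32) \<le> c\<^sub>1 * exp (- 2 * L) \<and>
      2000000 / c\<^sub>1 * exp (L ^ 3 + 2 * L - L ^ 4 / 16) \<le> 1 / 4"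
    using lattice_spacing_large[OF b assms(1)] union_bound_small[OF assms(1)]
    by (intro eventually_conj eventually_ge_at_top)
  then obtain L0 where L0: "\<And>L. L0 \<le> L \<Longrightarrow> 1 \<le> L \<and> 25 / c\<^sub>1 \<le> L \<and> 12 * 3 * c\<^sub>2 \<le> L \<and> 256 \<le> b * L\<^sup>2 \<and>
      28 * exp (- (b * L\<^sup>2) / 32) \<le> c\<^sub>1 * exp (- 2 * L) \<and>
      2000000 / c\<^sub>1 * exp (L ^ 3 + 2 * L - L ^ 4 / 16) \<le> 1 / 4"
    unfolding eventually_at_top_linorder by blast
  have "\<forall>\<^sub>F d::nat in sequentially. max 0 L0 \<le> ln (real d)" by real_asymp
  with polylog_dimension[of a] eventually_ge_at_top[of 11]
  have "\<forall>\<^sub>F d::nat in sequentially. 11 \<le> d \<and> max 0 L0 \<le> ln (real d) \<and>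
      2 * (ln (real d) + ln (real d) ^ (a + 1))\<^sup>2 \<le> sqrt (real d)"
    by eventually_elim auto
  then obtain d\<^sub>0 where d0: "\<And>d. d\<^sub>0 \<le> d \<Longrightarrow> 11 \<le> d \<and> max 0 L0 \<le> ln (real d) \<and>
      2 * (ln (real d) + ln (real d) ^ (a + 1))\<^sup>2 \<le> sqrt (real d)"
    unfolding eventually_sequentially by blast
  show ?thesis
  proof (rule that[of d\<^sub>0])
    fix d :: nat and L :: real assume d: "d\<^sub>0 \<le> d" and L: "ln (real d) \<le> L"
    have "L0 \<le> L" "0 \<le> L" using d0[OF d] L by auto
    moreover have "2 * L\<^sup>2 \<le> sqrt (real d)" if "L \<le> ln (real d) + ln (real d) ^ (a + 1)"
    proof -
      have "L\<^sup>2 \<le> (ln (real d) + ln (real d) ^ (a + 1))\<^sup>2" using that \<open>0 \<le> L\<close> by (intro power_mono) auto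
      then show ?thesis using d0[OF d] by linarith
    qed
    ultimately show "11 \<le> d \<and> 1 \<le> L \<and> 25 / c\<^sub>1 \<le> L \<and> 12 * 3 * c\<^sub>2 \<le> L \<and> 256 \<le> c\<^sub>1 / \<kappa>'\<^sup>2 * L\<^sup>2 \<and>
      28 * exp (- (c\<^sub>1 / \<kappa>'\<^sup>2 * L\<^sup>2) / 32) \<le> c\<^sub>1 * exp (- 2 * L) \<and>
      2000000 / c\<^sub>1 * exp (L ^ 3 + 2 * L - L ^ 4 / 16) \<le> 1 / 4 \<and>
      (L \<le> ln (real d) + ln (real d) ^ (a + 1) \<longrightarrow> 2 * L\<^sup>2 \<le> sqrt (real d))"
      using L0[of L] d0[OF d] by (simp add: b_def)
  qed
qed

theorem theorem3p11:
  "\<exists>(k\<^sub>0::nat) (\<kappa>::real) (\<rho>\<^sub>0::real) (c::real). 0 < \<kappa> \<and> 0 < \<rho>\<^sub>0 \<and> 0 < c \<and>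
     (\<forall>k::nat. k\<^sub>0 \<le> k \<longrightarrow> (\<exists>K::nat.
       \<forall>(c\<^sub>1::real) (c\<^sub>2::real) (\<kappa>'::real) (a::nat). 0 < c\<^sub>1 \<and> c\<^sub>1 \<le> c\<^sub>2 \<and> \<kappa> \<le> \<kappa>' \<longrightarrow>
       (\<exists>d\<^sub>0::nat. \<forall>(d::nat) (\<alpha>::real) (\<rho>::real) (s::real).
          d\<^sub>0 \<le> d \<and> 0 < d \<and>
          0 < \<alpha> \<and> \<alpha> < 1 \<and> real d powr (- (ln (real d) ^ a)) \<le> \<alpha> \<and>
          0 < \<rho> \<and> \<rho> \<le> \<rho>\<^sub>0 \<and>
          c\<^sub>1 * \<alpha>\<^sup>2 * ln (real d / \<alpha>) ^ k \<le> \<rho>\<^sup>2 \<and> \<rho>\<^sup>2 \<le> c\<^sub>2 * \<alpha>\<^sup>2 * ln (real d / \<alpha>) ^ k \<and>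
          \<kappa> * \<alpha> \<le> s \<and> s \<le> \<kappa>' * \<alpha> \<longrightarrow>
          (let E = discrete_gaussian 0 (sqrt (1 - \<rho>\<^sup>2)) 0 s;
               q\<^sub>0 = real d powr ((ln (real d / \<alpha>))\<^sup>2);
               m\<^sub>0 = sqrt (real d) / (\<alpha>\<^sup>2 * ln (real d / \<alpha>) ^ K)
           in \<alpha> \<le> measure E {0} \<and>
              (\<forall>M A. sq_algorithm d M A \<and> solves_test d \<rho> E M A (2/3) \<longrightarrow>
                 (\<exists>\<tau> \<in> possible_runs d \<rho> E M A. c * q\<^sub>0 \<le> real (length \<tau>)) \<or>
                 (\<exists>\<tau> \<in> possible_runs d \<rho> E M A. \<exists>((f, m), u) \<in> set \<tau>. c * m\<^sub>0 \<le> real m))))))"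
  (is "\<exists>k\<^sub>0 \<kappa> \<rho>\<^sub>0 c. 0 < \<kappa> \<and> 0 < \<rho>\<^sub>0 \<and> 0 < c \<and> (\<forall>k. k\<^sub>0 \<le> k \<longrightarrow> (\<exists>K. \<forall>c\<^sub>1 c\<^sub>2 \<kappa>' a. ?C c\<^sub>1 c\<^sub>2 \<kappa> \<kappa>' \<longrightarrow>
     (\<exists>d\<^sub>0. \<forall>d \<alpha> \<rho> s. ?P \<kappa> \<rho>\<^sub>0 c k K c\<^sub>1 c\<^sub>2 \<kappa>' a d\<^sub>0 d \<alpha> \<rho> s)))")
\<comment> \<open>The exponent 2 makes \<open>\<Lambda>\<close> at least a multiple of
  \<open>L\<^sup>2\<close>; the spacing factor 10 serves the atom at 0;
  \<open>\<rho> \<le> 1/2\<close> gives \<open>sd\<^sup>2 \<ge> 3/4\<close>. The constant in front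
  of both bounds can be 1 because large \<open>L\<close> absorbs all others.\<close>
proof (rule exI[of _ 2], rule exI[of _ 10], rule exI[of _ "1/2"], rule exI[of _ 1], intro conjI allI impI)
  fix k :: nat assume k: "2 \<le> k"
  show "\<exists>K. \<forall>c\<^sub>1 c\<^sub>2 \<kappa>' a. ?C c\<^sub>1 c\<^sub>2 10 \<kappa>' \<longrightarrow> (\<exists>d\<^sub>0. \<forall>d \<alpha> \<rho> s. ?P 10 (1/2) 1 k K c\<^sub>1 c\<^sub>2 \<kappa>' a d\<^sub>0 d \<alpha> \<rho> s)"
  \<comment> \<open>Of the exponent, \<open>k\<close> comes from \<open>\<rho>\<^sup>2\<close>, 2
    from the threshold \<open>\<tau>\<close>, and the remaining power of \<open>L\<close> pays for
    the constant multiple of \<open>c\<^sub>2\<close>.\<close>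
  proof (rule exI[of _ "k + 3"], intro allI impI)
    fix c\<^sub>1 c\<^sub>2 \<kappa>' :: real and a :: nat
    assume "0 < c\<^sub>1 \<and> c\<^sub>1 \<le> c\<^sub>2 \<and> 10 \<le> \<kappa>'"
    then have c: "0 < c\<^sub>1" "c\<^sub>1 \<le> c\<^sub>2" "0 < \<kappa>'" by auto
    obtain d\<^sub>0 where d0: "\<And>d L. d\<^sub>0 \<le> d \<Longrightarrow> ln (real d) \<le> L \<Longrightarrow>
      11 \<le> d \<and> 1 \<le> L \<and> 25 / c\<^sub>1 \<le> L \<and> 12 * 3 * c\<^sub>2 \<le> L \<and> 256 \<le> c\<^sub>1 / \<kappa>'\<^sup>2 * L\<^sup>2 \<and>
      28 * exp (- (c\<^sub>1 / \<kappa>'\<^sup>2 * L\<^sup>2) / 32) \<le> c\<^sub>1 * exp (- 2 * L) \<and>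
      2000000 / c\<^sub>1 * exp (L ^ 3 + 2 * L - L ^ 4 / 16) \<le> 1 / 4 \<and>
      (L \<le> ln (real d) + ln (real d) ^ (a + 1) \<longrightarrow> 2 * L\<^sup>2 \<le> sqrt (real d))"
      by (rule large_dimension[OF c(1,3), of c\<^sub>2 a]) blast
    show "\<exists>d\<^sub>0. \<forall>d \<alpha> \<rho> s. ?P 10 (1/2) 1 k (k + 3) c\<^sub>1 c\<^sub>2 \<kappa>' a d\<^sub>0 d \<alpha> \<rho> s"
    proof (rule exI[of _ d\<^sub>0], intro allI impI, elim conjE)
      fix d :: nat and \<alpha> \<rho> s :: real
      assume d: "d\<^sub>0 \<le> d" "0 < d" and \<alpha>: "0 < \<alpha>" "\<alpha> < 1" "real d powr (- (ln (real d) ^ a)) \<le> \<alpha>"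
        and \<rho>: "0 < \<rho>" "\<rho> \<le> 1/2"
        and snr: "c\<^sub>1 * \<alpha>\<^sup>2 * ln (real d / \<alpha>) ^ k \<le> \<rho>\<^sup>2" "\<rho>\<^sup>2 \<le> c\<^sub>2 * \<alpha>\<^sup>2 * ln (real d / \<alpha>) ^ k"
        and spread: "10 * \<alpha> \<le> s" "s \<le> \<kappa>' * \<alpha>"
      define L where "L = ln (real d / \<alpha>)"
      have Lsplit: "L = ln (real d) - ln \<alpha>" using d \<alpha> by (simp add: L_def ln_div)
      have Ld: "ln (real d) \<le> L" unfolding Lsplit using \<alpha> by simp
      have L_up: "L \<le> ln (real d) + ln (real d) ^ (a + 1)"
      proof -
        have "ln (real d powr (- (ln (real d) ^ a))) \<le> ln \<alpha>" using \<alpha> d by (subst ln_le_cancel_iff) auto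
        then have "- (ln (real d) ^ a) * ln (real d) \<le> ln \<alpha>" using d by (simp add: ln_powr)
        then show ?thesis by (simp add: Lsplit mult.commute)
      qed
      note big = d0[OF d(1) Ld]
      have d11: "11 \<le> d" and L1: "1 \<le> L" and L25: "25 / c\<^sub>1 \<le> L" and Lc2: "12 * 3 * c\<^sub>2 \<le> L"
        and snr256: "256 \<le> c\<^sub>1 / \<kappa>'\<^sup>2 * L\<^sup>2"
        and spacing: "28 * exp (- (c\<^sub>1 / \<kappa>'\<^sup>2 * L\<^sup>2) / 32) \<le> c\<^sub>1 * exp (- 2 * L)"
        and union: "2000000 / c\<^sub>1 * exp (L ^ 3 + 2 * L - L ^ 4 / 16) \<le> 1 / 4"
        and dim: "2 * L\<^sup>2 \<le> sqrt (real d)"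
        using big L_up by auto
      note snr = snr[folded L_def]
      have s0: "0 < s" using spread(1) \<alpha>(1) by linarith
      interpret lattice_noise \<rho> s using \<rho> s0 by unfold_locales auto
      have E_eq: "discrete_gaussian 0 (sqrt (1 - \<rho>\<^sup>2)) 0 s = E" by (simp add: E_def sd_def)
      have Lk: "L\<^sup>2 \<le> L ^ k" using L1 k by (intro power_increasing) auto
      have rho_low: "c\<^sub>1 * \<alpha>\<^sup>2 * L\<^sup>2 \<le> \<rho>\<^sup>2"
      proof -
        have "c\<^sub>1 * \<alpha>\<^sup>2 * L\<^sup>2 \<le> c\<^sub>1 * \<alpha>\<^sup>2 * L ^ k" using Lk c by (intro mult_left_mono) auto
        then show ?thesis using snr(1) by linarith
      qed
      have rho4: "\<rho>\<^sup>2 \<le> 1/4" using power_mono[OF \<rho>(2), of 2] \<rho>(1) by (simp add: power_divide)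
      \<comment> \<open>\<open>\<rho>\<close> is bounded while \<open>\<rho> / \<alpha>\<close>
        grows at least like \<open>L\<close>, so a large \<open>L\<close> forces \<alpha> to be
        small.\<close>
      have \<alpha>10: "\<alpha> \<le> 1/10"
      proof -
        have "25 \<le> c\<^sub>1 * L" using L25 c by (simp add: field_simps)
        also have "\<dots> \<le> c\<^sub>1 * L\<^sup>2" using L1 c by (intro mult_left_mono) (auto simp: power2_eq_square)
        finally have "25 * \<alpha>\<^sup>2 \<le> c\<^sub>1 * L\<^sup>2 * \<alpha>\<^sup>2" by (intro mult_right_mono) auto
        also have "\<dots> \<le> 1/4" using rho_low rho4 by (simp add: mult_ac)
        finally have "\<alpha>\<^sup>2 \<le> (1/10)\<^sup>2" by (simp add: power_divide)
        then show ?thesis by (rule power2_le_imp_le) simp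
      qed
      have mass: "\<alpha> \<le> measure E {0}"
        unfolding E_def using sd(1) by (intro discrete_gaussian_atom \<alpha> \<alpha>10 spread) (auto simp: sd_def)
      have \<Lambda>_low: "c\<^sub>1 / \<kappa>'\<^sup>2 * L\<^sup>2 \<le> \<Lambda>"
      proof -
        have "s\<^sup>2 \<le> (\<kappa>' * \<alpha>)\<^sup>2" using spread s0 by (intro power_mono) auto
        have "c\<^sub>1 / \<kappa>'\<^sup>2 * L\<^sup>2 = c\<^sub>1 * \<alpha>\<^sup>2 * L\<^sup>2 / (\<kappa>' * \<alpha>)\<^sup>2"
          using \<alpha> c by (simp add: power_mult_distrib)
        also have "\<dots> \<le> \<rho>\<^sup>2 / s\<^sup>2"
          using rho_low \<open>s\<^sup>2 \<le> (\<kappa>' * \<alpha>)\<^sup>2\<close> s0 c by (intro frac_le) auto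
        finally show ?thesis by (simp add: \<Lambda>_def)
      qed
      have \<Lambda>4: "4 \<le> \<Lambda>" using \<Lambda>_low snr256 by linarith
      have err: "7 * theta_error \<le> c\<^sub>1 * exp (- 2 * L)"
      proof -
        have "exp (- \<Lambda> / 32) \<le> exp (- (c\<^sub>1 / \<kappa>'\<^sup>2 * L\<^sup>2) / 32)" using \<Lambda>_low by simp
        moreover have "7 * theta_error = 28 * exp (- \<Lambda> / 32)" by (simp add: theta_error_def)
        ultimately show ?thesis using spacing by linarith
      qed
      have err10: "theta_error \<le> 1/10"
      proof -
        \<comment> \<open>\<open>\<Lambda> \<ge> 256\<close> gives the exponent
          \<open>256 / 32 = 8\<close>, and \<open>theta_error\<close> is 4 times the
          exponential.\<close>
        have "41 \<le> exp (8::real)" using exp_lower_Taylor_quadratic[of 8] by simp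
        then have "exp (- 8) \<le> (1 / 40 :: real)" by (simp add: exp_minus field_simps)
        moreover have "exp (- \<Lambda> / 32) \<le> exp (- 8)" using \<Lambda>_low snr256 by simp
        ultimately have "exp (- \<Lambda> / 32) \<le> 1 / 40" by linarith
        then show ?thesis by (simp add: theta_error_def)
      qed
      \<comment> \<open>Chosen so that the exponent \<open>d * \<tau>\<^sup>2 / 16\<close> of the
        tail bound is \<open>L ^ 4 / 16\<close>.\<close>
      define \<tau> where "\<tau> = L\<^sup>2 / sqrt (real d)"
      have sd0: "0 < sqrt (real d)" "sqrt (real d) * sqrt (real d) = real d" using d by auto
      have \<tau>: "0 < \<tau>" "\<tau> \<le> 1/2" using L1 dim sd0 by (auto simp: \<tau>_def field_simps)
      have \<tau>2: "real d * \<tau>\<^sup>2 = L ^ 4" using sd0 d by (simp add: \<tau>_def power_divide power_mult[symmetric])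
      have exp_L: "exp (- 2 * L) = (\<alpha> / real d)\<^sup>2"
      proof -
        have "exp (- L) = \<alpha> / real d" using d \<alpha> by (simp add: Lsplit exp_diff exp_minus)
        moreover have "exp (- 2 * L) = (exp (- L))\<^sup>2" by (simp add: power2_eq_square exp_add[symmetric])
        ultimately show ?thesis by simp
      qed
      \<comment> \<open>This lower bound is used twice: the lattice error has to stay below it, and
        it controls the denominator of \<open>\<beta>\<close>.\<close>
      have signal: "c\<^sub>1 * exp (- 2 * L) \<le> \<rho>\<^sup>2 * \<tau>"
      proof -
        have "(\<alpha> / real d)\<^sup>2 \<le> \<alpha>\<^sup>2 / sqrt (real d)"
        proof -
          have "sqrt (real d) \<le> (real d)\<^sup>2"
          proof (rule real_le_lsqrt)
            have "real d \<le> real d ^ 4" using d11 by (intro self_le_power) auto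
            then show "real d \<le> ((real d)\<^sup>2)\<^sup>2" by (simp add: power_mult[symmetric])
          qed simp_all
          then show ?thesis unfolding power_divide using d by (intro divide_left_mono) auto
        qed
        then have "c\<^sub>1 * exp (- 2 * L) \<le> c\<^sub>1 * (\<alpha>\<^sup>2 / sqrt (real d))" unfolding exp_L using c by (intro mult_left_mono) auto
        also have "\<dots> = c\<^sub>1 * \<alpha>\<^sup>2 * 1 * (1 / sqrt (real d))" by simp
        also have "\<dots> \<le> c\<^sub>1 * \<alpha>\<^sup>2 * L\<^sup>2 * (L\<^sup>2 / sqrt (real d))"
          using L1 c by (intro mult_mono divide_right_mono) (auto simp: one_le_power)
        also have "\<dots> \<le> \<rho>\<^sup>2 * \<tau>" unfolding \<tau>_def using rho_low by (intro mult_right_mono) auto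
        finally show ?thesis .
      qed
      have small: "7 * theta_error \<le> \<rho>\<^sup>2 * \<tau>" using err signal by linarith
      define q\<^sub>0 where "q\<^sub>0 = real d powr L\<^sup>2"
      define m\<^sub>0 where "m\<^sub>0 = sqrt (real d) / (\<alpha>\<^sup>2 * L ^ (k + 3))"
      define \<beta> where "\<beta> = 2000000 * exp (- real d * \<tau>\<^sup>2 / 16) / (\<rho>\<^sup>2 * \<tau>)"
      have \<beta>0: "0 \<le> \<beta>" using \<tau> by (simp add: \<beta>_def)
      have \<beta>q: "q\<^sub>0 * \<beta> \<le> 1/4"
      proof -
        have q: "q\<^sub>0 \<le> exp (L ^ 3)"
        proof -
          have "q\<^sub>0 = exp (L\<^sup>2 * ln (real d))" using d by (simp add: q\<^sub>0_def powr_def)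
          also have "\<dots> \<le> exp (L\<^sup>2 * L)" using Ld by (simp add: mult_left_mono)
          finally show ?thesis by (simp add: power2_eq_square power3_eq_cube)
        qed
        have "\<beta> \<le> 2000000 * exp (- (L ^ 4) / 16) / (c\<^sub>1 * exp (- 2 * L))"
          unfolding \<beta>_def using signal c \<tau> rho2 \<tau>2 by (intro frac_le) (auto simp: minus_mult_left[symmetric])
        also have "\<dots> = 2000000 / c\<^sub>1 * exp (2 * L - L ^ 4 / 16)"
        proof -
          have "2 * L - L ^ 4 / 16 = - (L ^ 4) / 16 - - 2 * L" by simp
          then show ?thesis by (simp only: exp_diff times_divide_times_eq)
        qed
        finally have "q\<^sub>0 * \<beta> \<le> exp (L ^ 3) * (2000000 / c\<^sub>1 * exp (2 * L - L ^ 4 / 16))"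
          using q \<beta>0 by (intro mult_mono) auto
        also have "\<dots> = 2000000 / c\<^sub>1 * exp (L ^ 3 + 2 * L - L ^ 4 / 16)"
          by (simp add: exp_add exp_diff)
        finally show ?thesis using union by linarith
      qed
      have hard: "measure (uniform_sphere d) {v \<in> space (vec_space d). \<not> vstat_answer (alt_dist d \<rho> E v) (f, m) (integral\<^sup>L (null_dist d \<rho> E) f)} \<le> \<beta>"
        if valid: "valid_query d (f, m)" and m: "real m < m\<^sub>0" for f m
        unfolding \<beta>_def
      proof (rule query_uninformative[OF \<rho>(2) \<Lambda>4 err10 \<tau> small d11 valid])
        have pos: "0 < \<alpha>\<^sup>2 * L ^ (k + 3)" using \<alpha> L1 by simp
        have "12 * (\<rho>\<^sup>2 * \<tau>) * real m \<le> 12 * (\<rho>\<^sup>2 * \<tau>) * m\<^sub>0" using m \<tau> by (intro mult_left_mono) auto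
        also have "\<dots> \<le> 12 * (c\<^sub>2 * \<alpha>\<^sup>2 * L ^ k * \<tau>) * m\<^sub>0"
          using snr(2) \<tau> pos by (intro mult_right_mono mult_left_mono) (auto simp: m\<^sub>0_def)
        \<comment> \<open>The powers of \<open>L\<close> combine to
          \<open>k + 2 - (k + 3) = -1\<close>, while \<alpha> and \<open>sqrt d\<close>
          cancel.\<close>
        also have "\<dots> = 12 * c\<^sub>2 / L"
          using \<alpha> L1 sd0 d by (simp add: \<tau>_def m\<^sub>0_def power_add power2_eq_square power3_eq_cube field_simps)
        also have "\<dots> \<le> 1" using Lc2 L1 c by (simp add: divide_le_eq)
        finally show "12 * (\<rho>\<^sup>2 * \<tau>) * real m \<le> 1" .
      qed
      have lower: "(\<exists>\<tau> \<in> possible_runs d \<rho> E M A. q\<^sub>0 \<le> real (length \<tau>)) \<or>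
          (\<exists>\<tau> \<in> possible_runs d \<rho> E M A. \<exists>((f, m), u) \<in> set \<tau>. m\<^sub>0 \<le> real m)"
        if "sq_algorithm d M A" "solves_test d \<rho> E M A (2/3)" for M A
      proof (rule ccontr)
        assume no: "\<not> ?thesis"
        show False
        proof (rule sq_reduction[OF d(2) hard \<beta>0 \<beta>q that])
          show "real (length \<tau>) < q\<^sub>0" if "\<tau> \<in> possible_runs d \<rho> E M A" for \<tau>
            using no that by (auto simp: not_le)
          show "real m < m\<^sub>0" if "\<tau> \<in> possible_runs d \<rho> E M A" "((f, m), u) \<in> set \<tau>" for \<tau> f m u
            using no that by (force simp: not_le)
        qed
      qed
      show "let E = discrete_gaussian 0 (sqrt (1 - \<rho>\<^sup>2)) 0 s;
               q\<^sub>0 = real d powr ((ln (real d / \<alpha>))\<^sup>2);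
               m\<^sub>0 = sqrt (real d) / (\<alpha>\<^sup>2 * ln (real d / \<alpha>) ^ (k + 3))
           in \<alpha> \<le> measure E {0} \<and>
              (\<forall>M A. sq_algorithm d M A \<and> solves_test d \<rho> E M A (2/3) \<longrightarrow>
                 (\<exists>\<tau> \<in> possible_runs d \<rho> E M A. 1 * q\<^sub>0 \<le> real (length \<tau>)) \<or>
                 (\<exists>\<tau> \<in> possible_runs d \<rho> E M A. \<exists>((f, m), u) \<in> set \<tau>. 1 * m\<^sub>0 \<le> real m))"
        unfolding Let_def E_eq L_def[symmetric] q\<^sub>0_def[symmetric] m\<^sub>0_def[symmetric] mult_1
        using mass lower by blast
    qed
  qed
qed simp_all

end
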